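(* Let $n\ge1$, $d=1+n$, $\tau>0$, and let $A$ be a divergence-free positive symmetric tensor (DPT) over the slab $(0,\tau)\times\mathbb{R}^n$, with coordinates $(t,y)$. Assume that $A$ is integrable over the slab and that its normal traces on the boundaries $\{0\}\times\mathbb{R}^n$ and $\{\tau\}\times\mathbb{R}^n$ are bounded (vector-valued) measures. Then $(\det A)^{\frac1n}$ is integrable over the slab and $$\int_0^\tau\!\int_{\mathbb{R}^n}(\det A)^{\frac1n}\,dy\,dt\;\le\;\frac1{(n+1)\,|S^n|^{\frac1n}}\,\Bigl(\|A\vec n\|_{\mathcal{M}(\{0\}\times\mathbb{R}^n)}+\|A\vec n\|_{\mathcal{M}(\{\tau\}\times\mathbb{R}^n)}\Bigr)^{1+\frac1n}.$$
   Context: A divergence-free positive symmetric tensor (DPT) over an open set $\Omega\subset\mathbb{R}^d$ is a measurable field $A:\Omega\to\mathbf{Sym}_d^+$ (real symmetric positive semi-definite $d\times d$ matrices), here in $L^1(\Omega)$, whose row-wise divergence vanishes in the sense of distributions: $\sum_{j}\partial_jA_{ij}=0$ for every $i$. $\vec n$ denotes the outward unit normal of the slab. The normal trace $A\vec n$ is defined by Green's formula: for every compactly supported $\psi\in C^\infty(\mathbb{R}^{1+n};\mathbb{R}^{1+n})$, $\langle A\vec n,\psi\rangle=\int_{(0,\tau)\times\mathbb{R}^n}\mathrm{Tr}(A\nabla\psi)\,dy\,dt$; it is a distribution on the two boundary components. $\|\cdot\|_{\mathcal{M}}$ is the total mass of a vector-valued measure, computed with the Euclidean norm on $\mathbb{R}^{1+n}$.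 $|S^n|$ is the $n$-dimensional area of the unit sphere of $\mathbb{R}^{n+1}$. *)

theory Defs
  imports "HOL-Analysis.Analysis"
begin

section \<open>Test functions\<close>

text \<open>
  \<open>Ck k f\<close>: the map \<open>f\<close> is of class \<open>C\<^sup>k\<close> on the whole space. In finite
  dimension it is enough to ask that all directional derivatives
  \<open>x \<mapsto> Df(x) v\<close> are of class \<open>C\<^sup>k\<close> in order to express that \<open>Df\<close> is.
\<close>

primrec Ck :: "nat \<Rightarrow> ('a::euclidean_space \<Rightarrow> 'b::euclidean_space) \<Rightarrow> bool" where
  "Ck 0 f \<longleftrightarrow> continuous_on UNIV f"
| "Ck (Suc k) f \<longleftrightarrow> (\<forall>x. f differentiable (at x)) \<and>
      (\<forall>v. Ck k (\<lambda>x. frechet_derivative f (at x) v))"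

definition test_function ::
    "'a set \<Rightarrow> ('a::euclidean_space \<Rightarrow> 'b::euclidean_space) \<Rightarrow> bool" where
  "test_function \<Omega> \<phi> \<longleftrightarrow> (\<forall>k. Ck k \<phi>) \<and>
     compact (closure {x. \<phi> x \<noteq> 0}) \<and> closure {x. \<phi> x \<noteq> 0} \<subseteq> \<Omega>"

definition partial_deriv :: "'d \<Rightarrow> (real^'d \<Rightarrow> real) \<Rightarrow> real^'d::finite \<Rightarrow> real" where
  "partial_deriv j \<phi> x = frechet_derivative \<phi> (at x) (axis j 1)"


section \<open>Divergence-free positive symmetric tensors\<close>

definition sym_psd :: "real^'d^'d \<Rightarrow> bool" where
  "sym_psd M \<longleftrightarrow> transpose M = M \<and> (\<forall>v. 0 \<le> v \<bullet> (M *v v))"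

text \<open>
  The field \<open>A\<close> is a total function of which only the restriction to \<open>\<Omega>\<close> matters.
  The last clause is \<open>\<Sum>\<^sub>j \<partial>\<^sub>j A\<^sub>i\<^sub>j = 0\<close> in the sense of distributions on \<open>\<Omega>\<close>,
  for every row \<open>i\<close>.
\<close>

definition DPT :: "(real^'d::finite) set \<Rightarrow> (real^'d \<Rightarrow> real^'d^'d) \<Rightarrow> bool" where
  "DPT \<Omega> A \<longleftrightarrow> open \<Omega> \<and> integrable (lebesgue_on \<Omega>) A \<and> (\<forall>x\<in>\<Omega>. sym_psd (A x)) \<and>
     (\<forall>i. \<forall>\<phi>. test_function \<Omega> \<phi> \<longrightarrow>
        (\<Sum>j\<in>UNIV. - (LINT x|lebesgue_on \<Omega>. A x $ i $ j * partial_deriv j \<phi> x)) = 0)"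


section \<open>Vector-valued measures\<close>

text \<open>
  A vector-valued measure is a countably additive set function on the sets of a
  sigma-algebra. The latter is given, as usual, as \<open>sets M\<close>; the values of the measure
  \<open>M\<close> itself play no role.
\<close>

definition vector_measure ::
    "'a measure \<Rightarrow> ('a set \<Rightarrow> 'b::real_normed_vector) \<Rightarrow> bool" where
  "vector_measure M \<mu> \<longleftrightarrow>
     (\<forall>B::nat \<Rightarrow> 'a set. range B \<subseteq> sets M \<and> disjoint_family B \<longrightarrow> (\<lambda>i. \<mu> (B i)) sums \<mu> (\<Union>i. B i))"

definition total_mass ::
    "'a measure \<Rightarrow> ('a set \<Rightarrow> 'b::real_normed_vector) \<Rightarrow> ennreal" where
  "total_mass M \<mu> =
     (SUP P\<in>{P. finite P \<and> P \<subseteq> sets M \<and> partition_on (space M) P}. \<Sum>B\<in>P. ennreal (norm (\<mu> B)))"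

definition bounded_vector_measure ::
    "'a measure \<Rightarrow> ('a set \<Rightarrow> 'b::real_normed_vector) \<Rightarrow> bool" where
  "bounded_vector_measure M \<mu> \<longleftrightarrow> vector_measure M \<mu> \<and> total_mass M \<mu> < \<infinity>"

text \<open>
  Positive part (upper variation) in the Jordan decomposition of a real-valued measure \<open>\<mu>\<close>.
  As \<open>ennreal\<close> maps negative numbers to \<open>0 = \<mu> {}\<close>, the supremum below is
  \<open>sup {\<mu> E | E \<subseteq> B}\<close>. The negative part is the positive part of \<open>- \<mu>\<close>.
\<close>

definition pos_part :: "'a measure \<Rightarrow> ('a set \<Rightarrow> real) \<Rightarrow> 'a measure" where
  "pos_part M \<mu> = measure_of (space M) (sets M) (\<lambda>B. SUP E\<in>{E\<in>sets M. E \<subseteq> B}. ennreal (\<mu> E))"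

definition signed_integral :: "'a measure \<Rightarrow> ('a set \<Rightarrow> real) \<Rightarrow> ('a \<Rightarrow> real) \<Rightarrow> real" where
  "signed_integral M \<mu> f =
     integral\<^sup>L (pos_part M \<mu>) f - integral\<^sup>L (pos_part M (\<lambda>B. - \<mu> B)) f"

definition vector_integral ::
    "'a measure \<Rightarrow> ('a set \<Rightarrow> real^'d::finite) \<Rightarrow> ('a \<Rightarrow> real^'d) \<Rightarrow> real" where
  "vector_integral M \<mu> \<psi> = (\<Sum>i\<in>UNIV. signed_integral M (\<lambda>B. \<mu> B $ i) (\<lambda>x. \<psi> x $ i))"

lemma sets_pos_part [simp]: "sets (pos_part M \<mu>) = sets M"
  and space_pos_part [simp]: "space (pos_part M \<mu>) = space M"
  by (auto simp: pos_part_def)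

lemma vector_measure_empty: "vector_measure M \<mu> \<Longrightarrow> \<mu> {} = 0"
proof -
  assume "vector_measure M \<mu>"
  moreover have "range (\<lambda>_::nat. {}) \<subseteq> sets M" "disjoint_family (\<lambda>_::nat. {})"
    by (auto simp: disjoint_family_on_def)
  ultimately have "(\<lambda>i::nat. \<mu> {}) sums \<mu> (\<Union>i::nat. {})"
    unfolding vector_measure_def by blast
  then show "\<mu> {} = 0"
    by (metis sums_summable summable_const_iff)
qed

lemma vector_measure_Un:
  assumes "vector_measure M \<mu>" "E \<in> sets M" "F \<in> sets M" "E \<inter> F = {}"
  shows "\<mu> (E \<union> F) = \<mu> E + \<mu> F"
proof -
  have "(\<lambda>i. \<mu> (binaryset E F i)) sums \<mu> (\<Union>i. binaryset E F i)"
  proof -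
    have "range (binaryset E F) \<subseteq> sets M"
      using assms by (auto simp: range_binaryset_eq)
    moreover have "disjoint_family (binaryset E F)"
      using assms by (auto simp: disjoint_family_on_def binaryset_def)
    ultimately show ?thesis
      using assms(1) unfolding vector_measure_def by blast
  qed
  moreover have "(\<lambda>i. \<mu> (binaryset E F i)) sums (\<mu> E + \<mu> F)"
    using binaryset_sums[of \<mu> E F] vector_measure_empty[OF assms(1)] by simp
  ultimately show ?thesis
    by (simp add: sums_unique2 UN_binaryset_eq)
qed

text \<open>The set function in the definition of \<^const>\<open>pos_part\<close> is indeed a measure.\<close>

lemma emeasure_pos_part:
  fixes \<mu> :: "'a set \<Rightarrow> real"
  assumes \<mu>: "vector_measure M \<mu>" and B: "B \<in> sets M"
  shows "emeasure (pos_part M \<mu>) B = (SUP E\<in>{E\<in>sets M. E \<subseteq> B}. ennreal (\<mu> E))"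
proof -
  define p where "p B = (SUP E\<in>{E\<in>sets M. E \<subseteq> B}. ennreal (\<mu> E))" for B
  have p_ge: "ennreal (\<mu> E) \<le> p B" if "E \<in> sets M" "E \<subseteq> B" for E B
    unfolding p_def using that by (intro SUP_upper) auto
  have p_mono: "p B \<le> p C" if "B \<subseteq> C" for B C
    unfolding p_def using that by (intro SUP_subset_mono) auto
  have p0: "p {} = 0"
  proof -
    have "{E \<in> sets M. E \<subseteq> {}} = {{}}" by auto
    then show ?thesis unfolding p_def using vector_measure_empty[OF \<mu>] by simp
  qed
  have p_Un: "p B + p C \<le> p (B \<union> C)" if "B \<inter> C = {}" for B C
  proof -
    have *: "ennreal (\<mu> E) + ennreal (\<mu> F) \<le> p (B \<union> C)"
      if EF: "E \<in> sets M" "E \<subseteq> B" "F \<in> sets M" "F \<subseteq> C" for E F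
    proof (cases "\<mu> E \<ge> 0 \<and> \<mu> F \<ge> 0")
      case True
      have "\<mu> (E \<union> F) = \<mu> E + \<mu> F"
        using EF \<open>B \<inter> C = {}\<close> by (intro vector_measure_Un[OF \<mu>]) auto
      then have "ennreal (\<mu> E) + ennreal (\<mu> F) = ennreal (\<mu> (E \<union> F))"
        using True by simp
      also have "\<dots> \<le> p (B \<union> C)" using EF by (intro p_ge) auto
      finally show ?thesis .
    next
      case False
      then have "ennreal (\<mu> E) + ennreal (\<mu> F) \<le> max (ennreal (\<mu> E)) (ennreal (\<mu> F))"
        by (auto simp: ennreal_neg)
      also have "\<dots> \<le> p (B \<union> C)" using EF by (intro max.boundedI p_ge) auto
      finally show ?thesis .
    qed
    have ne: "{E\<in>sets M. E \<subseteq> X} \<noteq> {}" for X by auto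
    have "ennreal (\<mu> E) + p C \<le> p (B \<union> C)" if "E \<in> sets M" "E \<subseteq> B" for E
      unfolding p_def[of C] ennreal_SUP_add_right[OF ne]
      using * that by (intro SUP_least) auto
    then show ?thesis
      unfolding p_def[of B] by (subst ennreal_SUP_add_left[OF ne, symmetric]) (auto intro: SUP_least)
  qed
  have "countably_additive (sets M) p"
  proof (rule countably_additiveI)
    fix A :: "nat \<Rightarrow> 'a set"
    assume A: "range A \<subseteq> sets M" "disjoint_family A" "\<Union>(range A) \<in> sets M"
    have fin: "(\<Sum>i<n. p (A i)) \<le> p (\<Union>i<n. A i)" for n
    proof (induction n)
      case (Suc n)
      have "A i \<inter> A n = {}" if "i < n" for i
        using that by (intro disjoint_family_onD[OF A(2)]) auto
      then have "(\<Union>i<n. A i) \<inter> A n = {}" by auto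
      then have "p (\<Union>i<n. A i) + p (A n) \<le> p ((\<Union>i<n. A i) \<union> A n)" by (rule p_Un)
      moreover have "(\<Union>i<n. A i) \<union> A n = (\<Union>i<Suc n. A i)" by (auto simp: less_Suc_eq)
      ultimately have "p (\<Union>i<n. A i) + p (A n) \<le> p (\<Union>i<Suc n. A i)" by (simp only:)
      then show ?case using add_right_mono[OF Suc, of "p (A n)"] by (simp only: sum.lessThan_Suc)
    qed (simp add: p0)
    have 1: "(\<Sum>i. p (A i)) \<le> p (\<Union>(range A))"
      by (intro suminf_le_const) (auto intro!: order_trans[OF fin] p_mono)
    have 2: "p (\<Union>(range A)) \<le> (\<Sum>i. p (A i))"
      unfolding p_def[of "\<Union>(range A)"]
    proof (intro SUP_least, clarsimp)
      fix E assume E: "E \<in> sets M" "E \<subseteq> \<Union>(range A)"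
      have "range (\<lambda>i. E \<inter> A i) \<subseteq> sets M \<and> disjoint_family (\<lambda>i. E \<inter> A i)"
        using A E by (auto simp: disjoint_family_on_def)
      then have "(\<lambda>i. \<mu> (E \<inter> A i)) sums \<mu> (\<Union>i. E \<inter> A i)"
        using \<mu> unfolding vector_measure_def by blast
      moreover have "(\<Union>i. E \<inter> A i) = E" using E by auto
      ultimately have "(\<lambda>n. \<Sum>i<n. \<mu> (E \<inter> A i)) \<longlonglongrightarrow> \<mu> E" by (simp add: sums_def)
      then have "(\<lambda>n. ennreal (\<Sum>i<n. \<mu> (E \<inter> A i))) \<longlonglongrightarrow> ennreal (\<mu> E)"
        by (rule tendsto_ennrealI)
      moreover have "ennreal (\<Sum>i<n. \<mu> (E \<inter> A i)) \<le> (\<Sum>i. p (A i))" for n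
      proof -
        have "ennreal (\<Sum>i<n. \<mu> (E \<inter> A i)) \<le> ennreal (\<Sum>i<n. max 0 (\<mu> (E \<inter> A i)))"
          by (intro ennreal_leI sum_mono) auto
        also have "\<dots> = (\<Sum>i<n. ennreal (max 0 (\<mu> (E \<inter> A i))))"
          by (simp add: sum_ennreal)
        also have "\<dots> \<le> (\<Sum>i<n. p (A i))"
          using A E by (intro sum_mono) (auto simp: max_def intro!: p_ge)
        also have "\<dots> \<le> (\<Sum>i. p (A i))" by (intro sum_le_suminf) auto
        finally show ?thesis .
      qed
      ultimately show "ennreal (\<mu> E) \<le> (\<Sum>i. p (A i))"
        by (intro LIMSEQ_le_const2) auto
    qed
    show "(\<Sum>i. p (A i)) = p (\<Union>(range A))" using 1 2 by (rule antisym)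
  qed
  then show ?thesis
    using B p0 unfolding pos_part_def p_def[symmetric]
    by (intro emeasure_measure_of_sigma) (auto simp: positive_def sets.sigma_algebra_axioms)
qed


section \<open>The slab and the normal trace\<close>

text \<open>
  The space \<open>\<real>\<^sup>1\<^sup>+\<^sup>n\<close> is \<open>real^('n option)\<close>, with \<open>n = CARD('n)\<close>: the coordinate \<open>None\<close> is
  the time \<open>t\<close> and the coordinates \<open>Some i\<close> form the point \<open>y \<in> \<real>\<^sup>n\<close>.
\<close>

definition slab :: "real \<Rightarrow> (real^('n::finite option)) set" where
  "slab \<tau> = {x. 0 < x $ None \<and> x $ None < \<tau>}"

definition time_slice :: "real \<Rightarrow> (real^('n::finite option)) set" where
  "time_slice s = {x. x $ None = s}"

definition borel_slice :: "real \<Rightarrow> (real^('n::finite option)) measure" where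
  "borel_slice s = restrict_space borel (time_slice s)"

definition normal_trace ::
    "real \<Rightarrow> (real^('n::finite option) \<Rightarrow> real^('n option)^('n option)) \<Rightarrow>
     (real^('n option) \<Rightarrow> real^('n option)) \<Rightarrow> real" where
  "normal_trace \<tau> A \<psi> = (LINT x|lebesgue_on (slab \<tau>). trace (A x ** jacobian \<psi> (at x)))"

text \<open>
  The normal trace of \<open>A\<close> is the distribution given by the measures \<open>\<mu>\<^sub>0\<close> and \<open>\<mu>\<^sub>1\<close> on the
  boundary components \<open>t = 0\<close> and \<open>t = \<tau>\<close>.
\<close>

definition normal_traces_are ::
    "real \<Rightarrow> (real^('n::finite option) \<Rightarrow> real^('n option)^('n option)) \<Rightarrow>
     ((real^('n option)) set \<Rightarrow> real^('n option)) \<Rightarrow>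
     ((real^('n option)) set \<Rightarrow> real^('n option)) \<Rightarrow> bool" where
  "normal_traces_are \<tau> A \<mu>\<^sub>0 \<mu>\<^sub>1 \<longleftrightarrow>
     (\<forall>\<psi>. test_function UNIV \<psi> \<longrightarrow>
        normal_trace \<tau> A \<psi> =
          vector_integral (borel_slice 0) \<mu>\<^sub>0 \<psi> + vector_integral (borel_slice \<tau>) \<mu>\<^sub>1 \<psi>)"


section \<open>Surface area\<close>

text \<open>
  The area of a compact hypersurface, as the limit of the volume of its tubular
  neighbourhood of radius \<open>\<epsilon>\<close> divided by the thickness \<open>2 \<epsilon>\<close> (Minkowski content).
\<close>

definition surface_area :: "'a::euclidean_space set \<Rightarrow> real" where
  "surface_area S = Lim (at_right 0) (\<lambda>\<epsilon>. measure lebesgue {x. infdist x S < \<epsilon>} / (2 * \<epsilon>))"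

lemma infdist_unit_sphere:
  fixes x :: "'a::euclidean_space"
  shows "infdist x (sphere 0 1) = \<bar>norm x - 1\<bar>"
proof (rule antisym)
  show "infdist x (sphere 0 1) \<le> \<bar>norm x - 1\<bar>"
  proof (cases "x = 0")
    case True
    obtain b :: 'a where "b \<in> Basis" using nonempty_Basis by blast
    then have "infdist x (sphere 0 1) \<le> dist x b" by (intro infdist_le) auto
    then show ?thesis using True \<open>b \<in> Basis\<close> by simp
  next
    case False
    have "infdist x (sphere 0 1) \<le> dist x (x /\<^sub>R norm x)"
      using False by (intro infdist_le) auto
    also have "\<dots> = norm ((1 - inverse (norm x)) *\<^sub>R x)"
      by (simp add: dist_norm algebra_simps)
    also have "\<dots> = \<bar>(1 - inverse (norm x)) * norm x\<bar>" by (simp add: abs_mult)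
    also have "(1 - inverse (norm x)) * norm x = norm x - 1" using False by (simp add: field_simps)
    finally show ?thesis .
  qed
next
  obtain b :: 'a where "b \<in> Basis" using nonempty_Basis by blast
  then have ne: "sphere (0::'a) 1 \<noteq> {}" by (metis norm_Basis mem_sphere_0 empty_iff)
  moreover have "\<bar>norm x - 1\<bar> \<le> dist x a" if "a \<in> sphere 0 1" for a
    using that norm_triangle_ineq3[of x a] by (simp add: dist_norm)
  ultimately show "\<bar>norm x - 1\<bar> \<le> infdist x (sphere 0 1)"
    unfolding infdist_notempty[OF ne] by (intro cINF_greatest)
qed

text \<open>The usual value: \<open>|S\<^sup>d\<^sup>-\<^sup>1|\<close> is \<open>d\<close> times the volume of the unit ball of \<open>\<real>\<^sup>d\<close>.\<close>

lemma surface_area_unit_sphere: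
  "surface_area (sphere (0::'a::euclidean_space) 1) = DIM('a) * unit_ball_vol DIM('a)"
proof -
  let ?d = "DIM('a)" and ?c = "unit_ball_vol DIM('a)"
  let ?f = "\<lambda>\<epsilon>. measure lebesgue {x::'a. infdist x (sphere 0 1) < \<epsilon>} / (2 * \<epsilon>)"
  let ?g = "\<lambda>\<epsilon>::real. (1 + \<epsilon>) ^ ?d - (1 - \<epsilon>) ^ ?d"
  have eq: "?f \<epsilon> = ?c / 2 * (?g \<epsilon> / \<epsilon>)" if \<epsilon>: "0 < \<epsilon>" "\<epsilon> < 1" for \<epsilon>
  proof -
    have "{x::'a. infdist x (sphere 0 1) < \<epsilon>} = ball 0 (1 + \<epsilon>) - cball 0 (1 - \<epsilon>)"
      by (auto simp: infdist_unit_sphere)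
    then have "?f \<epsilon> = measure lebesgue (ball (0::'a) (1 + \<epsilon>) - cball 0 (1 - \<epsilon>)) / (2 * \<epsilon>)"
      by simp
    also have "measure lebesgue (ball (0::'a) (1 + \<epsilon>) - cball 0 (1 - \<epsilon>)) =
        measure lebesgue (ball (0::'a) (1 + \<epsilon>)) - measure lebesgue (cball (0::'a) (1 - \<epsilon>))"
      using \<epsilon> by (intro measurable_measure_Diff) auto
    also have "\<dots> = ?c * ?g \<epsilon>"
      using \<epsilon> by (simp add: content_ball content_cball algebra_simps)
    finally show ?thesis by simp
  qed
  have "(?g has_real_derivative 2 * ?d) (at 0)"
    by (auto intro!: derivative_eq_intros)
  then have "((\<lambda>\<epsilon>. ?g \<epsilon> / \<epsilon>) \<longlongrightarrow> 2 * ?d) (at 0)"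
    by (simp add: DERIV_def)
  then have "((\<lambda>\<epsilon>. ?g \<epsilon> / \<epsilon>) \<longlongrightarrow> 2 * ?d) (at_right 0)"
    by (rule filterlim_mono) (auto simp: at_le)
  then have "((\<lambda>\<epsilon>. ?c / 2 * (?g \<epsilon> / \<epsilon>)) \<longlongrightarrow> ?c / 2 * (2 * ?d)) (at_right 0)"
    by (intro tendsto_intros)
  moreover have "\<forall>\<^sub>F \<epsilon> in at_right 0. ?c / 2 * (?g \<epsilon> / \<epsilon>) = ?f \<epsilon>"
    using eventually_at_right_real[OF zero_less_one] by (rule eventually_mono) (use eq in auto)
  ultimately have "(?f \<longlongrightarrow> ?c / 2 * (2 * ?d)) (at_right 0)"
    by (rule Lim_transform_eventually)
  then have "Lim (at_right 0) ?f = ?c / 2 * (2 * ?d)"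
    by (intro tendsto_Lim) auto
  then show ?thesis by (simp add: surface_area_def)
qed

end

theory Submission
  imports Defs
begin

text \<open>
  Write \<open>d = n + 1\<close> and \<open>a = (det A) powr (1/d)\<close>. Testing against \<open>q = (det A) powr (1/(n d))\<close>, truncated,
  and rearranging powers, it suffices to bound \<open>d \<integral> a q\<close> by \<open>R M\<close>, where \<open>M\<close> is the total mass of the
  traces, \<open>q \<ge> 0\<close> is continuous with compact support, and \<open>R\<close> is given by \<open>\<integral> q^d = |B_R|\<close>.
  If \<open>w\<close> is a smooth convex function with \<open>|\<nabla>w| \<le> R\<close> and \<open>det D\<^sup>2w \<ge> q^d\<close>, testing the normal traces with
  \<open>\<nabla>w\<close> times a cutoff gives \<open>\<integral> Tr (A D\<^sup>2w) \<le> R M\<close>, and \<open>Tr (A D\<^sup>2w) \<ge> d (det A det D\<^sup>2w) powr (1/d) \<ge> d a q\<close>.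

  Such a \<open>w\<close> is needed only with \<open>q\<close> replaced by a mollification \<open>\<rho> * q\<close>, so no regularity theory
  for the Monge-Ampere equation is required. On a lattice of mesh \<open>h\<close>, minimising Kantorovich's dual functional yields a
  convex \<open>u\<close> with subgradients in \<open>B_R\<close> whose subdifferential at each lattice point has at least the
  volume \<open>\<integral> q^d\<close> over the corresponding cell (Alexandrov). By the Brunn-Minkowski inequality, averaging the
  lattice translates of \<open>u\<close> with the weights of \<open>\<rho>\<close> carries this lower bound over to the mollified
  data, and \<open>h \<rightarrow> 0\<close> gives \<open>det D\<^sup>2(\<rho> * u) \<ge> (\<rho> * q)^d\<close>.
\<close>

section \<open>Smooth bump functions\<close>

text \<open>The exponents are forced by \<open>1/d + 1/(n d) = 1/n\<close>: both \<open>a q\<close>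
  and \<open>q^d\<close> then equal \<open>(det A) powr (1/n)\<close>. With \<open>I\<close> the
  integral of this function and \<open>\<omega>\<close> the volume of the unit ball, the bound
  \<open>R M\<close> turns into \<open>d I \<le> M (I / \<omega>) powr (1/d)\<close>, that is,
  \<open>I \<le> M powr (1 + 1/n) / (d (d \<omega>) powr (1/n))\<close>, and
  \<open>d \<omega>\<close> is the area of the unit sphere. Solving for \<open>I\<close> divides by
  a power of \<open>I\<close>, so finiteness must be known beforehand; hence the truncation. A ball
  is the natural target for the gradient: the total masses use the Euclidean norm, so only the
  largest norm of a gradient counts, while the volume of the target must equal the mass of
  \<open>q^d\<close>. The obstacle is that an Alexandrov solution is convex but need not be twice
  differentiable, so its Monge-Ampere measure cannot be compared directly with a Hessian
  determinant. The lattice helps because lattice translations permute the lattice points, and at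
  each of them subdifferentials of translates can be added as sets. Brunn-Minkowski makes the
  \<open>d\<close>-th root of their volume superadditive, which is why the mollified datum is
  \<open>q\<close> and not \<open>q^d\<close>.\<close>

lemma Ck_SucI:
  assumes "\<And>x. (f has_derivative F x) (at x)" "\<And>v. Ck k (\<lambda>x. F x v)"
  shows "Ck (Suc k) f"
proof -
  have "frechet_derivative f (at x) = F x" for x
    using frechet_derivative_at[OF assms(1)] by simp
  then show ?thesis using assms by (auto simp: differentiable_def)
qed

lemma Ck_SucD:
  assumes "Ck (Suc k) f"
  shows "(f has_derivative frechet_derivative f (at x)) (at x)" "Ck k (\<lambda>x. frechet_derivative f (at x) v)"
  using assms by (auto simp: frechet_derivative_works)

lemma Ck_continuous:
  assumes "Ck k f" shows "continuous_on S f"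
proof (cases k)
  case 0
  then show ?thesis using assms continuous_on_subset by fastforce
next
  case (Suc j)
  then show ?thesis using assms
    by (auto intro!: continuous_at_imp_continuous_on differentiable_imp_continuous_within)
qed

lemma Ck_Suc_imp_Ck: "Ck (Suc k) f \<Longrightarrow> Ck k f"
proof (induction k arbitrary: f)
  case 0
  then show ?case using Ck_continuous by (simp only: Ck.simps(1))
next
  case (Suc k)
  show ?case
    by (rule Ck_SucI[OF Ck_SucD(1)[OF Suc.prems]]) (rule Suc.IH[OF Ck_SucD(2)[OF Suc.prems]])
qed

lemma Ck_const: "Ck k (\<lambda>x. c)"
proof (induction k arbitrary: c)
  case (Suc k)
  show ?case by (rule Ck_SucI[of _ "\<lambda>x v. 0"]) (auto intro: Suc)
qed simp

lemma Ck_inner_right: "Ck k (\<lambda>x. x \<bullet> w)"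
proof (cases k)
  case (Suc j)
  show ?thesis unfolding Suc by (rule Ck_SucI[of _ "\<lambda>x v. v \<bullet> w"]) (auto intro: Ck_const derivative_eq_intros)
qed (simp add: continuous_intros)

lemma Ck_add: "Ck k f \<Longrightarrow> Ck k g \<Longrightarrow> Ck k (\<lambda>x. f x + g x)"
proof (induction k arbitrary: f g)
  case 0 then show ?case by (simp add: continuous_on_add)
next
  case (Suc k)
  show ?case
    by (rule Ck_SucI[OF has_derivative_add[OF Ck_SucD(1)[OF Suc.prems(1)] Ck_SucD(1)[OF Suc.prems(2)]]])
       (intro Suc.IH Ck_SucD(2)[OF Suc.prems(1)] Ck_SucD(2)[OF Suc.prems(2)])
qed

lemma Ck_scaleR:
  fixes f :: "'a::euclidean_space \<Rightarrow> real" and g :: "'a \<Rightarrow> 'b::euclidean_space"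
  shows "Ck k f \<Longrightarrow> Ck k g \<Longrightarrow> Ck k (\<lambda>x. f x *\<^sub>R g x)"
proof (induction k arbitrary: f g)
  case 0 then show ?case by (simp add: continuous_on_scaleR)
next
  case (Suc k)
  show ?case
    by (rule Ck_SucI[OF has_derivative_scaleR[OF Ck_SucD(1)[OF Suc.prems(1)] Ck_SucD(1)[OF Suc.prems(2)]]])
       (intro Ck_add Suc.IH Ck_SucD(2)[OF Suc.prems(1)] Ck_SucD(2)[OF Suc.prems(2)]
          Ck_Suc_imp_Ck[OF Suc.prems(1)] Ck_Suc_imp_Ck[OF Suc.prems(2)])
qed

lemma Ck_mult:
  fixes f g :: "'a::euclidean_space \<Rightarrow> real"
  shows "Ck k f \<Longrightarrow> Ck k g \<Longrightarrow> Ck k (\<lambda>x. f x * g x)"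
  using Ck_scaleR[of k f g] by simp

lemma Ck_sum: "finite I \<Longrightarrow> (\<And>i. i \<in> I \<Longrightarrow> Ck k (f i)) \<Longrightarrow> Ck k (\<lambda>x. \<Sum>i\<in>I. f i x)"
  by (induction I rule: finite_induct) (auto intro: Ck_const Ck_add)

lemma Ck_vec:
  fixes f :: "'a::euclidean_space \<Rightarrow> real^'d::finite"
  assumes "\<And>i. Ck k (\<lambda>x. f x $ i)"
  shows "Ck k f"
proof -
  have "f = (\<lambda>x. \<Sum>i\<in>UNIV. f x $ i *\<^sub>R axis i 1)"
    by (intro ext) (simp add: basis_expansion flip: scalar_mult_eq_scaleR)
  moreover have "Ck k (\<lambda>x. \<Sum>i\<in>UNIV. f x $ i *\<^sub>R axis i (1::real))"
    by (intro Ck_sum Ck_scaleR assms Ck_const) auto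
  ultimately show ?thesis by simp
qed

section \<open>Flat function and radial bumps\<close>

definition flat_exp :: "nat \<Rightarrow> real \<Rightarrow> real" where
  "flat_exp m t = (if t \<le> 0 then 0 else exp (- inverse t) * inverse t ^ m)"

lemma flat_exp_nonneg: "flat_exp m t \<ge> 0"
  by (simp add: flat_exp_def)

lemma flat_exp_tendsto_0: "(flat_exp m \<longlongrightarrow> 0) (at_right 0)"
proof -
  have "((\<lambda>s::real. s ^ m / exp s) \<longlongrightarrow> 0) at_top" by (rule tendsto_power_div_exp_0)
  then have "((\<lambda>t::real. inverse t ^ m / exp (inverse t)) \<longlongrightarrow> 0) (at_right 0)"
    by (rule filterlim_compose) (rule filterlim_inverse_at_top_right)
  moreover have "\<forall>\<^sub>F t in at_right 0. inverse t ^ m / exp (inverse t) = flat_exp m t"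
    by (auto simp: eventually_at_right_field flat_exp_def exp_minus field_simps intro!: exI[of _ 1])
  ultimately show ?thesis by (rule Lim_transform_eventually)
qed

text \<open>The exponent \<open>m\<close> is carried for the sake of this formula: differentiation
  stays inside the family, so smoothness is an induction on the order with \<open>m\<close>
  arbitrary. Only at 0 is a limit needed.\<close>

lemma flat_exp_DERIV: "(flat_exp m has_real_derivative flat_exp (m + 2) t - m * flat_exp (m + 1) t) (at t)"
proof -
  consider "t < 0" | "t = 0" | "t > 0" by linarith
  then show ?thesis
  proof cases
    case 1
    have "((\<lambda>_. 0) has_real_derivative 0) (at t)" by simp
    then have "(flat_exp m has_real_derivative 0) (at t)"
      by (rule has_field_derivative_transform_within_open[of _ _ _ "{..<0}"]) (use 1 in \<open>auto simp: flat_exp_def\<close>)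
    then show ?thesis using 1 by (simp add: flat_exp_def)
  next
    case 2
    have "((\<lambda>h. flat_exp m h / h) \<longlongrightarrow> 0) (at_right 0)"
    proof (rule Lim_transform_eventually[OF flat_exp_tendsto_0[of "m + 1"]])
      show "\<forall>\<^sub>F t in at_right 0. flat_exp (m + 1) t = flat_exp m t / t"
        by (auto simp: eventually_at_right_field flat_exp_def field_simps intro!: exI[of _ 1])
    qed
    moreover have "((\<lambda>h. flat_exp m h / h) \<longlongrightarrow> 0) (at_left 0)"
    proof (rule Lim_transform_eventually[OF tendsto_const])
      show "\<forall>\<^sub>F t in at_left 0. 0 = flat_exp m t / t"
        by (auto simp: eventually_at_left_field flat_exp_def intro!: exI[of _ "-1"])
    qed
    ultimately have "((\<lambda>h. flat_exp m h / h) \<longlongrightarrow> 0) (at 0)" by (simp add: filterlim_at_split)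
    then have "(flat_exp m has_real_derivative 0) (at 0)" by (simp add: DERIV_def flat_exp_def)
    then show ?thesis using 2 by (simp add: flat_exp_def)
  next
    case 3
    have "((\<lambda>t. exp (- inverse t) * inverse t ^ m) has_real_derivative
        flat_exp (m + 2) t - m * flat_exp (m + 1) t) (at t)"
    proof -
      have "(inverse has_real_derivative - (inverse t ^ 2)) (at t)"
        using DERIV_inverse[of t UNIV] 3 by (simp add: power2_eq_square numeral_2_eq_2)
      from DERIV_mult[OF DERIV_fun_exp[OF DERIV_minus[OF this]] DERIV_power[OF this, of m]]
      have "((\<lambda>t. exp (- inverse t) * inverse t ^ m) has_real_derivative
          exp (- inverse t) * inverse t ^ 2 * inverse t ^ m + real m * (- (inverse t ^ 2) * inverse t ^ (m - 1)) * exp (- inverse t)) (at t)"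
        by simp
      moreover have "real m * (inverse t ^ 2 * inverse t ^ (m - 1)) = real m * inverse t ^ (m + 1)"
        by (cases m) (simp_all add: power2_eq_square)
      then have "exp (- inverse t) * inverse t ^ 2 * inverse t ^ m + real m * (- (inverse t ^ 2) * inverse t ^ (m - 1)) * exp (- inverse t)
          = flat_exp (m + 2) t - m * flat_exp (m + 1) t"
        using 3 by (simp add: flat_exp_def power2_eq_square)
      ultimately show ?thesis by simp
    qed
    then show ?thesis
      by (rule has_field_derivative_transform_within_open[of _ _ _ "{0<..}"]) (use 3 in \<open>auto simp: flat_exp_def\<close>)
  qed
qed

text \<open>Composition with \<open>1 - s * (x \<bullet> x)\<close> puts the support in the ball of
  radius \<open>1 / sqrt s\<close>. The one parameter serves both the concentrating mollifiers
  (large \<open>s\<close>) and the spreading cutoffs (small \<open>s\<close>).\<close>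

definition bump_at :: "nat \<Rightarrow> real \<Rightarrow> 'a::euclidean_space \<Rightarrow> real" where
  "bump_at m s x = flat_exp m (1 - s * (x \<bullet> x))"

abbreviation bump :: "real \<Rightarrow> 'a::euclidean_space \<Rightarrow> real" where
  "bump \<equiv> bump_at 0"

lemma bump_at_has_derivative:
  "(bump_at m s has_derivative (\<lambda>v. (bump_at (m + 2) s x - m * bump_at (m + 1) s x) * (- 2 * s * (x \<bullet> v)))) (at x)"
proof -
  have "((\<lambda>x. 1 - s * (x \<bullet> x)) has_derivative (\<lambda>v. - 2 * s * (x \<bullet> v))) (at x)"
    by (auto intro!: derivative_eq_intros simp: inner_commute)
  from DERIV_compose_FDERIV[OF flat_exp_DERIV this] show ?thesis
    unfolding bump_at_def by (simp add: mult.commute)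
qed

lemma Ck_bump_at: "Ck k (bump_at m s)"
proof (induction k arbitrary: m)
  case 0
  show ?case by (auto intro!: continuous_at_imp_continuous_on has_derivative_continuous[OF bump_at_has_derivative])
next
  case (Suc k)
  have "Ck k (\<lambda>x. (bump_at (m + 2) s x - m * bump_at (m + 1) s x) * (- 2 * s * (x \<bullet> v)))" for v :: 'a
  proof -
    have "Ck k (\<lambda>x. (bump_at (m + 2) s x + (- real m) * bump_at (m + 1) s x) * ((- 2 * s) * (x \<bullet> v)))"
      by (intro Ck_mult Ck_add Ck_const Ck_inner_right Suc.IH)
    then show ?thesis by simp
  qed
  then show ?case by (rule Ck_SucI[OF bump_at_has_derivative])
qed

lemma bump_at_nonneg: "bump_at m s x \<ge> 0" by (simp add: bump_at_def flat_exp_nonneg)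

lemma bump_at_eq_0:
  assumes "s > 0" "norm x \<ge> 1 / sqrt s"
  shows "bump_at m s x = 0"
proof -
  have "(1 / sqrt s)\<^sup>2 \<le> (norm x)\<^sup>2" using assms by (intro power_mono) auto
  then have "1 \<le> s * (x \<bullet> x)" using assms by (simp add: power_divide field_simps power2_norm_eq_inner)
  then show ?thesis by (simp add: bump_at_def flat_exp_def)
qed

lemma bump_le: "s > 0 \<Longrightarrow> bump s x \<le> exp (- 1)"
proof -
  assume s: "s > 0"
  have "1 \<le> inverse t" if "0 < t" "t \<le> 1" for t :: real using that by (simp add: one_le_inverse)
  then show ?thesis using s by (auto simp: bump_at_def flat_exp_def)
qed

lemma bump_0: "bump s 0 = exp (- 1)" by (simp add: bump_at_def flat_exp_def)

text \<open>Index 2 occurs because the derivative of \<open>flat_exp 0\<close> is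
  \<open>flat_exp 2\<close>; the bound is \<open>s^2 / 2 \<le> exp s\<close> at
  \<open>s = inverse t\<close>. It controls the gradient of the cutoffs.\<close>

lemma flat_exp_2_le: "flat_exp 2 t \<le> 2"
proof (cases "t > 0")
  case True
  let ?s = "inverse t"
  have "1 + ?s + ?s\<^sup>2 / 2 \<le> exp ?s" using True by (intro exp_lower_Taylor_quadratic) auto
  moreover have "?s > 0" using True by simp
  ultimately have "?s\<^sup>2 \<le> 2 * exp ?s" by linarith
  then have "exp (- ?s) * ?s\<^sup>2 \<le> exp (- ?s) * (2 * exp ?s)" by (intro mult_left_mono) auto
  also have "\<dots> = 2" by (simp add: exp_minus)
  finally show ?thesis using True by (simp add: flat_exp_def)
qed (simp add: flat_exp_def)

section \<open>Smooth functions of compact support\<close>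

definition csmooth :: "('a::euclidean_space \<Rightarrow> real) \<Rightarrow> bool" where
  "csmooth \<rho> \<longleftrightarrow> (\<forall>k. Ck k \<rho>) \<and> (\<exists>r. \<forall>x. r < norm x \<longrightarrow> \<rho> x = 0)"

lemma csmooth_frechet_derivative:
  assumes "csmooth \<rho>"
  shows "csmooth (\<lambda>x. frechet_derivative \<rho> (at x) v)"
proof -
  obtain r where r: "\<And>x. r < norm x \<Longrightarrow> \<rho> x = 0" using assms by (auto simp: csmooth_def)
  have "frechet_derivative \<rho> (at x) v = 0" if x: "r < norm x" for x
  proof -
    have "open {x::'a. r < norm x}" by (intro open_Collect_less continuous_intros)
    have "((\<lambda>x. 0) has_derivative (\<lambda>v. 0)) (at x)" by simp
    then have "(\<rho> has_derivative (\<lambda>v. 0)) (at x)"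
      by (rule has_derivative_transform_within_open[OF _ \<open>open {x::'a. r < norm x}\<close>]) (use r x in auto)
    then show ?thesis using frechet_derivative_at by metis
  qed
  moreover have "Ck k (\<lambda>x. frechet_derivative \<rho> (at x) v)" for k
    using assms Ck_SucD(2)[of k \<rho> v] by (auto simp: csmooth_def simp del: Ck.simps)
  ultimately show ?thesis by (auto simp: csmooth_def)
qed

lemma csmooth_has_derivative: "csmooth \<rho> \<Longrightarrow> (\<rho> has_derivative frechet_derivative \<rho> (at x)) (at x)"
  using Ck_SucD(1)[of 0 \<rho>] by (auto simp: csmooth_def simp del: Ck.simps)

lemma csmooth_continuous: "csmooth \<rho> \<Longrightarrow> continuous_on S \<rho>"
  using Ck_continuous by (auto simp: csmooth_def)

lemma csmooth_mult_const:
  assumes "csmooth \<rho>" shows "csmooth (\<lambda>x. c * \<rho> x)"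
proof -
  have "Ck k (\<lambda>x. c * \<rho> x)" for k using assms by (intro Ck_mult Ck_const) (simp add: csmooth_def)
  moreover obtain r where "\<forall>x. r < norm x \<longrightarrow> \<rho> x = 0" using assms by (auto simp: csmooth_def)
  ultimately show ?thesis by (auto simp: csmooth_def)
qed

lemma csmooth_bump: "s > 0 \<Longrightarrow> csmooth (bump s)"
  unfolding csmooth_def by (intro conjI allI Ck_bump_at exI[of _ "1 / sqrt s"] impI bump_at_eq_0) auto

section \<open>Positive semidefinite matrices\<close>

lemma quadratic_nonneg_imp_linear_coeff_0:
  fixes a b :: real
  assumes "\<And>t. 0 \<le> t * a + t\<^sup>2 * b"
  shows "a = 0"
proof (rule ccontr)
  assume "a \<noteq> 0"
  \<comment> \<open>At \<open>t = - s * a\<close> the expression equals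
    \<open>- s a^2 (1 - s b)\<close>; this choice of \<open>s\<close> makes
    \<open>s * b < 1\<close>.\<close>
  define s where "s = 1 / (\<bar>b\<bar> + 1)"
  have s: "0 < s" "s * b < 1"
    by (auto simp: s_def field_simps)
  have "0 \<le> (- s * a) * a + (- s * a)\<^sup>2 * b" by (rule assms)
  also have "\<dots> = - (s * a\<^sup>2) * (1 - s * b)" by (simp add: power2_eq_square algebra_simps)
  also have "\<dots> < 0" using s \<open>a \<noteq> 0\<close> by (intro mult_neg_pos) auto
  finally show False by simp
qed

text \<open>Spectral theorem by Rayleigh quotients: a maximiser of \<open>x \<bullet> f x\<close> on
  the unit sphere of \<open>S\<close> is an eigenvector, and its orthogonal complement in
  \<open>S\<close> is again invariant because \<open>f\<close> is self-adjoint.\<close>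

lemma selfadjoint_eigenbasis_subspace:
  fixes f :: "'a::euclidean_space \<Rightarrow> 'a"
  assumes lin: "linear f" and sa: "\<And>x y. f x \<bullet> y = x \<bullet> f y"
    and "subspace S" "f ` S \<subseteq> S"
  shows "\<exists>B. finite B \<and> B \<subseteq> S \<and> card B = dim S \<and> pairwise orthogonal B \<and>
      (\<forall>b\<in>B. norm b = 1 \<and> (\<exists>c. f b = c *\<^sub>R b))"
  using assms(3,4)
proof (induction "dim S" arbitrary: S)
  case 0
  then show ?case by (intro exI[of _ "{}"]) auto
next
  case (Suc k S)
  have S: "subspace S" and fS: "\<And>x. x \<in> S \<Longrightarrow> f x \<in> S" using Suc.prems by auto
  let ?C = "sphere 0 1 \<inter> S"
  have "compact ?C" using closed_subspace[OF S] by (intro compact_Int_closed) auto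
  moreover have "?C \<noteq> {}"
  proof -
    have "\<exists>x\<in>S. x \<noteq> 0"
    proof (rule ccontr)
      assume "\<not> ?thesis"
      then have "S \<subseteq> {0}" by auto
      then have "dim S = 0" by (simp only: dim_eq_0)
      then show False using Suc.hyps(2) by linarith
    qed
    then obtain x where "x \<in> S" "x \<noteq> 0" by auto
    then have "x /\<^sub>R norm x \<in> ?C" using S by (auto intro: subspace_scale)
    then show ?thesis by blast
  qed
  moreover have "continuous_on ?C (\<lambda>x. x \<bullet> f x)"
    using lin by (intro continuous_intros linear_continuous_on) (simp add: linear_conv_bounded_linear)
  ultimately obtain b where b: "b \<in> ?C" "\<And>y. y \<in> ?C \<Longrightarrow> y \<bullet> f y \<le> b \<bullet> f b"
    using continuous_attains_sup by metis
  define c where "c = b \<bullet> f b"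
  have bS: "b \<in> S" "norm b = 1" using b(1) by auto
  have bb: "b \<bullet> b = 1" using bS by (simp add: dot_square_norm)
  have Q: "y \<bullet> f y \<le> c * (y \<bullet> y)" if "y \<in> S" for y
  proof (cases "y = 0")
    case False
    have "(y /\<^sub>R norm y) \<bullet> f (y /\<^sub>R norm y) \<le> c"
      unfolding c_def using False that S by (intro b) (auto intro: subspace_scale)
    then show ?thesis using False
      by (simp add: linear_scale[OF lin] field_simps dot_square_norm power2_eq_square)
  qed auto
  \<comment> \<open>The form \<open>c * (y \<bullet> y) - y \<bullet> f y\<close> is nonnegative on
    \<open>S\<close> and vanishes at \<open>b\<close>, so its derivative at \<open>b\<close>
    vanishes in every direction of \<open>S\<close>.\<close>
  have orth: "(c *\<^sub>R b - f b) \<bullet> y = 0" if "y \<in> S" for y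
  proof -
    have "0 \<le> t * (2 * ((c *\<^sub>R b - f b) \<bullet> y)) + t\<^sup>2 * (c * (y \<bullet> y) - y \<bullet> f y)" for t
    proof -
      have "b + t *\<^sub>R y \<in> S" using bS that S by (auto intro: subspace_add subspace_scale)
      from Q[OF this] have "0 \<le> c * ((b + t *\<^sub>R y) \<bullet> (b + t *\<^sub>R y)) - (b + t *\<^sub>R y) \<bullet> f (b + t *\<^sub>R y)"
        by simp
      also have "\<dots> = t * (2 * ((c *\<^sub>R b - f b) \<bullet> y)) + t\<^sup>2 * (c * (y \<bullet> y) - y \<bullet> f y)"
        using sa[of b y] bb
        by (simp add: linear_add[OF lin] linear_scale[OF lin] inner_add inner_diff algebra_simps power2_eq_square inner_commute c_def)
      finally show ?thesis .
    qed
    then have "2 * ((c *\<^sub>R b - f b) \<bullet> y) = 0" by (rule quadratic_nonneg_imp_linear_coeff_0)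
    then show ?thesis by simp
  qed
  \<comment> \<open>Since \<open>S\<close> is invariant, the residual lies in \<open>S\<close> and
    may be tested against itself.\<close>
  have "c *\<^sub>R b - f b \<in> S" using bS fS S by (auto intro: subspace_diff subspace_scale)
  from orth[OF this] have fb: "f b = c *\<^sub>R b" by simp
  define T where "T = {y \<in> S. orthogonal b y}"
  have subT: "subspace T"
    unfolding T_def using S by (auto simp: subspace_def orthogonal_def inner_add_right)
  have fT: "f ` T \<subseteq> T"
  proof (clarsimp simp: T_def orthogonal_def, intro conjI fS)
    fix x assume "x \<in> S" "b \<bullet> x = 0"
    then show "b \<bullet> f x = 0" using sa[of b x] fb by simp
  qed
  have dimT: "dim T = k"
  proof -
    have "span {b} \<subseteq> S" using S bS by (auto simp: span_minimal)
    then have "dim {y \<in> S. \<forall>x \<in> span {b}. orthogonal x y} + dim (span {b}) = dim S"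
      using S by (intro dim_subspace_orthogonal_to_vectors) auto
    moreover have "{y \<in> S. \<forall>x \<in> span {b}. orthogonal x y} = T"
      by (auto simp: T_def span_singleton orthogonal_def)
    moreover have "dim (span {b}) = 1"
      using bS by (subst dim_span, subst dim_eq_card_independent) (auto simp: dependent_single)
    ultimately show ?thesis using Suc.hyps(2) by simp
  qed
  from Suc.hyps(1)[OF dimT[symmetric] subT fT] obtain B where B: "finite B" "B \<subseteq> T" "card B = dim T"
    "pairwise orthogonal B" "\<forall>b\<in>B. norm b = 1 \<and> (\<exists>c. f b = c *\<^sub>R b)" by blast
  have "b \<notin> B" using B(2) bb by (auto simp: T_def orthogonal_def)
  show ?case
  proof (intro exI[of _ "insert b B"] conjI)
    show "card (insert b B) = dim S" using B \<open>b \<notin> B\<close> dimT Suc.hyps(2) by simp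
    show "pairwise orthogonal (insert b B)" using B(2,4)
      by (auto simp: pairwise_insert T_def orthogonal_commute)
  qed (use B bS fb in \<open>auto simp: T_def\<close>)
qed

lemma symmetric_matrix_eigen:
  fixes K :: "real^'n^'n"
  assumes "transpose K = K"
  shows "\<exists>(b :: 'n \<Rightarrow> real^'n) c. \<forall>i. norm (b i) = 1 \<and> (\<forall>j. i \<noteq> j \<longrightarrow> b i \<bullet> b j = 0) \<and> K *v b i = c i *\<^sub>R b i"
proof -
  have "(K *v x) \<bullet> y = x \<bullet> (K *v y)" for x y
    using assms by (metis dot_lmul_matrix inner_commute vector_transpose_matrix)
  then obtain B where B: "finite B" "card B = dim (UNIV :: (real^'n) set)" "pairwise orthogonal B"
    "\<forall>b\<in>B. norm b = 1 \<and> (\<exists>c. K *v b = c *\<^sub>R b)"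
    using selfadjoint_eigenbasis_subspace[of "(*v) K" UNIV] by auto
  then have "card B = CARD('n)" by simp
  then obtain b where b: "bij_betw b (UNIV :: 'n set) B"
    using B(1) finite_same_card_bij[of "UNIV :: 'n set" B] by auto
  then have bB: "b i \<in> B" for i by (auto simp: bij_betw_def)
  have "\<forall>i. \<exists>c. K *v b i = c *\<^sub>R b i" using B(4) bB by blast
  then obtain c where "\<And>i. K *v b i = c i *\<^sub>R b i" by metis
  moreover have "b i \<bullet> b j = 0" if "i \<noteq> j" for i j
  proof -
    have "b i \<noteq> b j" using b that by (auto simp: bij_betw_def inj_on_def)
    then show ?thesis using B(3) bB by (auto simp: pairwise_def orthogonal_def)
  qed
  ultimately show ?thesis using B(4) bB by blast
qed

section \<open>Diagonalisation, determinant and trace\<close>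

lemma trace_mult_commute: "trace (A ** B) = trace (B ** (A :: real^'n^'n))"
  unfolding trace_def matrix_matrix_mult_def
  by (simp, subst sum.swap, simp add: mult.commute)

lemma orthonormal_eigenbasis_diagonalize:
  fixes K :: "real^'n^'n" and b :: "'n \<Rightarrow> real^'n"
  assumes b: "\<And>i. norm (b i) = 1" "\<And>i j. i \<noteq> j \<Longrightarrow> b i \<bullet> b j = 0" "\<And>i. K *v b i = c i *\<^sub>R b i"
  shows "\<exists>Q :: real^'n^'n. orthogonal_matrix Q \<and> K = Q ** (\<chi> i j. if i = j then c i else 0) ** transpose Q \<and>
    (\<forall>i. column i Q = b i)"
proof -
  define Q :: "real^'n^'n" where "Q = (\<chi> i j. b j $ i)"
  define D :: "real^'n^'n" where "D = (\<chi> i j. if i = j then c i else 0)"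
  have col: "column i Q = b i" for i by (simp add: Q_def column_def vec_eq_iff)
  have Q: "orthogonal_matrix Q"
    unfolding orthogonal_matrix_orthonormal_columns col using b by (auto simp: orthogonal_def)
  have "K ** Q = Q ** D"
  proof -
    have "(K ** Q) $ i $ j = (K *v b j) $ i" for i j
      by (simp add: matrix_matrix_mult_def matrix_vector_mult_def Q_def)
    moreover have "(Q ** D) $ i $ j = c j * b j $ i" for i j
      by (simp add: matrix_matrix_mult_def Q_def D_def if_distrib cong: if_cong)
    ultimately show ?thesis using b(3) by (simp add: vec_eq_iff)
  qed
  then have "Q ** D ** transpose Q = K ** (Q ** transpose Q)" by (simp add: matrix_mul_assoc)
  also have "\<dots> = K" using Q by (simp add: orthogonal_matrix_def)
  finally have "K = Q ** D ** transpose Q" by simp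
  then show ?thesis using Q col unfolding D_def by (intro exI[of _ Q]) simp
qed

lemma det_orthogonal_diagonal:
  fixes Q :: "real^'n^'n"
  assumes "orthogonal_matrix Q" "K = Q ** (\<chi> i j. if i = j then c i else 0) ** transpose Q"
  shows "det K = (\<Prod>i\<in>UNIV. c i)"
proof -
  let ?D = "(\<chi> i j. if i = j then c i else 0) :: real^'n^'n"
  have "det K = det ?D * (det Q * det (transpose Q))" using arg_cong[OF assms(2), of det] by (simp add: det_mul)
  also have "det Q * det (transpose Q) = 1"
    using assms(1) by (metis det_I det_mul orthogonal_matrix_def)
  also have "det ?D = (\<Prod>i\<in>UNIV. c i)" by (subst det_diagonal) auto
  finally show ?thesis by simp
qed

text \<open>An orthonormal eigenbasis determines the determinant without reference to how the
  indices are arranged; this later computes a determinant after a change of index type.\<close>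

lemma det_eq_prod_eigenvalues:
  fixes K :: "real^'n^'n" and b :: "'n \<Rightarrow> real^'n"
  assumes "\<And>i. norm (b i) = 1" "\<And>i j. i \<noteq> j \<Longrightarrow> b i \<bullet> b j = 0" "\<And>i. K *v b i = c i *\<^sub>R b i"
  shows "det K = (\<Prod>i\<in>UNIV. c i)"
  using orthonormal_eigenbasis_diagonalize[of b K c, OF assms] det_orthogonal_diagonal by blast

lemma sym_psd_diagonalize:
  fixes K :: "real^'n^'n"
  assumes "sym_psd K"
  shows "\<exists>(Q :: real^'n^'n) c. K = Q ** (\<chi> i j. if i = j then c i else 0) ** transpose Q \<and>
    (\<forall>i. c i \<ge> 0) \<and> det K = (\<Prod>i\<in>UNIV. c i) \<and> trace K = (\<Sum>i\<in>UNIV. c i)"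
proof -
  have "transpose K = K" using assms by (simp add: sym_psd_def)
  from symmetric_matrix_eigen[OF this]
  obtain b :: "'n \<Rightarrow> real^'n" and c where "\<forall>i. norm (b i) = 1 \<and> (\<forall>j. i \<noteq> j \<longrightarrow> b i \<bullet> b j = 0) \<and> K *v b i = c i *\<^sub>R b i"
    by (elim exE) (rule that)
  then have b: "norm (b i) = 1" "i \<noteq> j \<Longrightarrow> b i \<bullet> b j = 0" "K *v b i = c i *\<^sub>R b i" for i j by auto
  let ?D = "(\<chi> i j. if i = j then c i else 0) :: real^'n^'n"
  have "\<exists>Q :: real^'n^'n. orthogonal_matrix Q \<and> K = Q ** ?D ** transpose Q \<and> (\<forall>i. column i Q = b i)"
    by (rule orthonormal_eigenbasis_diagonalize) (simp_all add: b)
  then obtain Q :: "real^'n^'n" where "orthogonal_matrix Q \<and> K = Q ** ?D ** transpose Q \<and> (\<forall>i. column i Q = b i)"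
    by (elim exE) (rule that)
  then have Q: "orthogonal_matrix Q" "K = Q ** ?D ** transpose Q" by auto
  have "c i \<ge> 0" for i
  proof -
    have "0 \<le> b i \<bullet> (K *v b i)" using assms by (simp add: sym_psd_def)
    also have "\<dots> = c i" by (simp add: b dot_square_norm)
    finally show ?thesis .
  qed
  moreover have "det K = (\<Prod>i\<in>UNIV. c i)" using Q by (rule det_orthogonal_diagonal)
  moreover have "trace K = (\<Sum>i\<in>UNIV. c i)"
  proof -
    have "trace K = trace (Q ** ?D ** transpose Q)" using Q(2) by simp
    also have "\<dots> = trace (transpose Q ** Q ** ?D)"
      by (simp only: trace_mult_commute[of "Q ** _" "transpose Q"] matrix_mul_assoc)
    also have "transpose Q ** Q = mat 1" using Q(1) by (simp add: orthogonal_matrix)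
    finally show ?thesis by (simp add: trace_def)
  qed
  ultimately show ?thesis using Q(2) by (intro exI[of _ Q] exI[of _ c]) simp
qed

lemma sym_psd_det_nonneg: "sym_psd K \<Longrightarrow> det K \<ge> 0"
  using sym_psd_diagonalize[of K] by (auto simp: prod_nonneg)

text \<open>The arithmetic-geometric mean inequality for the eigenvalues.\<close>

lemma sym_psd_trace_ge:
  fixes K :: "real^'n^'n"
  assumes "sym_psd K"
  shows "trace K \<ge> CARD('n) * det K powr (1 / CARD('n))"
proof -
  obtain c :: "'n \<Rightarrow> real" where c: "\<And>i. c i \<ge> 0" "det K = (\<Prod>i\<in>UNIV. c i)" "trace K = (\<Sum>i\<in>UNIV. c i)"
    using sym_psd_diagonalize[OF assms] by blast
  have "(\<Prod>i\<in>UNIV. c i) powr (1 / CARD('n)) \<le> (\<Sum>i \<in> UNIV. c i / CARD('n))"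
    using c by (intro arith_geom_mean) auto
  then show ?thesis using c by (simp add: field_simps flip: sum_divide_distrib)
qed

lemma sym_psd_factor:
  fixes A :: "real^'n^'n"
  assumes "sym_psd A"
  obtains L :: "real^'n^'n" where "A = L ** transpose L"
proof -
  obtain Q :: "real^'n^'n" and c where "A = Q ** (\<chi> i j. if i = j then c i else 0) ** transpose Q \<and>
    (\<forall>i. c i \<ge> 0) \<and> det A = (\<Prod>i\<in>UNIV. c i) \<and> trace A = (\<Sum>i\<in>UNIV. c i)"
    using sym_psd_diagonalize[OF assms] by (elim exE) (rule that)
  then have Q: "A = Q ** (\<chi> i j. if i = j then c i else 0) ** transpose Q" "\<And>i. c i \<ge> 0" by auto
  define D :: "real^'n^'n" where "D = (\<chi> i j. if i = j then sqrt (c i) else 0)"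
  have "D ** transpose D = (\<chi> i j. if i = j then c i else 0)"
    unfolding vec_eq_iff
  proof (intro allI)
    fix i j
    have "(D ** transpose D) $ i $ j = (\<Sum>k\<in>UNIV. if k = i then (if k = j then sqrt (c i) * sqrt (c j) else 0) else 0)"
      unfolding matrix_matrix_mult_def transpose_def D_def vec_lambda_beta by (intro sum.cong) auto
    then show "(D ** transpose D) $ i $ j = (\<chi> i j. if i = j then c i else 0) $ i $ j"
      using Q(2) by simp
  qed
  then have "A = Q ** (D ** transpose D) ** transpose Q"
    using Q(1) by simp
  then have "A = (Q ** D) ** transpose (Q ** D)"
     by (simp only: matrix_transpose_mul matrix_mul_assoc)
  then show ?thesis using that by blast
qed

text \<open>\<open>A ** H\<close> need not be symmetric. With \<open>A = L ** transpose L\<close>,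
  the congruence \<open>transpose L ** H ** L\<close> is positive semidefinite and has the trace and
  the determinant of \<open>A ** H\<close>, so the bound for a single matrix applies to it.\<close>

lemma trace_mult_ge_det:
  fixes A H :: "real^'n^'n"
  assumes "sym_psd A" "sym_psd H"
  shows "trace (A ** H) \<ge> CARD('n) * (det A powr (1 / CARD('n)) * det H powr (1 / CARD('n)))"
proof -
  obtain L :: "real^'n^'n" where L: "A = L ** transpose L" using sym_psd_factor assms(1) by blast
  define K where "K = transpose L ** H ** L"
  have "sym_psd K"
    unfolding sym_psd_def
  proof (intro conjI allI)
    show "transpose K = K" using assms(2)
      by (simp add: K_def matrix_transpose_mul matrix_mul_assoc sym_psd_def)
    fix v
    have "v \<bullet> (K *v v) = (L *v v) \<bullet> (H *v (L *v v))"
      unfolding K_def matrix_vector_mul_assoc[symmetric]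
      by (metis dot_lmul_matrix inner_commute vector_transpose_matrix transpose_transpose)
    then show "0 \<le> v \<bullet> (K *v v)" using assms(2) by (simp add: sym_psd_def)
  qed
  from sym_psd_trace_ge[OF this] have "trace K \<ge> CARD('n) * det K powr (1 / CARD('n))" .
  moreover have "trace K = trace (A ** H)"
    unfolding K_def L trace_mult_commute[of "transpose L ** H" L] by (simp only: matrix_mul_assoc)
  moreover have "det K = det A * det H" by (simp add: K_def L det_mul)
  ultimately show ?thesis using sym_psd_det_nonneg assms by (simp add: powr_mult)
qed

section \<open>The Brunn-Minkowski inequality\<close>

definition minkowski_sum :: "'a::ab_group_add set \<Rightarrow> 'a set \<Rightarrow> 'a set" where
  "minkowski_sum A B = {x + y | x y. x \<in> A \<and> y \<in> B}"

text \<open>Nonemptiness is part of the notion because the Brunn-Minkowski inequality fails when one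
  summand is empty.\<close>

definition disjoint_boxes :: "'a::euclidean_space set set \<Rightarrow> bool" where
  "disjoint_boxes \<A> \<longleftrightarrow> finite \<A> \<and> \<A> \<noteq> {} \<and> disjoint \<A> \<and> (\<forall>K\<in>\<A>. K \<noteq> {} \<and> (\<exists>a b. K = box a b))"

lemma minkowski_sum_commute: "minkowski_sum A B = minkowski_sum B A"
  unfolding minkowski_sum_def by (metis add.commute)

lemma minkowski_sum_mono: "A \<subseteq> A' \<Longrightarrow> B \<subseteq> B' \<Longrightarrow> minkowski_sum A B \<subseteq> minkowski_sum A' B'"
  unfolding minkowski_sum_def by blast

lemma minkowski_sum_eq_UN: "minkowski_sum A B = (\<Union>y\<in>B. (+) y ` A)"
  unfolding minkowski_sum_def by (auto simp: image_iff) (metis add.commute)+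

lemma open_minkowski_sum: "open A \<Longrightarrow> open (minkowski_sum A (B::'a::real_normed_vector set))"
  unfolding minkowski_sum_eq_UN by (auto intro: open_translation)

lemma bounded_minkowski_sum: "bounded A \<Longrightarrow> bounded B \<Longrightarrow> bounded (minkowski_sum A (B::'a::real_normed_vector set))"
  by (rule bounded_subset[OF bounded_plus[of A B]]) (auto simp: minkowski_sum_def)

lemma measure_lebesgue_box:
  assumes "box a b \<noteq> {}"
  shows "measure lebesgue (box a b) = (\<Prod>i\<in>Basis. b \<bullet> i - a \<bullet> i)"
proof -
  have "a \<bullet> i \<le> b \<bullet> i" if "i \<in> Basis" for i
    using assms that by (auto simp: box_ne_empty intro: less_imp_le)
  then show ?thesis by (simp add: measure_lborel_box inner_diff_left)
qed

text \<open>Divided by the right-hand side, the two terms on the left are geometric means of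
  \<open>p i / (p i + q i)\<close> and of \<open>q i / (p i + q i)\<close>; the corresponding
  arithmetic means add up to 1.\<close>

lemma root_prod_add_le:
  fixes p q :: "'i \<Rightarrow> real"
  assumes S: "finite S" "S \<noteq> {}" and pos: "\<And>i. i \<in> S \<Longrightarrow> p i > 0" "\<And>i. i \<in> S \<Longrightarrow> q i > 0"
  shows "root (card S) (\<Prod>i\<in>S. p i) + root (card S) (\<Prod>i\<in>S. q i) \<le> root (card S) (\<Prod>i\<in>S. p i + q i)"
proof -
  let ?n = "card S"
  have n: "?n > 0" using S by (simp add: card_gt_0_iff)
  define r where "r = root ?n (\<Prod>i\<in>S. p i + q i)"
  have r: "r > 0" unfolding r_def using n pos by (simp add: prod_pos add_pos_pos)
  have *: "root ?n (\<Prod>i\<in>S. u i) / r \<le> (\<Sum>i\<in>S. u i / (p i + q i)) / ?n"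
    if u: "\<And>i. i \<in> S \<Longrightarrow> u i > 0" for u :: "'i \<Rightarrow> real"
  proof -
    have u': "u i / (p i + q i) > 0" if "i \<in> S" for i using u pos that by (simp add: add_pos_pos)
    have "root ?n (\<Prod>i\<in>S. u i) / r = root ?n (\<Prod>i\<in>S. u i / (p i + q i))"
      unfolding r_def using n by (simp add: real_root_divide prod_dividef)
    also have "\<dots> = (\<Prod>i\<in>S. u i / (p i + q i)) powr (1 / ?n)"
      using prod_pos[of S "\<lambda>i. u i / (p i + q i)", OF u'] n by (subst root_powr_inverse) auto
    also have "\<dots> \<le> (\<Sum>i\<in>S. u i / (p i + q i) / ?n)"
      using S u' by (intro arith_geom_mean) (auto intro: less_imp_le)
    finally show ?thesis by (simp add: sum_divide_distrib)
  qed
  have "root ?n (\<Prod>i\<in>S. p i) / r + root ?n (\<Prod>i\<in>S. q i) / r \<le>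
      (\<Sum>i\<in>S. p i / (p i + q i)) / ?n + (\<Sum>i\<in>S. q i / (p i + q i)) / ?n"
    using pos by (intro add_mono *) auto
  also have "\<dots> = (\<Sum>i\<in>S. (p i + q i) / (p i + q i)) / ?n"
    by (simp only: add_divide_distrib sum.distrib)
  also have "(\<Sum>i\<in>S. (p i + q i) / (p i + q i)) = (\<Sum>i\<in>S. 1)"
    using pos by (intro sum.cong refl divide_self) (metis add_pos_pos less_irrefl)
  also have "(\<Sum>i\<in>S. 1) / ?n = (1::real)" using n by simp
  finally show ?thesis using r by (simp add: field_simps flip: r_def)
qed

lemma box_add_subset_minkowski_sum:
  fixes a b c d :: "'a::euclidean_space"
  assumes "box a b \<noteq> {}" "box c d \<noteq> {}"
  shows "box (a + c) (b + d) \<subseteq> minkowski_sum (box a b) (box c d)"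
proof
  fix x assume x: "x \<in> box (a + c) (b + d)"
  have ab: "a \<bullet> i < b \<bullet> i" "c \<bullet> i < d \<bullet> i" if "i \<in> Basis" for i
    using assms that by (auto simp: box_ne_empty)
  \<comment> \<open>The relative position of \<open>x\<close> in side \<open>i\<close> of the large
    box. Taking the same relative position in each of the two small boxes splits \<open>x\<close> as
    required.\<close>
  define s where "s i = (x \<bullet> i - a \<bullet> i - c \<bullet> i) / ((b \<bullet> i - a \<bullet> i) + (d \<bullet> i - c \<bullet> i))" for i
  have s: "0 < s i" "s i < 1" if "i \<in> Basis" for i
    using x ab[OF that] that by (auto simp: s_def mem_box inner_add_left field_simps)
  have xs: "x \<bullet> i = a \<bullet> i + c \<bullet> i + s i * (b \<bullet> i - a \<bullet> i) + s i * (d \<bullet> i - c \<bullet> i)" if "i \<in> Basis" for i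
  proof -
    have "s i * ((b \<bullet> i - a \<bullet> i) + (d \<bullet> i - c \<bullet> i)) = x \<bullet> i - a \<bullet> i - c \<bullet> i"
      using ab[OF that] by (simp add: s_def)
    then show ?thesis by (simp add: algebra_simps)
  qed
  have bd: "u < u + t * (v - u) \<and> u + t * (v - u) < v" if "0 < t" "t < 1" "u < v" for t u v :: real
  proof -
    have "t * (v - u) < 1 * (v - u)" using that by (intro mult_strict_right_mono) auto
    moreover have "0 < t * (v - u)" using that by simp
    ultimately show ?thesis by simp
  qed
  define y where "y = (\<Sum>i\<in>Basis. (a \<bullet> i + s i * (b \<bullet> i - a \<bullet> i)) *\<^sub>R i)"
  have yi: "y \<bullet> i = a \<bullet> i + s i * (b \<bullet> i - a \<bullet> i)" if "i \<in> Basis" for i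
    using that by (simp add: y_def)
  have "y \<in> box a b"
    unfolding mem_box using bd s ab by (auto simp: yi)
  moreover have "x - y \<in> box c d"
    unfolding mem_box
  proof (intro ballI)
    fix i :: 'a assume i: "i \<in> Basis"
    have "(x - y) \<bullet> i = c \<bullet> i + s i * (d \<bullet> i - c \<bullet> i)"
      using i by (simp add: inner_diff_left yi xs)
    then show "c \<bullet> i < (x - y) \<bullet> i \<and> (x - y) \<bullet> i < d \<bullet> i" using bd s[OF i] ab[OF i] by simp
  qed
  ultimately show "x \<in> minkowski_sum (box a b) (box c d)"
    unfolding minkowski_sum_def by (intro CollectI exI[of _ y] exI[of _ "x - y"]) auto
qed

text \<open>Raised to the power \<open>DIM('a)\<close>, because volumes of disjoint pieces add
  whereas their roots do not.\<close>

definition bm_ineq :: "'a::euclidean_space set \<Rightarrow> 'a set \<Rightarrow> bool" where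
  "bm_ineq A B \<longleftrightarrow> (root DIM('a) (measure lebesgue A) + root DIM('a) (measure lebesgue B)) ^ DIM('a)
     \<le> measure lebesgue (minkowski_sum A B)"

lemma bm_ineq_commute: "bm_ineq A B \<longleftrightarrow> bm_ineq B A"
  unfolding bm_ineq_def by (simp add: minkowski_sum_commute add.commute)

lemma bm_ineq_box:
  fixes a b c d :: "'a::euclidean_space"
  assumes ne: "box a b \<noteq> {}" "box c d \<noteq> {}"
  shows "bm_ineq (box a b) (box c d)"
proof -
  let ?p = "\<lambda>i. b \<bullet> i - a \<bullet> i" and ?q = "\<lambda>i. d \<bullet> i - c \<bullet> i"
  have ab: "a \<bullet> i < b \<bullet> i" "c \<bullet> i < d \<bullet> i" if "i \<in> Basis" for i
    using assms that by (auto simp: box_ne_empty)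
  have ne': "box (a + c) (b + d) \<noteq> {}"
    using ab by (auto simp: box_ne_empty inner_add_left intro: add_strict_mono)
  have P: "(\<Prod>i\<in>Basis. ?p i) > 0" "(\<Prod>i\<in>Basis. ?q i) > 0" "(\<Prod>i\<in>Basis. ?p i + ?q i) > 0"
    using ab by (auto intro!: prod_pos add_pos_pos)
  have "root DIM('a) (measure lebesgue (box a b)) + root DIM('a) (measure lebesgue (box c d)) \<le>
        root DIM('a) (\<Prod>i\<in>Basis. ?p i + ?q i)"
    unfolding measure_lebesgue_box[OF ne(1)] measure_lebesgue_box[OF ne(2)]
    using ab by (intro root_prod_add_le) auto
  then have "(root DIM('a) (measure lebesgue (box a b)) + root DIM('a) (measure lebesgue (box c d))) ^ DIM('a)
      \<le> root DIM('a) (\<Prod>i\<in>Basis. ?p i + ?q i) ^ DIM('a)"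
    by (intro power_mono) (auto intro!: add_nonneg_nonneg)
  also have "\<dots> = (\<Prod>i\<in>Basis. ?p i + ?q i)" using P by simp
  also have "\<dots> = measure lebesgue (box (a + c) (b + d))"
    unfolding measure_lebesgue_box[OF ne'] by (intro prod.cong) (auto simp: inner_add_left)
  also have "\<dots> \<le> measure lebesgue (minkowski_sum (box a b) (box c d))"
    by (intro measure_mono_fmeasurable box_add_subset_minkowski_sum ne lmeasurable_open
          bounded_minkowski_sum open_minkowski_sum) auto
  finally show ?thesis unfolding bm_ineq_def .
qed

lemma box_Int_halfspaces:
  fixes a b :: "'a::euclidean_space"
  assumes "i \<in> Basis"
  shows "\<exists>a' b'. box a b \<inter> {x. x \<bullet> i < t} = box a' b'" "\<exists>a' b'. box a b \<inter> {x. x \<bullet> i > t} = box a' b'"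
proof -
  have "box a b \<inter> {x. x \<bullet> i < t} = box a (\<Sum>j\<in>Basis. (if j = i then min (b \<bullet> j) t else b \<bullet> j) *\<^sub>R j)"
    using assms by (auto simp: mem_box split: if_splits) (metis)?
  then show "\<exists>a' b'. box a b \<inter> {x. x \<bullet> i < t} = box a' b'" by blast
  have "box a b \<inter> {x. x \<bullet> i > t} = box (\<Sum>j\<in>Basis. (if j = i then max (a \<bullet> j) t else a \<bullet> j) *\<^sub>R j) b"
    using assms by (auto simp: mem_box split: if_splits) (metis)?
  then show "\<exists>a' b'. box a b \<inter> {x. x \<bullet> i > t} = box a' b'" by blast
qed

text \<open>The strict drop in the number of boxes, as soon as one of them misses \<open>H\<close>,
  is what lets the induction on that number progress.\<close>

lemma disjoint_boxes_cut:
  assumes \<A>: "disjoint_boxes \<A>" and "\<Union>\<A> \<inter> H \<noteq> {}"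
    and H: "\<And>a b. \<exists>a' b'. box a b \<inter> H = box a' b'"
  obtains \<A>' where "disjoint_boxes \<A>'" "\<Union>\<A>' = \<Union>\<A> \<inter> H" "card \<A>' \<le> card \<A>"
    "\<And>K. K \<in> \<A> \<Longrightarrow> K \<inter> H = {} \<Longrightarrow> card \<A>' < card \<A>"
proof
  let ?B = "(\<lambda>K. K \<inter> H) ` {K\<in>\<A>. K \<inter> H \<noteq> {}}"
  have fin: "finite \<A>" using \<A> by (simp add: disjoint_boxes_def)
  show "disjoint_boxes ?B"
    unfolding disjoint_boxes_def
  proof (intro conjI)
    show "?B \<noteq> {}" using assms(2) by auto
    show "disjoint ?B"
      using \<A> unfolding disjoint_boxes_def disjoint_def by blast
    show "\<forall>K\<in>?B. K \<noteq> {} \<and> (\<exists>a b. K = box a b)"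
      using \<A> H unfolding disjoint_boxes_def by fastforce
  qed (use fin in auto)
  show "\<Union>?B = \<Union>\<A> \<inter> H" by auto
  have *: "card ?B \<le> card {K\<in>\<A>. K \<inter> H \<noteq> {}}" using fin by (intro card_image_le) auto
  also have "\<dots> \<le> card \<A>" using fin by (intro card_mono) auto
  finally show "card ?B \<le> card \<A>" .
  show "card ?B < card \<A>" if "K \<in> \<A>" "K \<inter> H = {}" for K
  proof -
    have "card {K\<in>\<A>. K \<inter> H \<noteq> {}} < card \<A>" using fin that by (intro psubset_card_mono) auto
    with * show ?thesis by simp
  qed
qed

lemma disjoint_boxes_Union:
  assumes "disjoint_boxes \<A>"
  shows "open (\<Union>\<A>)" "bounded (\<Union>\<A>)" "\<Union>\<A> \<noteq> {}" "\<Union>\<A> \<in> lmeasurable" "measure lebesgue (\<Union>\<A>) > 0"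
proof -
  show o: "open (\<Union>\<A>)" using assms unfolding disjoint_boxes_def by (metis open_Union open_box)
  show b: "bounded (\<Union>\<A>)" using assms unfolding disjoint_boxes_def by (metis bounded_Union bounded_box)
  show ne: "\<Union>\<A> \<noteq> {}" using assms unfolding disjoint_boxes_def by blast
  show m: "\<Union>\<A> \<in> lmeasurable" using o b by (intro lmeasurable_open)
  show "measure lebesgue (\<Union>\<A>) > 0"
    using open_not_negligible[OF o ne] m by (metis negligible_iff_measure zero_less_measure_iff)
qed

lemma separate_boxes:
  fixes K L :: "'a::euclidean_space set"
  assumes "K = box a b" "L = box c d" "K \<noteq> {}" "L \<noteq> {}" "K \<inter> L = {}"
  obtains i t where "i \<in> Basis" "(K \<subseteq> {x. x \<bullet> i < t} \<and> L \<subseteq> {x. x \<bullet> i > t}) \<or> (L \<subseteq> {x. x \<bullet> i < t} \<and> K \<subseteq> {x. x \<bullet> i > t})"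
proof -
  have "box a b \<inter> box c d = {}" using assms by simp
  then obtain i where i: "i \<in> Basis" "min (b \<bullet> i) (d \<bullet> i) \<le> max (a \<bullet> i) (c \<bullet> i)"
    unfolding box_Int_box by (auto simp: box_eq_empty)
  moreover have "a \<bullet> i < b \<bullet> i" "c \<bullet> i < d \<bullet> i" using assms i(1) by (auto simp: box_ne_empty)
  ultimately consider "b \<bullet> i \<le> c \<bullet> i" | "d \<bullet> i \<le> a \<bullet> i" by linarith
  then show ?thesis
  proof cases
    case 1
    then have "K \<subseteq> {x. x \<bullet> i < c \<bullet> i}" "L \<subseteq> {x. x \<bullet> i > c \<bullet> i}"
      using assms i(1) by (force simp: mem_box)+
    then show ?thesis using that i(1) by blast
  next
    case 2
    then have "L \<subseteq> {x. x \<bullet> i < a \<bullet> i}" "K \<subseteq> {x. x \<bullet> i > a \<bullet> i}"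
      using assms i(1) by (force simp: mem_box)+
    then show ?thesis using that i(1) by blast
  qed
qed

lemma measure_split_hyperplane:
  fixes S :: "'a::euclidean_space set"
  assumes S: "open S" "bounded S" and i: "i \<in> Basis"
  shows "measure lebesgue S = measure lebesgue (S \<inter> {x. x \<bullet> i < t}) + measure lebesgue (S \<inter> {x. x \<bullet> i > t})"
proof -
  let ?L = "S \<inter> {x. x \<bullet> i < t}" and ?R = "S \<inter> {x. x \<bullet> i > t}"
  have m: "?L \<in> lmeasurable" "?R \<in> lmeasurable"
    using S by (auto intro!: lmeasurable_open bounded_Int open_Int open_halfspace_component_lt open_halfspace_component_gt)
  have "negligible {x. x \<bullet> i = t}"
    using negligible_hyperplane[of i t] i by (simp add: inner_commute nonzero_Basis)
  then have neg: "negligible (S - (?L \<union> ?R) \<union> (?L \<union> ?R - S))"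
    by (rule negligible_subset) auto
  have "measure lebesgue S = measure lebesgue (?L \<union> ?R)"
  proof (rule measure_negligible_symdiff)
    show "?L \<union> ?R \<in> lmeasurable" using m by blast
    show "negligible ((?L \<union> ?R - S) \<union> (S - (?L \<union> ?R)))" using neg by (simp only: Un_commute)
  qed
  moreover have "measure lebesgue (?L \<union> ?R) = measure lebesgue ?L + measure lebesgue ?R"
  proof -
    have "?L \<inter> ?R = {}" by auto
    then show ?thesis using measure_Un3[OF m] by simp
  qed
  ultimately show ?thesis by simp
qed

text \<open>The volume cut off is continuous in \<open>t\<close> by dominated convergence,
  hyperplanes being null sets, and it runs from 0 to the whole volume.\<close>

lemma measure_halfspace_cut_IVT:
  fixes S :: "'a::euclidean_space set"
  assumes S: "open S" "bounded S" and i: "i \<in> Basis" and \<theta>: "0 < \<theta>" "\<theta> < 1"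
  obtains t where "measure lebesgue (S \<inter> {x. x \<bullet> i < t}) = \<theta> * measure lebesgue S"
proof -
  let ?g = "\<lambda>t. measure lebesgue (S \<inter> {x. x \<bullet> i < t})"
  have m: "S \<in> lmeasurable" using S by (intro lmeasurable_open)
  have m': "S \<inter> {x. x \<bullet> i < t} \<in> lmeasurable" for t
    using S by (auto intro!: lmeasurable_open bounded_Int open_Int open_halfspace_component_lt)
  obtain B where B: "B > 0" "\<And>x. x \<in> S \<Longrightarrow> norm x \<le> B" using S(2) bounded_pos by blast
  have comp: "\<bar>x \<bullet> i\<bar> \<le> B" if "x \<in> S" for x
    using B(2)[OF that] Basis_le_norm[OF i, of x] by linarith
  have "S \<inter> {x. x \<bullet> i < - B} = {}" using comp by force
  then have g0: "?g (-B) = 0" by simp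
  have "S \<inter> {x. x \<bullet> i < B + 1} = S" using comp by force
  then have g1: "?g (B+1) = measure lebesgue S" by simp
  have "continuous_on {-B..B+1} ?g"
    unfolding continuous_on_sequentially
  proof (intro allI impI ballI)
    fix s t assume "t \<in> {-B..B+1}" "(\<forall>n. s n \<in> {-B..B+1}) \<and> s \<longlonglongrightarrow> t"
    then have st: "s \<longlonglongrightarrow> t" by simp
    have "(\<lambda>n. LINT x|lebesgue. indicat_real (S \<inter> {x. x \<bullet> i < s n}) x) \<longlonglongrightarrow>
          (LINT x|lebesgue. indicat_real (S \<inter> {x. x \<bullet> i < t}) x)"
    proof (rule integral_dominated_convergence[where w="indicat_real S"])
      have "negligible {x. x \<bullet> i = t}"
        using negligible_hyperplane[of i t] i by (simp add: inner_commute nonzero_Basis)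
      then have "{x. x \<bullet> i = t} \<in> null_sets lebesgue" by (simp add: negligible_iff_null_sets)
      then show "AE x in lebesgue. (\<lambda>n. indicat_real (S \<inter> {x. x \<bullet> i < s n}) x) \<longlonglongrightarrow> indicat_real (S \<inter> {x. x \<bullet> i < t}) x"
      proof (rule AE_I')
        have "(\<lambda>n. indicat_real (S \<inter> {x. x \<bullet> i < s n}) x) \<longlonglongrightarrow> indicat_real (S \<inter> {x. x \<bullet> i < t}) x" if "x \<bullet> i \<noteq> t" for x
        proof -
          from that consider "x \<bullet> i < t" | "t < x \<bullet> i" by linarith
          then have "\<forall>\<^sub>F n in sequentially. indicat_real (S \<inter> {x. x \<bullet> i < s n}) x = indicat_real (S \<inter> {x. x \<bullet> i < t}) x"
          proof cases
            case 1 with order_tendstoD(1)[OF st 1] show ?thesis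
              by (auto elim!: eventually_mono simp: indicator_def)
          next
            case 2 with order_tendstoD(2)[OF st 2] show ?thesis
              by (auto elim!: eventually_mono simp: indicator_def)
          qed
          then show ?thesis by (rule tendsto_eventually)
        qed
        then show "{x \<in> space lebesgue. \<not> (\<lambda>n. indicat_real (S \<inter> {x. x \<bullet> i < s n}) x) \<longlonglongrightarrow> indicat_real (S \<inter> {x. x \<bullet> i < t}) x} \<subseteq> {x. x \<bullet> i = t}"
          by blast
      qed
      show "indicat_real (S \<inter> {x. x \<bullet> i < t}) \<in> borel_measurable lebesgue"
        using m' by (intro borel_measurable_indicator fmeasurableD)
      show "indicat_real (S \<inter> {x. x \<bullet> i < s n}) \<in> borel_measurable lebesgue" for n
        using m' by (intro borel_measurable_indicator fmeasurableD)
      show "integrable lebesgue (indicat_real S)"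
        using m by (intro integrable_real_indicator) (auto simp: fmeasurable_def)
    qed (auto simp: indicator_def)
    then show "((\<lambda>t. ?g t) \<circ> s) \<longlonglongrightarrow> ?g t" by (simp add: o_def)
  qed
  moreover have "?g (-B) \<le> \<theta> * measure lebesgue S" "\<theta> * measure lebesgue S \<le> ?g (B+1)"
    using g0 g1 \<theta> by (auto simp: mult_left_le_one_le)
  ultimately obtain t where "?g t = \<theta> * measure lebesgue S"
    using IVT'[of ?g "-B" "\<theta> * measure lebesgue S" "B+1"] B(1) by auto
  then show ?thesis using that by blast
qed

text \<open>
  The induction step of Hadwiger and Ohmann: cut \<open>A\<close> by a hyperplane separating two of its boxes and \<open>B\<close>
  by a parallel one in the same volume proportion. The sums of corresponding pieces lie on different
  sides of a hyperplane, so the bounds for the two pairs add up.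
\<close>

lemma bm_ineq_cut:
  fixes \<A> \<B> :: "'a::euclidean_space set set"
  assumes \<A>: "disjoint_boxes \<A>" and \<B>: "disjoint_boxes \<B>" and KL: "K \<in> \<A>" "L \<in> \<A>" "K \<noteq> L"
    and IH: "\<And>\<A>' \<B>' :: 'a set set. disjoint_boxes \<A>' \<Longrightarrow> disjoint_boxes \<B>' \<Longrightarrow> card \<A>' + card \<B>' < card \<A> + card \<B>
      \<Longrightarrow> bm_ineq (\<Union>\<A>') (\<Union>\<B>')"
  shows "bm_ineq (\<Union>\<A>) (\<Union>\<B>)"
proof -
  let ?n = "DIM('a)" and ?\<mu> = "measure (lebesgue :: 'a measure)"
  define A B where "A = \<Union>\<A>" and "B = \<Union>\<B>"
  note A = disjoint_boxes_Union[OF \<A>, folded A_def] and B = disjoint_boxes_Union[OF \<B>, folded B_def]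
  have "K \<noteq> {}" "L \<noteq> {}" "K \<inter> L = {}" and box: "\<exists>a b. K = box a b" "\<exists>a b. L = box a b"
    using \<A> KL by (auto simp: disjoint_boxes_def disjoint_def)
  then obtain i t where i: "i \<in> Basis" and
    sep: "(K \<subseteq> {x. x \<bullet> i < t} \<and> L \<subseteq> {x. x \<bullet> i > t}) \<or> (L \<subseteq> {x. x \<bullet> i < t} \<and> K \<subseteq> {x. x \<bullet> i > t})"
    by (metis separate_boxes)
  let ?H1 = "\<lambda>t. {x::'a. x \<bullet> i < t}" and ?H2 = "\<lambda>t. {x::'a. x \<bullet> i > t}"
  have ne: "A \<inter> ?H1 t \<noteq> {}" "A \<inter> ?H2 t \<noteq> {}"
    using sep KL \<open>K \<noteq> {}\<close> \<open>L \<noteq> {}\<close> unfolding A_def by blast+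
  have "\<exists>M\<in>\<A>. M \<inter> ?H1 t = {}" "\<exists>M\<in>\<A>. M \<inter> ?H2 t = {}"
    using sep KL by fastforce+
  note cutH1 = disjoint_boxes_cut[OF _ _ box_Int_halfspaces(1)[OF i]]
  note cutH2 = disjoint_boxes_cut[OF _ _ box_Int_halfspaces(2)[OF i]]
  obtain \<A>1 where \<A>1: "disjoint_boxes \<A>1" "\<Union>\<A>1 = A \<inter> ?H1 t" "card \<A>1 < card \<A>"
    using cutH1[OF \<A>, of t] ne(1) \<open>\<exists>M\<in>\<A>. M \<inter> ?H1 t = {}\<close> unfolding A_def by metis
  obtain \<A>2 where \<A>2: "disjoint_boxes \<A>2" "\<Union>\<A>2 = A \<inter> ?H2 t" "card \<A>2 < card \<A>"
    using cutH2[OF \<A>, of t] ne(2) \<open>\<exists>M\<in>\<A>. M \<inter> ?H2 t = {}\<close> unfolding A_def by metis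
  have splitA: "?\<mu> A = ?\<mu> (A \<inter> ?H1 t) + ?\<mu> (A \<inter> ?H2 t)"
    using A i by (intro measure_split_hyperplane)
  have pA: "?\<mu> (A \<inter> ?H1 t) > 0" "?\<mu> (A \<inter> ?H2 t) > 0"
    using disjoint_boxes_Union(5)[OF \<A>1(1)] disjoint_boxes_Union(5)[OF \<A>2(1)] \<A>1(2) \<A>2(2) by auto
  define \<theta> where "\<theta> = ?\<mu> (A \<inter> ?H1 t) / ?\<mu> A"
  have \<theta>: "0 < \<theta>" "\<theta> < 1" using splitA pA by (auto simp: \<theta>_def)
  have A1: "?\<mu> (A \<inter> ?H1 t) = \<theta> * ?\<mu> A" using A(5) by (simp add: \<theta>_def)
  then have A2: "?\<mu> (A \<inter> ?H2 t) = (1 - \<theta>) * ?\<mu> A" using splitA by (simp add: algebra_simps)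
  obtain s where B1: "?\<mu> (B \<inter> ?H1 s) = \<theta> * ?\<mu> B"
    using measure_halfspace_cut_IVT[OF B(1,2) i \<theta>] by blast
  have B2: "?\<mu> (B \<inter> ?H2 s) = (1 - \<theta>) * ?\<mu> B"
    using measure_split_hyperplane[OF B(1,2) i, of s] B1 by (simp add: algebra_simps)
  have neB: "B \<inter> ?H1 s \<noteq> {}" "B \<inter> ?H2 s \<noteq> {}"
    using B1 B2 \<theta> B(5) by (metis measure_empty mult_eq_0_iff less_irrefl diff_gt_0_iff_gt)+
  obtain \<B>1 where \<B>1: "disjoint_boxes \<B>1" "\<Union>\<B>1 = B \<inter> ?H1 s" "card \<B>1 \<le> card \<B>"
    using cutH1[OF \<B>, of s] neB(1) unfolding B_def by metis
  obtain \<B>2 where \<B>2: "disjoint_boxes \<B>2" "\<Union>\<B>2 = B \<inter> ?H2 s" "card \<B>2 \<le> card \<B>"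
    using cutH2[OF \<B>, of s] neB(2) unfolding B_def by metis
  let ?r = "(root ?n (?\<mu> A) + root ?n (?\<mu> B)) ^ ?n"
  \<comment> \<open>Scaling both volumes by \<open>c\<close> scales both roots by the same factor,
    hence the bound by \<open>c\<close>; the bounds for \<open>\<theta>\<close> and
    \<open>1 - \<theta>\<close> therefore add up to the bound for the whole.\<close>
  have pw: "(root ?n (c * ?\<mu> A) + root ?n (c * ?\<mu> B)) ^ ?n = c * ?r" if "0 < c" for c
    using that by (simp add: real_root_mult power_mult_distrib flip: distrib_left)
  have 1: "\<theta> * ?r \<le> ?\<mu> (minkowski_sum (A \<inter> ?H1 t) (B \<inter> ?H1 s))"
    using IH[OF \<A>1(1) \<B>1(1)] \<A>1(2,3) \<B>1(2,3) A1 B1 pw[OF \<theta>(1)] by (simp add: bm_ineq_def)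
  have 2: "(1 - \<theta>) * ?r \<le> ?\<mu> (minkowski_sum (A \<inter> ?H2 t) (B \<inter> ?H2 s))"
    using IH[OF \<A>2(1) \<B>2(1)] \<A>2(2,3) \<B>2(2,3) A2 B2 pw[of "1 - \<theta>"] \<theta> by (simp add: bm_ineq_def)
  let ?M1 = "minkowski_sum (A \<inter> ?H1 t) (B \<inter> ?H1 s)" and ?M2 = "minkowski_sum (A \<inter> ?H2 t) (B \<inter> ?H2 s)"
  have lm: "?M1 \<in> lmeasurable" "?M2 \<in> lmeasurable" "minkowski_sum A B \<in> lmeasurable"
    using A B i by (auto intro!: lmeasurable_open open_minkowski_sum bounded_minkowski_sum bounded_Int open_Int
        open_halfspace_component_lt open_halfspace_component_gt)
  have "?r = \<theta> * ?r + (1 - \<theta>) * ?r" by (simp add: algebra_simps)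
  also have "\<dots> \<le> ?\<mu> ?M1 + ?\<mu> ?M2" using 1 2 by simp
  also have "\<dots> = ?\<mu> (?M1 \<union> ?M2)"
  proof -
    have "?M1 \<inter> ?M2 = {}"
    proof -
      have "z \<bullet> i < t + s" if "z \<in> ?M1" for z
        using that unfolding minkowski_sum_def by (auto simp: inner_add_left)
      moreover have "z \<bullet> i > t + s" if "z \<in> ?M2" for z
        using that unfolding minkowski_sum_def by (auto simp: inner_add_left)
      ultimately show ?thesis by force
    qed
    then show ?thesis using measure_Un3[OF lm(1,2)] by simp
  qed
  also have "\<dots> \<le> ?\<mu> (minkowski_sum A B)"
    using lm by (intro measure_mono_fmeasurable) (auto simp: minkowski_sum_def)
  finally show ?thesis by (simp add: bm_ineq_def A_def B_def)
qed

text \<open>Induction on the total number of boxes. Whichever family has two members can be cut, by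
  symmetry of the inequality; otherwise both sets are single boxes.\<close>

lemma bm_ineq_disjoint_boxes:
  assumes "disjoint_boxes \<A>" "disjoint_boxes \<B>"
  shows "bm_ineq (\<Union>\<A>) (\<Union>\<B>)"
  using assms
proof (induction "card \<A> + card \<B>" arbitrary: \<A> \<B> rule: less_induct)
  case less
  have single: "\<exists>K. \<C> = {K}" if "disjoint_boxes \<C>" "\<not> (\<exists>K L. K \<in> \<C> \<and> L \<in> \<C> \<and> K \<noteq> L)" for \<C> :: "'a set set"
    using that unfolding disjoint_boxes_def by blast
  show ?case
  proof (cases "\<exists>K L. K \<in> \<A> \<and> L \<in> \<A> \<and> K \<noteq> L")
    case True
    then show ?thesis using bm_ineq_cut[OF less.prems] less.hyps by blast
  next
    case A: False
    show ?thesis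
    proof (cases "\<exists>K L. K \<in> \<B> \<and> L \<in> \<B> \<and> K \<noteq> L")
      case True
      then obtain K L where "K \<in> \<B>" "L \<in> \<B>" "K \<noteq> L" by blast
      then have "bm_ineq (\<Union>\<B>) (\<Union>\<A>)"
        by (rule bm_ineq_cut[OF less.prems(2,1)]) (use less.hyps in \<open>simp add: add.commute\<close>)
      then show ?thesis by (simp add: bm_ineq_commute)
    next
      case False
      then obtain K L where "\<A> = {K}" "\<B> = {L}" using single A less.prems by metis
      then have ne: "K \<noteq> {}" "L \<noteq> {}" and "\<exists>a b. K = box a b" "\<exists>c d. L = box c d"
        using less.prems by (auto simp: disjoint_boxes_def)
      then obtain a b c d where KL: "K = box a b" "L = box c d" by blast
      have "bm_ineq K L" using ne unfolding KL by (rule bm_ineq_box)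
      then show ?thesis using \<open>\<A> = {K}\<close> \<open>\<B> = {L}\<close> by simp
    qed
  qed
qed

section \<open>From unions of boxes to open and to convex sets\<close>

lemma open_approx_disjoint_boxes:
  fixes A :: "'a::euclidean_space set"
  assumes A: "open A" "bounded A" "A \<noteq> {}" and \<epsilon>: "\<epsilon> > 0"
  obtains \<A> where "disjoint_boxes \<A>" "\<Union>\<A> \<subseteq> A" "measure lebesgue A - \<epsilon> < measure lebesgue (\<Union>\<A>)"
proof -
  obtain a b where ab: "A \<subseteq> box a b" using bounded_subset_box_symmetric[OF A(2)] by blast
  then have ne: "box a b \<noteq> {}" using A by auto
  \<comment> \<open>At points of \<open>A\<close> the gauge is \<open>A\<close> itself, so every
    cube of the covering, being tagged by a point of \<open>A\<close>, lies inside
    \<open>A\<close>.\<close>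
  define g where "g x = (if x \<in> A then A else UNIV)" for x
  have "gauge g" using A by (auto simp: gauge_def g_def)
  have "A \<subseteq> cbox a b" using ab box_subset_cbox by blast
  then obtain \<D> where \<D>: "countable \<D>" "\<And>K. K \<in> \<D> \<Longrightarrow> interior K \<noteq> {} \<and> (\<exists>c d. K = cbox c d)"
    "pairwise (\<lambda>A B. interior A \<inter> interior B = {}) \<D>"
    "\<And>K. K \<in> \<D> \<Longrightarrow> \<exists>x \<in> A \<inter> K. K \<subseteq> g x" "A \<subseteq> \<Union>\<D>"
    using covering_lemma[OF _ ne \<open>gauge g\<close>] by metis
  have sub: "K \<subseteq> A" if "K \<in> \<D>" for K using \<D>(4)[OF that] by (auto simp: g_def)
  have "\<D> \<noteq> {}" using \<D>(5) A(3) by auto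
  define e where "e = from_nat_into \<D>"
  have e: "range e = \<D>" unfolding e_def using \<open>\<D> \<noteq> {}\<close> \<D>(1) by (rule range_from_nat_into)
  have eD: "e n \<in> \<D>" for n using e by auto
  have mA: "A \<in> lmeasurable" using A by (intro lmeasurable_open)
  have me: "e n \<in> lmeasurable" for n using \<D>(2)[OF eD[of n]] by auto
  have U: "(\<Union>n. \<Union>i\<le>n. e i) = A" using \<D>(5) sub e by blast
  have "(\<lambda>n. measure lebesgue (\<Union>i\<le>n. e i)) \<longlonglongrightarrow> measure lebesgue (\<Union>n. \<Union>i\<le>n. e i)"
  proof (rule measure_nested_Union)
    show m: "(\<Union>i\<le>n. e i) \<in> lmeasurable" for n using me by (intro fmeasurable.finite_UN) auto
    show "measure lebesgue (\<Union>i\<le>n. e i) \<le> measure lebesgue A" for n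
      using sub eD m mA by (intro measure_mono_fmeasurable) (auto simp: fmeasurableD)
    show "(\<Union>i\<le>n. e i) \<subseteq> (\<Union>i\<le>Suc n. e i)" for n by (rule UN_mono) auto
  qed
  then have "\<forall>\<^sub>F n in sequentially. measure lebesgue (\<Union>i\<le>n. e i) > measure lebesgue A - \<epsilon>"
    unfolding U using \<epsilon> by (intro order_tendstoD) auto
  then obtain n where n: "measure lebesgue (\<Union>i\<le>n. e i) > measure lebesgue A - \<epsilon>"
    by (auto simp: eventually_sequentially)
  let ?F = "e ` {..n}"
  let ?\<A> = "interior ` ?F"
  have F: "?F \<subseteq> \<D>" using eD by auto
  have inj: "inj_on interior ?F"
    using \<D>(2,3) F unfolding inj_on_def pairwise_def by (metis Int_absorb subsetD)
  have box: "\<exists>a b. interior K = box a b" if K: "K \<in> \<D>" for K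
  proof -
    obtain c d where "K = cbox c d" using \<D>(2)[OF K] by blast
    then have "interior K = box c d" by simp
    then show ?thesis by blast
  qed
  have "disjoint_boxes ?\<A>"
    unfolding disjoint_boxes_def
  proof (intro conjI ballI)
    show "disjoint ?\<A>"
      unfolding disjoint_def
    proof (intro ballI impI)
      fix X Y assume "X \<in> ?\<A>" "Y \<in> ?\<A>" "X \<noteq> Y"
      from \<open>X \<in> ?\<A>\<close> obtain K where "K \<in> ?F" "X = interior K" by blast
      moreover from \<open>Y \<in> ?\<A>\<close> obtain L where "L \<in> ?F" "Y = interior L" by blast
      moreover have "K \<noteq> L" using calculation \<open>X \<noteq> Y\<close> by auto
      ultimately show "X \<inter> Y = {}" using pairwiseD[OF \<D>(3), of K L] F by blast
    qed
    show "K \<noteq> {}" "\<exists>a b. K = box a b" if "K \<in> ?\<A>" for K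
    proof -
      from that obtain L where L: "L \<in> \<D>" "K = interior L" using F by blast
      show "K \<noteq> {}" "\<exists>a b. K = box a b" using \<D>(2)[OF L(1)] box[OF L(1)] L(2) by auto
    qed
  qed auto
  moreover have "\<Union>?\<A> \<subseteq> A" using sub F interior_subset by blast
  moreover have "measure lebesgue A - \<epsilon> < measure lebesgue (\<Union>?\<A>)"
  proof -
    have "measure lebesgue (\<Union>?F) \<le> (\<Sum>K\<in>?F. measure lebesgue K)"
      using me by (intro measure_Union_le) (auto simp: fmeasurableD)
    also have "\<dots> = (\<Sum>K\<in>?F. measure lebesgue (interior K))"
    proof (intro sum.cong refl)
      fix K assume "K \<in> ?F"
      then obtain c d where K: "K = cbox c d" using \<D>(2) F by blast
      show "measure lebesgue K = measure lebesgue (interior K)"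
        by (simp add: K measure_lborel_cbox_eq measure_lborel_box_eq)
    qed
    also have "\<dots> = (\<Sum>K\<in>?\<A>. measure lebesgue K)" using inj by (simp add: sum.reindex)
    also have "\<dots> = measure lebesgue (\<Union>?\<A>)"
    proof (rule measure_negligible_finite_Union[symmetric])
      show "S \<in> lmeasurable" if "S \<in> ?\<A>" for S 
      proof -
        from that obtain L where L: "L \<in> \<D>" "S = interior L" using F by blast
        then obtain a b where "S = box a b" using box by blast
        then show ?thesis by simp
      qed
      show "pairwise (\<lambda>S T. negligible (S \<inter> T)) ?\<A>"
        using \<open>disjoint_boxes ?\<A>\<close> by (simp add: disjoint_boxes_def pairwise_def disjnt_def)
    qed auto
    finally show ?thesis using n by simp
  qed
  ultimately show ?thesis using that by blast
qed

theorem Brunn_Minkowski_open: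
  fixes A B :: "'a::euclidean_space set"
  assumes A: "open A" "bounded A" "A \<noteq> {}" and B: "open B" "bounded B" "B \<noteq> {}"
  shows "bm_ineq A B"
proof -
  have approx: "\<exists>\<C>. \<forall>n. disjoint_boxes (\<C> n) \<and> \<Union>(\<C> n) \<subseteq> S \<and> measure lebesgue S - inverse (real (Suc n)) < measure lebesgue (\<Union>(\<C> n))"
    if S: "open S" "bounded S" "S \<noteq> {}" for S :: "'a set"
  proof (rule choice, rule allI)
    fix n
    have "inverse (real (Suc n)) > 0" by simp
    then show "\<exists>\<C>. disjoint_boxes \<C> \<and> \<Union>\<C> \<subseteq> S \<and> measure lebesgue S - inverse (real (Suc n)) < measure lebesgue (\<Union>\<C>)"
      by (rule open_approx_disjoint_boxes[OF S]) (intro exI conjI)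
  qed
  have lim: "(\<lambda>n. measure lebesgue (\<Union>(\<C> n))) \<longlonglongrightarrow> measure lebesgue S"
    if S: "open S" "bounded S" and \<C>: "\<forall>n. disjoint_boxes (\<C> n) \<and> \<Union>(\<C> n) \<subseteq> S \<and> measure lebesgue S - inverse (real (Suc n)) < measure lebesgue (\<Union>(\<C> n))"
    for S :: "'a set" and \<C>
  proof (rule tendsto_sandwich[where f="\<lambda>n. measure lebesgue S - inverse (real (Suc n))" and h="\<lambda>n. measure lebesgue S"])
    show "(\<lambda>n. measure lebesgue S - inverse (real (Suc n))) \<longlonglongrightarrow> measure lebesgue S"
      using tendsto_diff[OF tendsto_const LIMSEQ_inverse_real_of_nat, of "measure lebesgue S"] by simp
    show "\<forall>\<^sub>F n in sequentially. measure lebesgue (\<Union>(\<C> n)) \<le> measure lebesgue S"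
    proof (intro always_eventually allI measure_mono_fmeasurable)
      show "\<Union>(\<C> n) \<in> sets lebesgue" for n
        using \<C> by (intro fmeasurableD disjoint_boxes_Union(4)) auto
      show "\<Union>(\<C> n) \<subseteq> S" for n using \<C> by blast
      show "S \<in> lmeasurable" using S by (intro lmeasurable_open)
    qed
  qed (use \<C> in \<open>auto intro!: always_eventually less_imp_le\<close>)
  obtain \<A> where \<A>: "\<forall>n. disjoint_boxes (\<A> n) \<and> \<Union>(\<A> n) \<subseteq> A \<and> measure lebesgue A - inverse (real (Suc n)) < measure lebesgue (\<Union>(\<A> n))"
    using approx[OF A] by blast
  obtain \<B> where \<B>: "\<forall>n. disjoint_boxes (\<B> n) \<and> \<Union>(\<B> n) \<subseteq> B \<and> measure lebesgue B - inverse (real (Suc n)) < measure lebesgue (\<Union>(\<B> n))"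
    using approx[OF B] by blast
  have "(\<lambda>n. (root DIM('a) (measure lebesgue (\<Union>(\<A> n))) + root DIM('a) (measure lebesgue (\<Union>(\<B> n)))) ^ DIM('a))
      \<longlonglongrightarrow> (root DIM('a) (measure lebesgue A) + root DIM('a) (measure lebesgue B)) ^ DIM('a)"
    by (intro tendsto_intros lim \<A> \<B> A B)
  moreover have "(root DIM('a) (measure lebesgue (\<Union>(\<A> n))) + root DIM('a) (measure lebesgue (\<Union>(\<B> n)))) ^ DIM('a)
      \<le> measure lebesgue (minkowski_sum A B)" for n
  proof -
    have "bm_ineq (\<Union>(\<A> n)) (\<Union>(\<B> n))" using \<A> \<B> by (intro bm_ineq_disjoint_boxes) auto
    moreover have "measure lebesgue (minkowski_sum (\<Union>(\<A> n)) (\<Union>(\<B> n))) \<le> measure lebesgue (minkowski_sum A B)"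
    proof (intro measure_mono_fmeasurable minkowski_sum_mono fmeasurableD[OF lmeasurable_open] lmeasurable_open open_minkowski_sum bounded_minkowski_sum)
      show "open (\<Union>(\<A> n))" "bounded (\<Union>(\<A> n))" "bounded (\<Union>(\<B> n))" "\<Union>(\<A> n) \<subseteq> A" "\<Union>(\<B> n) \<subseteq> B"
        using \<A> \<B> by (simp_all add: disjoint_boxes_Union)
    qed (use A B in auto)
    ultimately show ?thesis unfolding bm_ineq_def by linarith
  qed
  ultimately show ?thesis unfolding bm_ineq_def by (intro LIMSEQ_le_const2) auto
qed

text \<open>A convex set differs from its interior by a null set, which reduces the claim to open
  sets. A null summand may have empty interior; then the sum contains a translate of the other
  summand, and this is enough.\<close>

theorem Brunn_Minkowski_compact_convex:
  fixes K L :: "'a::euclidean_space set"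
  assumes K: "compact K" "convex K" "K \<noteq> {}" and L: "compact L" "convex L" "L \<noteq> {}"
  shows "root DIM('a) (measure lebesgue K) + root DIM('a) (measure lebesgue L) \<le>
    root DIM('a) (measure lebesgue (minkowski_sum K L))"
proof -
  have mKL: "minkowski_sum K L \<in> lmeasurable"
    unfolding minkowski_sum_def using K L by (intro lmeasurable_compact compact_sums)
  have int: "measure lebesgue (interior S) = measure lebesgue S" if "compact S" "convex S" for S :: "'a set"
  proof -
    have "negligible (S - interior S \<union> (interior S - S))"
    proof (rule negligible_subset[OF negligible_convex_frontier[OF that(2)]])
      show "S - interior S \<union> (interior S - S) \<subseteq> frontier S"
        unfolding frontier_def using closure_subset interior_subset by fast
    qed
    moreover have "S \<in> lmeasurable" using that(1) by (rule lmeasurable_compact)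
    ultimately show ?thesis by (intro measure_negligible_symdiff)
  qed
  have triv: "measure lebesgue T \<le> measure lebesgue (minkowski_sum S T)"
    if "compact T" "compact S" "S \<noteq> {}" for S T :: "'a set"
  proof -
    obtain s where s: "s \<in> S" using \<open>S \<noteq> {}\<close> by blast
    have "measure lebesgue T = measure lebesgue ((+) s ` T)" by (simp add: measure_translation)
    also have "\<dots> \<le> measure lebesgue (minkowski_sum S T)"
    proof (rule measure_mono_fmeasurable)
      show "(+) s ` T \<subseteq> minkowski_sum S T" using s by (auto simp: minkowski_sum_def)
      show "(+) s ` T \<in> sets lebesgue"
        using that by (intro fmeasurableD lmeasurable_compact compact_translation)
      show "minkowski_sum S T \<in> lmeasurable"
        unfolding minkowski_sum_def using that by (intro lmeasurable_compact compact_sums)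
    qed
    finally show ?thesis .
  qed
  consider "measure lebesgue K = 0" | "measure lebesgue L = 0"
    | "measure lebesgue K > 0" "measure lebesgue L > 0"
    by (meson zero_less_measure_iff)
  then show ?thesis
  proof cases
    case 1
    then show ?thesis using triv[of L K] K L by simp
  next
    case 2
    then show ?thesis using triv[of K L] K L by (simp add: minkowski_sum_commute)
  next
    case 3
    have "interior K \<noteq> {}" "interior L \<noteq> {}"
      using 3 int[OF K(1,2)] int[OF L(1,2)] by (metis less_irrefl measure_empty)+
    then have "bm_ineq (interior K) (interior L)"
      using K L by (intro Brunn_Minkowski_open bounded_interior compact_imp_bounded) auto
    then have "(root DIM('a) (measure lebesgue K) + root DIM('a) (measure lebesgue L)) ^ DIM('a) \<le>
        measure lebesgue (minkowski_sum (interior K) (interior L))"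
      unfolding bm_ineq_def int[OF K(1,2)] int[OF L(1,2)] .
    also have "\<dots> \<le> measure lebesgue (minkowski_sum K L)"
    proof (rule measure_mono_fmeasurable[OF _ _ mKL])
      show "minkowski_sum (interior K) (interior L) \<subseteq> minkowski_sum K L"
        by (intro minkowski_sum_mono interior_subset)
      show "minkowski_sum (interior K) (interior L) \<in> sets lebesgue"
        by (simp add: borel_open open_minkowski_sum)
    qed
    finally have "root DIM('a) ((root DIM('a) (measure lebesgue K) + root DIM('a) (measure lebesgue L)) ^ DIM('a)) \<le>
        root DIM('a) (measure lebesgue (minkowski_sum K L))" by simp
    then show ?thesis by (simp add: real_root_power_cancel add_nonneg_nonneg)
  qed
qed

text \<open>Compactness and convexity are carried along because each partial sum becomes a summand
  in the next step.\<close>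

lemma Brunn_Minkowski_sum:
  fixes S :: "'i \<Rightarrow> 'a::euclidean_space set"
  assumes "finite F" "\<And>k. k \<in> F \<Longrightarrow> compact (S k) \<and> convex (S k) \<and> S k \<noteq> {}"
  defines "T \<equiv> \<lambda>F. {\<Sum>k\<in>F. y k | y. \<forall>k\<in>F. y k \<in> S k}"
  shows "compact (T F) \<and> convex (T F) \<and> T F \<noteq> {} \<and>
    (\<Sum>k\<in>F. root DIM('a) (measure lebesgue (S k))) \<le> root DIM('a) (measure lebesgue (T F))"
  using assms(1,2)
proof (induction F)
  case empty
  have "T {} = {0}" by (auto simp: T_def)
  then show ?case by simp
next
  case (insert k F)
  have "T (insert k F) = minkowski_sum (S k) (T F)"
  proof (rule set_eqI, rule iffI)
    fix x assume "x \<in> T (insert k F)"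
    then show "x \<in> minkowski_sum (S k) (T F)"
      using insert.hyps unfolding T_def minkowski_sum_def by auto
  next
    fix x assume "x \<in> minkowski_sum (S k) (T F)"
    then obtain a y where a: "a \<in> S k" "\<forall>j\<in>F. y j \<in> S j" "x = a + (\<Sum>j\<in>F. y j)"
      unfolding T_def minkowski_sum_def by auto
    have "(\<Sum>j\<in>F. (y(k := a)) j) = (\<Sum>j\<in>F. y j)"
      using insert.hyps by (intro sum.cong) auto
    then have "x = (\<Sum>j\<in>insert k F. (y(k := a)) j)"
      using insert.hyps a(3) by simp
    moreover have "\<forall>j\<in>insert k F. (y(k := a)) j \<in> S j" using a by auto
    ultimately show "x \<in> T (insert k F)" unfolding T_def by blast
  qed
  moreover have Sk: "compact (S k)" "convex (S k)" "S k \<noteq> {}" using insert.prems by auto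
  moreover have TF: "compact (T F)" "convex (T F)" "T F \<noteq> {}"
    and le: "(\<Sum>k\<in>F. root DIM('a) (measure lebesgue (S k))) \<le> root DIM('a) (measure lebesgue (T F))"
    using insert.IH insert.prems by auto
  moreover have "compact (minkowski_sum (S k) (T F))"
    unfolding minkowski_sum_def using Sk TF by (intro compact_sums)
  moreover have "convex (minkowski_sum (S k) (T F))"
  proof -
    have "minkowski_sum (S k) (T F) = (\<Union>x\<in>S k. \<Union>y\<in>T F. {x + y})"
      unfolding minkowski_sum_def by auto
    then show ?thesis using convex_sums[OF Sk(2) TF(2)] by simp
  qed
  moreover have "minkowski_sum (S k) (T F) \<noteq> {}" using Sk TF by (auto simp: minkowski_sum_def)
  ultimately show ?case
    using Brunn_Minkowski_compact_convex[OF Sk TF] le insert.hyps by simp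
qed

section \<open>The discrete Monge-Ampere problem\<close>

text \<open>The subdifferential cut down to slopes of norm at most \<open>R\<close>. The bound makes
  it compact, and its being nonempty at every point encodes in one condition that \<open>u\<close>
  is convex and \<open>R\<close>-Lipschitz.\<close>

definition subdiff :: "real \<Rightarrow> ('a::euclidean_space \<Rightarrow> real) \<Rightarrow> 'a \<Rightarrow> 'a set" where
  "subdiff R u x = {p \<in> cball 0 R. \<forall>z. u x + p \<bullet> (z - x) \<le> u z}"

lemma subdiff_eq_Int: "subdiff R u x = cball 0 R \<inter> (\<Inter>z. {p. p \<bullet> (z - x) \<le> u z - u x})"
  by (auto simp: subdiff_def algebra_simps)

lemma compact_subdiff: "compact (subdiff R u x)"
  unfolding subdiff_eq_Int
  by (intro compact_Int_closed closed_INT ballI closed_Collect_le continuous_intros) auto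

lemma convex_subdiff: "convex (subdiff R u x)"
proof -
  have "convex {p. p \<bullet> (z - x) \<le> u z - u x}" for z
    using convex_halfspace_le[of "z - x" "u z - u x"] by (simp add: inner_commute)
  then show ?thesis unfolding subdiff_eq_Int by (intro convex_Int convex_INT) auto
qed

lemma subdiff_nonempty_imp_Lipschitz:
  fixes u :: "'a::euclidean_space \<Rightarrow> real"
  assumes "\<And>x. subdiff R u x \<noteq> {}"
  shows "\<bar>u x - u y\<bar> \<le> R * dist x y"
proof -
  have "u x - u y \<le> R * dist x y" for x y
  proof -
    obtain p where p: "p \<in> cball 0 R" "u x + p \<bullet> (y - x) \<le> u y" using assms[of x] by (auto simp: subdiff_def)
    have "u x - u y \<le> p \<bullet> (x - y)" using p(2) by (simp add: inner_diff_right)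
    also have "\<dots> \<le> norm p * norm (x - y)" by (rule norm_cauchy_schwarz)
    also have "\<dots> \<le> R * norm (x - y)" using p(1) by (intro mult_right_mono) auto
    finally show ?thesis by (simp add: dist_norm)
  qed
  from this[of x y] this[of y x] show ?thesis by (simp add: dist_commute abs_le_iff)
qed

lemma subdiff_nonempty_imp_convex_on:
  fixes u :: "'a::euclidean_space \<Rightarrow> real"
  assumes "\<And>x. subdiff R u x \<noteq> {}"
  shows "convex_on UNIV u"
proof (rule convex_onI)
  fix t :: real and x y :: 'a assume t: "0 < t" "t < (1::real)"
  let ?z = "(1 - t) *\<^sub>R x + t *\<^sub>R y"
  obtain p where p: "\<And>w. u ?z + p \<bullet> (w - ?z) \<le> u w" using assms[of ?z] by (auto simp: subdiff_def)
  have "(1 - t) * (u ?z + p \<bullet> (x - ?z)) + t * (u ?z + p \<bullet> (y - ?z)) \<le> (1 - t) * u x + t * u y"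
    using t p by (intro add_mono mult_left_mono) auto
  moreover have "(1 - t) * (u ?z + p \<bullet> (x - ?z)) + t * (u ?z + p \<bullet> (y - ?z)) = u ?z"
  proof -
    have "x - ?z = t *\<^sub>R (x - y)" "y - ?z = (1 - t) *\<^sub>R (y - x)" by (simp_all add: algebra_simps)
    then show ?thesis by (simp only: inner_scaleR_right) (simp add: inner_diff_right algebra_simps)
  qed
  ultimately show "u ?z \<le> (1 - t) * u x + t * u y" by simp
qed auto

text \<open>Tychonoff's theorem in the product topology on functions. It serves twice: for
  minimising the dual functional and for extracting convergent subsequences of potentials.\<close>

lemma compact_function_box:
  fixes S :: "'i \<Rightarrow> real set"
  assumes "\<And>i. compact (S i)"
  shows "compact {h. \<forall>i. h i \<in> S i}"
proof -
  have "compactin (product_topology (\<lambda>i. euclidean) UNIV) (PiE UNIV S)"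
    using assms by (subst compactin_PiE) auto
  moreover have "PiE UNIV S = {h. \<forall>i. h i \<in> S i}" by auto
  ultimately show ?thesis by (simp only: euclidean_product_topology compactin_euclidean_iff)
qed

section \<open>Optimal transport from a ball to finitely many point masses\<close>

locale discrete_target =
  fixes P :: "'a::euclidean_space set" and m :: "'a \<Rightarrow> real" and R :: real
  assumes fin: "finite P" and ne: "P \<noteq> {}" and mpos: "\<And>x. x \<in> P \<Longrightarrow> 0 < m x" and Rpos: "0 < R"
    and mass: "(\<Sum>x\<in>P. m x) = measure lebesgue (cball (0::'a) R)"
begin

text \<open>The Legendre transform of \<open>h\<close> restricted to \<open>P\<close>. The regions
  on which a given \<open>x\<close> attains the maximum are the cells sent to \<open>x\<close> by
  the transport.\<close>

definition V :: "('a \<Rightarrow> real) \<Rightarrow> 'a \<Rightarrow> real" where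
  "V h y = Max ((\<lambda>x. x \<bullet> y - h x) ` P)"

lemma V_ge: "x \<in> P \<Longrightarrow> x \<bullet> y - h x \<le> V h y"
  unfolding V_def using fin by (intro Max_ge) auto

lemma V_attained: "\<exists>x\<in>P. V h y = x \<bullet> y - h x"
proof -
  have "V h y \<in> (\<lambda>x. x \<bullet> y - h x) ` P" unfolding V_def using fin ne by (intro Max_in) auto
  then show ?thesis by auto
qed

lemma V_le_add:
  assumes "\<And>x. x \<in> P \<Longrightarrow> k x \<le> h x + \<epsilon>"
  shows "V h y \<le> V k y + \<epsilon>"
proof -
  obtain x where "x \<in> P" "V h y = x \<bullet> y - h x" using V_attained by blast
  then show ?thesis using V_ge[of x y k] assms[of x] by linarith
qed

lemma continuous_on_V: "continuous_on S (V h)"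
proof -
  let ?L = "\<Sum>x\<in>P. norm x"
  have L: "V h y - V h z \<le> ?L * dist y z" for y z
  proof -
    obtain x where x: "x \<in> P" "V h y = x \<bullet> y - h x" using V_attained by blast
    then have "V h y - V h z \<le> x \<bullet> (y - z)" using V_ge[of x z h] by (simp add: inner_diff_right)
    also have "\<dots> \<le> norm x * norm (y - z)" by (rule norm_cauchy_schwarz)
    also have "\<dots> \<le> ?L * norm (y - z)" using x fin by (intro mult_right_mono member_le_sum) auto
    finally show ?thesis by (simp add: dist_norm)
  qed
  have "?L-lipschitz_on S (V h)"
  proof (rule lipschitz_onI)
    show "dist (V h x) (V h y) \<le> ?L * dist x y" for x y
      using L[of x y] L[of y x] by (simp add: dist_real_def dist_commute abs_le_iff)
  qed (simp add: sum_nonneg)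
  then show ?thesis by (rule lipschitz_on_continuous_on)
qed

abbreviation M :: "'a measure" where "M \<equiv> lebesgue_on (cball (0::'a) R)"
definition vol :: real where "vol = (\<Sum>x\<in>P. m x)"

lemma vol_eq: "vol = measure lebesgue (cball (0::'a) R)" by (simp add: vol_def mass)

lemma finite_measure_M: "finite_measure M"
  by (intro finite_measure_lebesgue_on lmeasurable_cball)

lemma vol_pos: "vol > 0" using Rpos by (simp add: vol_eq content_cball_pos)

lemma measure_M_space: "measure M (space M) = vol" by (simp add: vol_eq measure_restrict_space)

lemma integrable_V: "integrable M (V h)"
proof -
  interpret finite_measure M by (rule finite_measure_M)
  have "compact (V h ` cball 0 R)" by (intro compact_continuous_image continuous_on_V) auto
  then obtain B where B: "\<And>y. y \<in> cball 0 R \<Longrightarrow> norm (V h y) \<le> B"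
    using compact_imp_bounded bounded_iff by (metis imageI)
  show ?thesis
  proof (rule integrable_const_bound[of _ B])
    show "AE x in M. norm (V h x) \<le> B" using B by (intro AE_I2) (simp add: space_restrict_space)
    show "V h \<in> borel_measurable M"
      by (intro continuous_imp_measurable_on_sets_lebesgue continuous_on_V) auto
  qed
qed

text \<open>
  Kantorovich's dual functional for transporting Lebesgue measure on the ball to the point masses \<open>m\<close>.
\<close>

definition \<Phi> :: "('a \<Rightarrow> real) \<Rightarrow> real" where
  "\<Phi> h = (LINT y|M. V h y) + (\<Sum>x\<in>P. m x * h x)"

lemma integral_const_M: "(LINT y|M. c) = vol * c"
  unfolding lebesgue_integral_const measure_M_space by simp

lemma integrable_const_M: "integrable M (\<lambda>_. c :: real)"
  using finite_measure.integrable_const[OF finite_measure_M] .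

text \<open>Here the equality of the two total masses enters: what the integral of \<open>V\<close>
  loses, the linear term regains. It permits normalising the minimum of \<open>h\<close> on
  \<open>P\<close> to 0.\<close>

lemma \<Phi>_shift: "\<Phi> (\<lambda>x. h x + c) = \<Phi> h"
proof -
  have "V (\<lambda>x. h x + c) y = V h y + - c" for y
  proof (rule antisym)
    show "V (\<lambda>x. h x + c) y \<le> V h y + - c" by (rule V_le_add) simp
    have "V h y \<le> V (\<lambda>x. h x + c) y + c" by (rule V_le_add) simp
    then show "V h y + - c \<le> V (\<lambda>x. h x + c) y" by simp
  qed
  then have "(LINT y|M. V (\<lambda>x. h x + c) y) = (LINT y|M. V h y + - c)"
    by (intro Bochner_Integration.integral_cong refl)
  moreover have "(LINT y|M. V h y + - c) = (LINT y|M. V h y) + vol * - c"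
    by (subst Bochner_Integration.integral_add[OF integrable_V integrable_const_M]) (simp only: integral_const_M)
  moreover have "(\<Sum>x\<in>P. m x * (h x + c)) = (\<Sum>x\<in>P. m x * h x) + vol * c"
    by (simp add: distrib_left sum.distrib vol_def flip: sum_distrib_right)
  ultimately show ?thesis unfolding \<Phi>_def by simp
qed

lemma \<Phi>_cong: "(\<And>x. x \<in> P \<Longrightarrow> h x = k x) \<Longrightarrow> \<Phi> h = \<Phi> k"
proof -
  assume eq: "\<And>x. x \<in> P \<Longrightarrow> h x = k x"
  then have "V h = V k" unfolding V_def by (intro ext arg_cong[where f=Max] image_cong) auto
  then show ?thesis using eq by (simp add: \<Phi>_def)
qed

text \<open>A Lipschitz bound in finitely many coordinates, which yields continuity for the product
  topology; exchanging \<open>h\<close> and \<open>k\<close> gives the other sign.\<close>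

lemma \<Phi>_diff_le: "\<Phi> h - \<Phi> k \<le> 2 * vol * (\<Sum>x\<in>P. \<bar>h x - k x\<bar>)"
proof -
  let ?d = "\<Sum>x\<in>P. \<bar>h x - k x\<bar>"
  have d: "\<bar>h x - k x\<bar> \<le> ?d" if "x \<in> P" for x using fin that by (intro member_le_sum) auto
  have "(LINT y|M. V h y) \<le> (LINT y|M. V k y + ?d)"
  proof (intro integral_mono integrable_V Bochner_Integration.integrable_add integrable_const_M V_le_add)
    show "k x \<le> h x + ?d" if "x \<in> P" for x using d[OF that] by linarith
  qed
  also have "\<dots> = (LINT y|M. V k y) + vol * ?d"
    by (subst Bochner_Integration.integral_add[OF integrable_V integrable_const_M]) (simp only: integral_const_M)
  finally have 1: "(LINT y|M. V h y) - (LINT y|M. V k y) \<le> vol * ?d" by simp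
  have "(\<Sum>x\<in>P. m x * h x) - (\<Sum>x\<in>P. m x * k x) = (\<Sum>x\<in>P. m x * (h x - k x))"
    by (simp add: right_diff_distrib sum_subtractf)
  also have "\<dots> \<le> (\<Sum>x\<in>P. m x * ?d)"
    using d mpos by (intro sum_mono mult_left_mono) (fastforce simp: abs_le_iff intro: less_imp_le)+
  also have "\<dots> = vol * ?d" by (simp add: vol_def flip: sum_distrib_right)
  finally show ?thesis using 1 by (simp add: \<Phi>_def)
qed

lemma continuous_on_\<Phi>: "continuous_on UNIV \<Phi>"
  unfolding continuous_on_def
proof (intro ballI)
  fix h :: "'a \<Rightarrow> real"
  have c: "((\<lambda>k. k x) \<longlongrightarrow> h x) (at h)" for x
    using continuous_on_product_coordinates[of x] unfolding continuous_on_def by auto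
  have "((\<lambda>k. 2 * vol * (\<Sum>x\<in>P. \<bar>k x - h x\<bar>)) \<longlongrightarrow> 2 * vol * (\<Sum>x\<in>P. \<bar>h x - h x\<bar>)) (at h)"
    by (intro tendsto_intros c)
  then have "((\<lambda>k. 2 * vol * (\<Sum>x\<in>P. \<bar>k x - h x\<bar>)) \<longlongrightarrow> 0) (at h)" by simp
  then have "((\<lambda>k. \<Phi> k - \<Phi> h) \<longlongrightarrow> 0) (at h)"
  proof (rule Lim_null_comparison[rotated], intro always_eventually allI)
    fix k show "norm (\<Phi> k - \<Phi> h) \<le> 2 * vol * (\<Sum>x\<in>P. \<bar>k x - h x\<bar>)"
      using \<Phi>_diff_le[of h k] \<Phi>_diff_le[of k h] by (simp add: abs_le_iff abs_minus_commute)
  qed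
  then show "(\<Phi> \<longlongrightarrow> \<Phi> h) (at h)" by (simp add: LIM_zero_iff)
qed

text \<open>Coercivity modulo constants: once the minimum on \<open>P\<close> is 0, a large value at
  a single point makes the linear term outweigh the integral. So it suffices to minimise over a
  compact box.\<close>

lemma \<Phi>_minimizer: obtains h where "\<And>k. \<Phi> h \<le> \<Phi> k"
proof -
  define D where "D = R * (\<Sum>x\<in>P. norm x)"
  have D: "\<bar>x \<bullet> y\<bar> \<le> D" if "x \<in> P" "y \<in> cball 0 R" for x y
  proof -
    have "\<bar>x \<bullet> y\<bar> \<le> norm x * norm y" by (rule Cauchy_Schwarz_ineq2)
    also have "\<dots> \<le> (\<Sum>x\<in>P. norm x) * R" using that fin by (intro mult_mono member_le_sum sum_nonneg) auto
    finally show ?thesis by (simp add: D_def mult.commute)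
  qed
  define \<mu> where "\<mu> = Min (m ` P)"
  have \<mu>: "\<mu> > 0" "\<And>x. x \<in> P \<Longrightarrow> \<mu> \<le> m x" using fin ne mpos by (auto simp: \<mu>_def)
  \<comment> \<open>The integral of \<open>V\<close> is at least \<open>- vol * D\<close> for
    normalised competitors, and \<open>\<Phi>\<close> is at most \<open>vol * D\<close> at 0. A
    value above \<open>K\<close> adds at least \<open>\<mu> * K = 2 * D * vol\<close>, which closes
    this gap.\<close>
  define K where "K = 2 * D * vol / \<mu>"
  have "D \<ge> 0" using Rpos by (simp add: D_def sum_nonneg)
  then have K: "K \<ge> 0" using \<mu> vol_pos by (simp add: K_def)
  let ?C = "{h :: 'a \<Rightarrow> real. \<forall>x. h x \<in> {0..K}}"
  have "compact ?C" by (rule compact_function_box) auto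
  moreover have z: "(\<lambda>_. 0) \<in> ?C" using K by auto
  ultimately have "\<exists>h\<in>?C. \<forall>k\<in>?C. \<Phi> h \<le> \<Phi> k"
    by (intro continuous_attains_inf continuous_on_subset[OF continuous_on_\<Phi> subset_UNIV]) auto
  then obtain h where h: "h \<in> ?C" "\<And>k. k \<in> ?C \<Longrightarrow> \<Phi> h \<le> \<Phi> k" by (elim bexE) (rule that, auto)
  have \<Phi>0: "\<Phi> (\<lambda>_. 0) \<le> vol * D"
  proof -
    have "(LINT y|M. V (\<lambda>_. 0) y) \<le> (LINT y|M. D)"
    proof (intro integral_mono integrable_V integrable_const_M)
      fix y assume "y \<in> space M"
      then show "V (\<lambda>_. 0) y \<le> D"
        using V_attained[of "\<lambda>_. 0" y] D by (force simp: space_restrict_space abs_le_iff)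
    qed
    then show ?thesis unfolding \<Phi>_def integral_const_M by simp
  qed
  have "\<Phi> h \<le> \<Phi> k" for k
  proof -
    define c where "c = Min (k ` P)"
    have c: "c \<le> k x" if "x \<in> P" for x using fin that by (simp add: c_def)
    have "c \<in> k ` P" unfolding c_def using fin ne by (intro Min_in) auto
    then obtain x1 where x1: "x1 \<in> P" "k x1 = c" by auto
    define k' where "k' x = (if x \<in> P then k x - c else 0)" for x
    have k': "\<Phi> k = \<Phi> k'"
    proof -
      have "\<Phi> k' = \<Phi> (\<lambda>x. k x + - c)" by (rule \<Phi>_cong) (simp add: k'_def)
      also have "\<dots> = \<Phi> k" by (rule \<Phi>_shift)
      finally show ?thesis by simp
    qed
    have nn: "k' x \<ge> 0" for x using c by (simp add: k'_def)
    show ?thesis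
    proof (cases "k' \<in> ?C")
      case True then show ?thesis using h(2) k' by simp
    next
      case False
      then obtain x0 where "k' x0 > K" using nn by (auto simp: not_le)
      moreover from this have x0: "x0 \<in> P" using K by (auto simp: k'_def split: if_splits)
      ultimately have "\<mu> * K \<le> m x0 * k' x0" using \<mu> K less_imp_le[OF mpos[OF x0]] by (intro mult_mono) auto
      also have "\<dots> \<le> (\<Sum>x\<in>P. m x * k' x)"
        using fin x0 nn less_imp_le[OF mpos] by (intro member_le_sum mult_nonneg_nonneg) auto
      finally have 1: "2 * D * vol \<le> (\<Sum>x\<in>P. m x * k' x)" using \<mu> by (simp add: K_def)
      have "(LINT y|M. - D) \<le> (LINT y|M. V k' y)"
      proof (intro integral_mono integrable_V integrable_const_M)
        fix y assume "y \<in> space M"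
        then have "- D \<le> x1 \<bullet> y" using D[OF x1(1), of y] by (simp add: space_restrict_space abs_le_iff)
        also have "\<dots> \<le> V k' y" using V_ge[OF x1(1), of y k'] x1 by (simp add: k'_def)
        finally show "- D \<le> V k' y" .
      qed
      then have "- (vol * D) \<le> (LINT y|M. V k' y)" unfolding integral_const_M by simp
      then have "vol * D \<le> \<Phi> k'" using 1 by (simp add: \<Phi>_def algebra_simps)
      then show ?thesis using \<Phi>0 h(2)[OF z] k' by simp
    qed
  qed
  then show ?thesis using that by blast
qed

text \<open>
  First variation: lowering \<open>h\<close> at \<open>x0\<close> by \<open>t\<close> raises \<open>V h\<close> by at most \<open>t\<close>, and only on the set
  \<open>C t\<close>, while the linear part of \<open>\<Phi>\<close> drops by \<open>t * m x0\<close>; then let \<open>t\<close> tend to \<open>0\<close>.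
\<close>

lemma cell_measure_ge:
  assumes min: "\<And>k. \<Phi> h \<le> \<Phi> k" and x0: "x0 \<in> P"
  shows "m x0 \<le> measure lebesgue {y \<in> cball 0 R. \<forall>x\<in>P. x \<bullet> y - h x \<le> x0 \<bullet> y - h x0}"
proof -
  define C where "C t = {y \<in> cball 0 R. \<forall>x\<in>P. x \<bullet> y - h x \<le> x0 \<bullet> y - h x0 + t}" for t :: real
  have C_eq: "C t = cball 0 R \<inter> (\<Inter>x\<in>P. {y. x \<bullet> y - h x \<le> x0 \<bullet> y - h x0 + t})" for t
    by (auto simp: C_def)
  have compC: "compact (C t)" for t
    unfolding C_eq by (intro compact_Int_closed closed_INT ballI closed_Collect_le continuous_intros) auto
  have mC: "C t \<in> lmeasurable" for t using compC by (rule lmeasurable_compact)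
  have ge: "m x0 \<le> measure lebesgue (C t)" if t: "t > 0" for t
  proof -
    define k where "k = h(x0 := h x0 - t)"
    have Vk: "V k y \<le> V h y + t * indicator (C t) y" if y: "y \<in> cball 0 R" for y
    proof (cases "y \<in> C t")
      case True then show ?thesis using V_le_add[of h k t y] t by (auto simp: k_def)
    next
      case False
      then obtain x where x: "x \<in> P" "x \<bullet> y - h x > x0 \<bullet> y - h x0 + t" using y by (auto simp: C_def)
      obtain x' where x': "x' \<in> P" "V k y = x' \<bullet> y - k x'" using V_attained by blast
      show ?thesis
      proof (cases "x' = x0")
        case True
        then show ?thesis using x' x V_ge[OF x(1), of y h] False by (simp add: k_def)
      next
        case neq: False
        then show ?thesis using x' V_ge[OF x'(1), of y h] False by (simp add: k_def)
      qed
    qed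
    have ind: "integrable M (\<lambda>y. t * indicator (C t) y)" "(LINT y|M. t * indicator (C t) y) = t * measure lebesgue (C t)"
    proof -
      have "C t \<in> sets M" "C t \<subseteq> cball 0 R"
        using mC by (auto simp: sets_restrict_space C_def intro!: image_eqI[of _ _ "C t"])
      then have s: "C t \<in> sets M" "measure M (C t) = measure lebesgue (C t)"
        by (auto simp: measure_restrict_space)
      have "emeasure M (C t) = emeasure lebesgue (C t)"
        using \<open>C t \<subseteq> cball 0 R\<close> by (intro emeasure_restrict_space) auto
      then have s': "emeasure M (C t) < \<infinity>" using fmeasurableD2[OF mC[of t]] by (metis infinity_ennreal_def less_top)
      then show "integrable M (\<lambda>y. t * indicator (C t) y)"
        using s s' by (intro integrable_mult_right integrable_real_indicator)
      show "(LINT y|M. t * indicator (C t) y) = t * measure lebesgue (C t)"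
        using s sets.sets_into_space[OF s(1)] by (simp add: Int_absorb1 Int_absorb2)
    qed
    have "(LINT y|M. V k y) \<le> (LINT y|M. V h y + t * indicator (C t) y)"
      using Vk by (intro integral_mono integrable_V Bochner_Integration.integrable_add ind) (auto simp: space_restrict_space)
    also have "\<dots> = (LINT y|M. V h y) + t * measure lebesgue (C t)"
      by (subst Bochner_Integration.integral_add[OF integrable_V ind(1)]) (simp only: ind(2))
    finally have "\<Phi> k \<le> \<Phi> h + t * measure lebesgue (C t) + ((\<Sum>x\<in>P. m x * k x) - (\<Sum>x\<in>P. m x * h x))"
      by (simp add: \<Phi>_def)
    also have "(\<Sum>x\<in>P. m x * k x) - (\<Sum>x\<in>P. m x * h x) = (\<Sum>x\<in>P. if x = x0 then - t * m x0 else 0)"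
      unfolding sum_subtractf[symmetric] by (intro sum.cong) (auto simp: k_def algebra_simps)
    also have "\<dots> = - t * m x0" using fin x0 by simp
    finally have "t * m x0 \<le> t * measure lebesgue (C t)" using min[of k] by simp
    then show ?thesis using t by simp
  qed
  have "(\<lambda>n. measure lebesgue (C (inverse (real (Suc n))))) \<longlonglongrightarrow> measure lebesgue (\<Inter>n. C (inverse (real (Suc n))))"
  proof (rule Lim_measure_decseq)
    show "range (\<lambda>n. C (inverse (real (Suc n)))) \<subseteq> sets lebesgue" using mC by auto
    show "decseq (\<lambda>n. C (inverse (real (Suc n))))"
    proof (rule decseq_SucI)
      fix n
      have "inverse (real (Suc (Suc n))) \<le> inverse (real (Suc n))" by (intro le_imp_inverse_le) auto
      then have "a \<le> c + inverse (real (Suc n))" if "a \<le> c + inverse (real (Suc (Suc n)))" for a c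
        using that by linarith
      then show "C (inverse (real (Suc (Suc n)))) \<subseteq> C (inverse (real (Suc n)))"
        unfolding C_def by blast
    qed
    show "emeasure lebesgue (C (inverse (real (Suc i)))) \<noteq> \<infinity>" for i
      using fmeasurableD2[OF mC] by (simp only: infinity_ennreal_def not_False_eq_True)
  qed
  moreover have "m x0 \<le> measure lebesgue (C (inverse (real (Suc n))))" for n by (rule ge) simp
  ultimately have "m x0 \<le> measure lebesgue (\<Inter>n. C (inverse (real (Suc n))))"
    by (intro LIMSEQ_le_const) auto
  also have "(\<Inter>n. C (inverse (real (Suc n)))) = C 0"
  proof (rule equalityI; rule subsetI)
    fix y assume y: "y \<in> (\<Inter>n. C (inverse (real (Suc n))))"
    have "x \<bullet> y - h x \<le> x0 \<bullet> y - h x0 + 0" if "x \<in> P" for x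
    proof (rule LIMSEQ_le_const)
      show "(\<lambda>n. x0 \<bullet> y - h x0 + inverse (real (Suc n))) \<longlonglongrightarrow> x0 \<bullet> y - h x0 + 0"
        by (intro tendsto_intros LIMSEQ_inverse_real_of_nat)
      show "\<exists>N. \<forall>n\<ge>N. x \<bullet> y - h x \<le> x0 \<bullet> y - h x0 + inverse (real (Suc n))"
        using y that by (auto simp: C_def)
    qed
    then show "y \<in> C 0" using y by (auto simp: C_def)
  next
    fix y assume "y \<in> C 0"
    moreover have "a \<le> c + inverse (real (Suc n))" if "a \<le> c + 0" for a c n
      using that by (simp add: add_increasing2)
    ultimately show "y \<in> (\<Inter>n. C (inverse (real (Suc n))))" unfolding C_def by blast
  qed
  finally show ?thesis by (simp add: C_def)
qed

text \<open>\<open>u\<close> is the Legendre transform of \<open>V h\<close> over the ball, so a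
  maximiser \<open>Y x\<close> is a subgradient at \<open>x\<close>. It satisfies
  \<open>u x0 \<le> h x0\<close> on \<open>P\<close>, and on the cell of \<open>x0\<close> one has
  \<open>V h y = x0 \<bullet> y - h x0\<close>; hence every \<open>y\<close> of the cell is a
  subgradient at \<open>x0\<close>.\<close>

lemma exists_convex_potential:
  "\<exists>u. (\<forall>x. subdiff R u x \<noteq> {}) \<and> (\<forall>x\<in>P. m x \<le> measure lebesgue (subdiff R u x))"
proof -
  obtain h where h: "\<And>k. \<Phi> h \<le> \<Phi> k" by (rule \<Phi>_minimizer) blast
  have "\<exists>y\<in>cball 0 R. \<forall>z\<in>cball 0 R. x \<bullet> z - V h z \<le> x \<bullet> y - V h y" for x
    using Rpos by (intro continuous_attains_sup continuous_intros continuous_on_V) auto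
  then obtain Y where Y: "\<And>x. Y x \<in> cball 0 R" "\<And>x z. z \<in> cball 0 R \<Longrightarrow> x \<bullet> z - V h z \<le> x \<bullet> Y x - V h (Y x)"
    by metis
  define u where "u x = x \<bullet> Y x - V h (Y x)" for x
  have u_ge: "x \<bullet> z - V h z \<le> u x" if "z \<in> cball 0 R" for x z using Y(2)[OF that] by (simp add: u_def)
  have "Y x \<in> subdiff R u x" for x
  proof -
    have "u x + Y x \<bullet> (z - x) \<le> u z" for z
      using u_ge[OF Y(1)[of x], of z] by (simp add: u_def inner_diff_right inner_commute)
    then show ?thesis using Y(1) by (simp add: subdiff_def)
  qed
  moreover have "m x0 \<le> measure lebesgue (subdiff R u x0)" if x0: "x0 \<in> P" for x0
  proof -
    let ?C = "{y \<in> cball 0 R. \<forall>x\<in>P. x \<bullet> y - h x \<le> x0 \<bullet> y - h x0}"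
    have "?C \<subseteq> subdiff R u x0"
    proof
      fix y assume y: "y \<in> ?C"
      have Vy: "V h y = x0 \<bullet> y - h x0"
        using y V_attained[of h y] V_ge[OF x0, of y h] by force
      have "u x0 \<le> h x0" using V_ge[OF x0, of "Y x0" h] by (simp add: u_def)
      moreover have "u z \<ge> z \<bullet> y - V h y" for z using y by (intro u_ge) auto
      ultimately have "u x0 + y \<bullet> (z - x0) \<le> u z" for z
        using Vy by (smt (verit) inner_commute inner_diff_right)
      then show "y \<in> subdiff R u x0" using y by (simp add: subdiff_def)
    qed
    moreover have "?C \<in> sets lebesgue"
    proof -
      have "?C = cball 0 R \<inter> (\<Inter>x\<in>P. {y. x \<bullet> y - h x \<le> x0 \<bullet> y - h x0})" by auto
      then have "compact ?C"
        by (simp only:) (intro compact_Int_closed closed_INT ballI closed_Collect_le continuous_intros; simp)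
      then show ?thesis by (intro fmeasurableD lmeasurable_compact)
    qed
    ultimately have "measure lebesgue ?C \<le> measure lebesgue (subdiff R u x0)"
      by (intro measure_mono_fmeasurable lmeasurable_compact compact_subdiff)
    then show ?thesis using cell_measure_ge[OF h x0] by linarith
  qed
  ultimately show ?thesis by blast
qed

end

theorem discrete_Alexandrov:
  fixes P :: "'a::euclidean_space set"
  assumes "finite P" "\<And>x. x \<in> P \<Longrightarrow> 0 \<le> m x" "0 < R" "(\<Sum>x\<in>P. m x) = measure lebesgue (cball (0::'a) R)"
  shows "\<exists>u. (\<forall>x. subdiff R u x \<noteq> {}) \<and> (\<forall>x\<in>P. m x \<le> measure lebesgue (subdiff R u x))"
proof -
  \<comment> \<open>Coercivity needs masses bounded away from 0. Points without mass are dropped,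
    and for them the conclusion is trivial.\<close>
  let ?P = "{x\<in>P. 0 < m x}"
  have s: "(\<Sum>x\<in>?P. m x) = (\<Sum>x\<in>P. m x)"
    using assms(1,2) by (intro sum.mono_neutral_left) (auto simp: less_le)
  have "measure lebesgue (cball (0::'a) R) > 0" using assms(3) by (simp add: content_cball_pos)
  then have "?P \<noteq> {}" using s assms(4) by (metis less_irrefl sum.empty)
  then have "discrete_target ?P m R"
    using assms s by unfold_locales auto
  then obtain u where u: "\<forall>x. subdiff R u x \<noteq> {}" "\<forall>x\<in>?P. m x \<le> measure lebesgue (subdiff R u x)"
    using discrete_target.exists_convex_potential by blast
  have "m x \<le> measure lebesgue (subdiff R u x)" if "x \<in> P" for x
    using u(2) that assms(2)[OF that] by (cases "m x = 0") auto
  then show ?thesis using u(1) by blast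
qed

section \<open>Integration against vector measures\<close>

lemma bounded_vector_measure_partition_le:
  assumes "bounded_vector_measure M \<mu>" "finite P" "P \<subseteq> sets M" "partition_on (space M) P"
  shows "(\<Sum>B\<in>P. norm (\<mu> B)) \<le> enn2real (total_mass M \<mu>)"
proof -
  have fin: "total_mass M \<mu> < \<infinity>" using assms(1) by (simp add: bounded_vector_measure_def)
  have "(\<Sum>B\<in>P. ennreal (norm (\<mu> B))) \<le> total_mass M \<mu>"
    unfolding total_mass_def using assms(2-4) by (intro SUP_upper) auto
  then have "ennreal (\<Sum>B\<in>P. norm (\<mu> B)) \<le> total_mass M \<mu>" by (simp add: sum_ennreal)
  then have "enn2real (ennreal (\<Sum>B\<in>P. norm (\<mu> B))) \<le> enn2real (total_mass M \<mu>)"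
    using fin by (intro enn2real_mono) auto
  then show ?thesis by (simp add: sum_nonneg)
qed

lemma bounded_vector_measure_norm_le:
  assumes "bounded_vector_measure M \<mu>" "E \<in> sets M"
  shows "norm (\<mu> E) \<le> enn2real (total_mass M \<mu>)"
proof (cases "E = {}")
  case True
  then have "\<mu> E = 0" using assms vector_measure_empty unfolding bounded_vector_measure_def by auto
  then show ?thesis by simp
next
  case False
  \<comment> \<open>A partition has no empty member, so the complement is removed when it is
    empty.\<close>
  let ?P = "{E, space M - E} - {{}}"
  have "partition_on (space M) ?P"
    using sets.sets_into_space[OF assms(2)] by (auto simp: partition_on_def disjoint_def)
  then have "(\<Sum>B\<in>?P. norm (\<mu> B)) \<le> enn2real (total_mass M \<mu>)"
    using assms by (intro bounded_vector_measure_partition_le) auto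
  moreover have "norm (\<mu> E) \<le> (\<Sum>B\<in>?P. norm (\<mu> B))"
    using False by (intro member_le_sum) auto
  ultimately show ?thesis by linarith
qed

lemma vector_measure_component:
  assumes "vector_measure M \<mu>"
  shows "vector_measure M (\<lambda>B. \<mu> B $ i)" "vector_measure M (\<lambda>B. - (\<mu> B $ i))"
  using assms bounded_linear.sums[OF bounded_linear_vec_nth] sums_minus
  unfolding vector_measure_def by blast+

lemma emeasure_pos_part_finite:
  assumes "vector_measure M \<mu>" "\<And>E. E \<in> sets M \<Longrightarrow> \<mu> E \<le> K" "B \<in> sets M"
  shows "emeasure (pos_part M \<mu>) B < \<infinity>"
proof -
  have "emeasure (pos_part M \<mu>) B \<le> ennreal K"
    unfolding emeasure_pos_part[OF assms(1,3)] using assms(2) by (intro SUP_least ennreal_leI) auto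
  then show ?thesis using le_less_trans by fastforce
qed

text \<open>For \<open>E\<close> inside \<open>B\<close>, the value at \<open>E\<close> is the value
  at \<open>B\<close> minus that at \<open>B - E\<close>, and the latter costs at most the negative
  part of \<open>B\<close>. The supremum over \<open>E\<close> gives one inequality; applied to the
  negated measure it gives the other.\<close>

lemma Jordan_decomposition:
  fixes \<mu> :: "'a set \<Rightarrow> real"
  assumes \<mu>: "vector_measure M \<mu>" "vector_measure M (\<lambda>B. - \<mu> B)" and K: "\<And>E. E \<in> sets M \<Longrightarrow> \<bar>\<mu> E\<bar> \<le> K"
    and B: "B \<in> sets M"
  shows "\<mu> B = measure (pos_part M \<mu>) B - measure (pos_part M (\<lambda>B. - \<mu> B)) B"
proof -
  have half: "measure (pos_part M \<nu>) B \<le> \<nu> B + measure (pos_part M (\<lambda>B. - \<nu> B)) B"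
    if \<nu>: "vector_measure M \<nu>" "vector_measure M (\<lambda>B. - \<nu> B)" "\<And>E. E \<in> sets M \<Longrightarrow> \<bar>\<nu> E\<bar> \<le> K" for \<nu> :: "'a set \<Rightarrow> real"
  proof -
    let ?n = "measure (pos_part M (\<lambda>B. - \<nu> B)) B"
    have fin: "emeasure (pos_part M (\<lambda>B. - \<nu> B)) B < \<infinity>"
      using \<nu>(3) B by (intro emeasure_pos_part_finite[OF \<nu>(2), of K]) (fastforce simp: abs_le_iff)
    have n: "- \<nu> F \<le> ?n" if "F \<in> sets M" "F \<subseteq> B" for F
    proof -
      have "ennreal (- \<nu> F) \<le> emeasure (pos_part M (\<lambda>B. - \<nu> B)) B"
        unfolding emeasure_pos_part[OF \<nu>(2) B] using that by (intro SUP_upper) auto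
      also have "\<dots> = ennreal ?n" using fin by (intro emeasure_eq_ennreal_measure) auto
      finally show ?thesis by (simp add: ennreal_le_iff)
    qed
    have nn: "\<nu> B + ?n \<ge> 0" using n[OF B] by simp
    have "emeasure (pos_part M \<nu>) B \<le> ennreal (\<nu> B + ?n)"
      unfolding emeasure_pos_part[OF \<nu>(1) B]
    proof (intro SUP_least ennreal_leI)
      fix E assume E: "E \<in> {E \<in> sets M. E \<subseteq> B}"
      then have "\<nu> (E \<union> (B - E)) = \<nu> E + \<nu> (B - E)"
        using B by (intro vector_measure_Un[OF \<nu>(1)]) auto
      moreover have "E \<union> (B - E) = B" using E by auto
      moreover have "- \<nu> (B - E) \<le> ?n" using B E by (intro n) auto
      ultimately show "\<nu> E \<le> \<nu> B + ?n" by simp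
    qed
    then show ?thesis using nn by (simp add: measure_def enn2real_leI)
  qed
  have "measure (pos_part M \<mu>) B \<le> \<mu> B + measure (pos_part M (\<lambda>B. - \<mu> B)) B"
    using half[OF \<mu>] K by blast
  moreover have "measure (pos_part M (\<lambda>B. - \<mu> B)) B \<le> - \<mu> B + measure (pos_part M (\<lambda>B. - (- \<mu> B))) B"
    using \<mu> K by (intro half) auto
  ultimately show ?thesis by simp
qed

text \<open>The integral is defined by components, and estimating these separately would not give
  the Euclidean total mass. So \<open>\<psi>\<close> is rounded to a finite-valued \<open>g\<close>;
  on each level set the components recombine into an inner product, and Cauchy-Schwarz applies to
  the vector value of the measure.\<close>

lemma vector_integral_le:
  fixes \<mu> :: "'a set \<Rightarrow> real^'d::finite"
  assumes \<mu>: "bounded_vector_measure M \<mu>" and \<psi>: "\<psi> \<in> borel_measurable M"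
    and R: "\<And>x. x \<in> space M \<Longrightarrow> norm (\<psi> x) \<le> R" and "R \<ge> 0"
  shows "vector_integral M \<mu> \<psi> \<le> R * enn2real (total_mass M \<mu>)"
proof -
  define T where "T = enn2real (total_mass M \<mu>)"
  have T: "norm (\<mu> E) \<le> T" if "E \<in> sets M" for E
    unfolding T_def using \<mu> that by (rule bounded_vector_measure_norm_le)
  have "T \<ge> 0" by (simp add: T_def)
  have vm: "vector_measure M \<mu>" using \<mu> by (simp add: bounded_vector_measure_def)
  define p where "p i = pos_part M (\<lambda>B. \<mu> B $ i)" for i
  define q where "q i = pos_part M (\<lambda>B. - (\<mu> B $ i))" for i
  have comp: "\<bar>\<mu> E $ i\<bar> \<le> T" if "E \<in> sets M" for E i
    using T[OF that] component_le_norm_cart[of "\<mu> E" i] by linarith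
  have sets: "sets (p i) = sets M" "sets (q i) = sets M" "space (p i) = space M" "space (q i) = space M" for i
    by (simp_all add: p_def q_def)
  have "emeasure (p i) (space M) < \<infinity>" "emeasure (q i) (space M) < \<infinity>" for i
    unfolding p_def q_def using comp vector_measure_component[OF vm]
    by (intro emeasure_pos_part_finite[of _ _ T]; fastforce simp: abs_le_iff)+
  then have "emeasure (p i) (space M) \<noteq> \<infinity>" "emeasure (q i) (space M) \<noteq> \<infinity>" for i
    by (metis less_irrefl)+
  then have fm: "finite_measure (p i)" "finite_measure (q i)" for i
    by (simp_all add: finite_measureI sets)
  have J: "\<mu> B $ i = measure (p i) B - measure (q i) B" if "B \<in> sets M" for B i
    unfolding p_def q_def using Jordan_decomposition[OF vector_measure_component[OF vm] comp that] by simp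
  \<comment> \<open>\<open>c\<close> collects both rounding errors per unit of
    \<open>\<epsilon>\<close>: the first term because \<open>norm (g x)\<close> may exceed
    \<open>R\<close> by \<open>CARD('d) * \<epsilon>\<close>, the second from replacing
    \<open>\<psi>\<close> by \<open>g\<close> in the component integrals.\<close>
  define c where "c = CARD('d) * T + (\<Sum>i\<in>UNIV. measure (p i) (space M) + measure (q i) (space M))"
  have main: "vector_integral M \<mu> \<psi> \<le> R * T + \<epsilon> * c" if \<epsilon>: "\<epsilon> > 0" for \<epsilon>
  proof -
    define g :: "'a \<Rightarrow> real^'d" where "g x = (\<chi> i. \<epsilon> * of_int \<lfloor>\<psi> x $ i / \<epsilon>\<rfloor>)" for x
    have g: "\<bar>\<psi> x $ i - g x $ i\<bar> \<le> \<epsilon>" for x i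
    proof -
      have "\<epsilon> * of_int \<lfloor>\<psi> x $ i / \<epsilon>\<rfloor> \<le> \<epsilon> * (\<psi> x $ i / \<epsilon>)" using \<epsilon> by (intro mult_left_mono) auto
      moreover have "\<epsilon> * (\<psi> x $ i / \<epsilon>) \<le> \<epsilon> * (of_int \<lfloor>\<psi> x $ i / \<epsilon>\<rfloor> + 1)" using \<epsilon> by (intro mult_left_mono) linarith+
      ultimately show ?thesis using \<epsilon> by (simp add: g_def algebra_simps abs_le_iff)
    qed
    have norm_g: "norm (g x) \<le> R + CARD('d) * \<epsilon>" if "x \<in> space M" for x
    proof -
      have "norm (g x - \<psi> x) \<le> (\<Sum>i\<in>UNIV. \<bar>(g x - \<psi> x) $ i\<bar>)" by (rule norm_le_l1_cart)
      also have "\<dots> \<le> (\<Sum>i\<in>(UNIV::'d set). \<epsilon>)" using g by (intro sum_mono) (simp add: abs_minus_commute)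
      finally have "norm (g x - \<psi> x) \<le> CARD('d) * \<epsilon>" by simp
      then show ?thesis using R[OF that] norm_triangle_sub[of "g x" "\<psi> x"] by linarith
    qed
    let ?V = "g ` space M"
    have finV: "finite ?V"
    proof (rule finite_subset)
      let ?N = "\<lceil>R / \<epsilon>\<rceil> + 1"
      let ?h = "\<lambda>k :: 'd \<Rightarrow> int. \<chi> i. \<epsilon> * of_int (k i)"
      show "finite (?h ` {k. \<forall>i. k i \<in> {- ?N..?N}})"
        using finite_PiE[of "UNIV :: 'd set" "\<lambda>_. {- ?N..?N}"] by (intro finite_imageI) (simp add: PiE_def Pi_def)
      show "?V \<subseteq> ?h ` {k. \<forall>i. k i \<in> {- ?N..?N}}"
      proof
        fix v assume "v \<in> ?V"
        then obtain x where x: "x \<in> space M" "v = g x" by auto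
        have "\<lfloor>\<psi> x $ i / \<epsilon>\<rfloor> \<in> {- ?N..?N}" for i
        proof -
          have "\<bar>\<psi> x $ i\<bar> \<le> R" using R[OF x(1)] component_le_norm_cart[of "\<psi> x" i] by linarith
          then have "\<bar>\<psi> x $ i / \<epsilon>\<bar> \<le> R / \<epsilon>" using \<epsilon> by (simp add: abs_divide divide_right_mono)
          moreover have "R / \<epsilon> \<le> of_int \<lceil>R / \<epsilon>\<rceil>" by simp
          ultimately have "- of_int \<lceil>R / \<epsilon>\<rceil> \<le> \<psi> x $ i / \<epsilon>" "\<psi> x $ i / \<epsilon> \<le> of_int \<lceil>R / \<epsilon>\<rceil>" by linarith+
          then show ?thesis by (simp add: le_floor_iff floor_le_iff)
        qed
        then show "v \<in> ?h ` {k. \<forall>i. k i \<in> {- ?N..?N}}"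
          unfolding x(2) g_def by (intro image_eqI[of _ _ "\<lambda>i. \<lfloor>\<psi> x $ i / \<epsilon>\<rfloor>"]) auto
      qed
    qed
    have \<psi>i: "(\<lambda>x. \<psi> x $ i) \<in> borel_measurable M" for i
      using \<psi> by (intro borel_measurable_continuous_on[OF _ \<psi>] continuous_intros)
    have gi: "(\<lambda>x. g x $ i) \<in> borel_measurable M" for i
      unfolding g_def using \<psi>i[of i] by simp
    define Ag where "Ag v = {x \<in> space M. g x = v}" for v
    have Ag: "Ag v \<in> sets M" for v
    proof -
      have "Ag v = {x \<in> space M. \<forall>i\<in>UNIV. g x $ i = v $ i}" by (auto simp: Ag_def vec_eq_iff)
      also have "\<dots> \<in> sets M" using gi by (intro sets.sets_Collect_finite_All borel_measurable_eq) auto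
      finally show ?thesis .
    qed
    have gsum: "g x $ i = (\<Sum>v\<in>?V. v $ i * indicator (Ag v) x)" if "x \<in> space M" for x i
    proof -
      have "(\<Sum>v\<in>?V. v $ i * indicator (Ag v) x) = (\<Sum>v\<in>?V. if v = g x then v $ i else 0)"
        using that by (intro sum.cong) (auto simp: Ag_def indicator_def)
      then show ?thesis using finV that by simp
    qed
    have int: "\<bar>(LINT x|N. \<psi> x $ i) - (\<Sum>v\<in>?V. v $ i * measure N (Ag v))\<bar> \<le> \<epsilon> * measure N (space M)"
      if N: "finite_measure N" "sets N = sets M" "space N = space M" for N i
    proof -
      interpret finite_measure N by (rule N)
      have meas: "(\<lambda>x. \<psi> x $ i) \<in> borel_measurable N" "(\<lambda>x. g x $ i) \<in> borel_measurable N"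
        using \<psi>i gi N(2) by (simp_all cong: measurable_cong_sets)
      have i\<psi>: "integrable N (\<lambda>x. \<psi> x $ i)"
      proof (rule integrable_const_bound[of _ R])
        show "AE x in N. norm (\<psi> x $ i) \<le> R"
        proof (rule AE_I2)
          fix x assume "x \<in> space N"
          then show "norm (\<psi> x $ i) \<le> R"
            using R[of x] N(3) component_le_norm_cart[of "\<psi> x" i] by simp
        qed
      qed (rule meas)
      have ig: "integrable N (\<lambda>x. g x $ i)"
      proof (rule integrable_const_bound[of _ "R + CARD('d) * \<epsilon>"])
        show "AE x in N. norm (g x $ i) \<le> R + CARD('d) * \<epsilon>"
        proof (rule AE_I2)
          fix x assume "x \<in> space N"
          then show "norm (g x $ i) \<le> R + CARD('d) * \<epsilon>"
            using norm_g[of x] N(3) component_le_norm_cart[of "g x" i] by simp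
        qed
      qed (rule meas)
      have "(LINT x|N. g x $ i) = (LINT x|N. (\<Sum>v\<in>?V. v $ i * indicator (Ag v) x))"
        by (intro Bochner_Integration.integral_cong refl gsum) (simp add: N)
      also have "\<dots> = (\<Sum>v\<in>?V. LINT x|N. v $ i * indicator (Ag v) x)"
        using Ag N by (intro Bochner_Integration.integral_sum integrable_mult_right integrable_real_indicator)
          (auto simp: emeasure_finite less_top[symmetric])
      also have "\<dots> = (\<Sum>v\<in>?V. v $ i * measure N (Ag v))"
        using Ag N(2) sets.sets_into_space[OF Ag] N(3) by (simp add: Int_absorb2)
      finally have eq: "(LINT x|N. g x $ i) = (\<Sum>v\<in>?V. v $ i * measure N (Ag v))" .
      have "\<bar>(LINT x|N. \<psi> x $ i) - (LINT x|N. g x $ i)\<bar> = \<bar>LINT x|N. \<psi> x $ i - g x $ i\<bar>"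
        by (simp add: i\<psi> ig)
      also have "\<dots> \<le> (LINT x|N. \<bar>\<psi> x $ i - g x $ i\<bar>)" by (rule integral_abs_bound)
      also have "\<dots> \<le> (LINT x|N. \<epsilon>)"
        using g i\<psi> ig by (intro integral_mono) auto
      also have "\<dots> = \<epsilon> * measure N (space M)" by (simp add: N)
      finally show ?thesis by (simp only: eq)
    qed
    have "vector_integral M \<mu> \<psi> = (\<Sum>i\<in>UNIV. (LINT x|p i. \<psi> x $ i) - (LINT x|q i. \<psi> x $ i))"
      by (simp add: vector_integral_def signed_integral_def p_def q_def)
    also have "\<dots> \<le> (\<Sum>i\<in>UNIV. (\<Sum>v\<in>?V. v $ i * \<mu> (Ag v) $ i) + \<epsilon> * (measure (p i) (space M) + measure (q i) (space M)))"
    proof (rule sum_mono)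
      fix i
      have "(\<Sum>v\<in>?V. v $ i * \<mu> (Ag v) $ i) = (\<Sum>v\<in>?V. v $ i * measure (p i) (Ag v)) - (\<Sum>v\<in>?V. v $ i * measure (q i) (Ag v))"
        unfolding sum_subtractf[symmetric] by (intro sum.cong refl) (simp add: J[OF Ag] right_diff_distrib)
      then show "(LINT x|p i. \<psi> x $ i) - (LINT x|q i. \<psi> x $ i) \<le>
          (\<Sum>v\<in>?V. v $ i * \<mu> (Ag v) $ i) + \<epsilon> * (measure (p i) (space M) + measure (q i) (space M))"
        using int[OF fm(1)[of i] sets(1,3), of i] int[OF fm(2)[of i] sets(2,4), of i]
        unfolding distrib_left abs_le_iff by linarith
    qed
    also have "\<dots> = (\<Sum>v\<in>?V. v \<bullet> \<mu> (Ag v)) + \<epsilon> * (\<Sum>i\<in>UNIV. measure (p i) (space M) + measure (q i) (space M))"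
      unfolding sum.distrib[of "\<lambda>i. \<Sum>v\<in>?V. v $ i * \<mu> (Ag v) $ i"] sum_distrib_left
      by (subst sum.swap) (simp add: inner_vec_def)
    also have "(\<Sum>v\<in>?V. v \<bullet> \<mu> (Ag v)) \<le> (R + CARD('d) * \<epsilon>) * T"
    proof -
      have "(\<Sum>v\<in>?V. v \<bullet> \<mu> (Ag v)) \<le> (\<Sum>v\<in>?V. (R + CARD('d) * \<epsilon>) * norm (\<mu> (Ag v)))"
      proof (rule sum_mono)
        fix v assume "v \<in> ?V"
        then have "norm v \<le> R + CARD('d) * \<epsilon>" using norm_g by auto
        then have "norm v * norm (\<mu> (Ag v)) \<le> (R + CARD('d) * \<epsilon>) * norm (\<mu> (Ag v))"
          by (intro mult_right_mono) auto
        then show "v \<bullet> \<mu> (Ag v) \<le> (R + CARD('d) * \<epsilon>) * norm (\<mu> (Ag v))"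
          using norm_cauchy_schwarz[of v "\<mu> (Ag v)"] by linarith
      qed
      also have "\<dots> = (R + CARD('d) * \<epsilon>) * (\<Sum>v\<in>?V. norm (\<mu> (Ag v)))" by (simp add: sum_distrib_left)
      \<comment> \<open>Level sets of distinct values are disjoint and nonempty, so they form a
        partition as in the definition of the total mass.\<close>
      also have "(\<Sum>v\<in>?V. norm (\<mu> (Ag v))) = (\<Sum>B\<in>Ag ` ?V. norm (\<mu> B))"
        by (subst sum.reindex) (auto simp: inj_on_def Ag_def)
      also have "(\<Sum>B\<in>Ag ` ?V. norm (\<mu> B)) \<le> T"
        unfolding T_def using Ag finV
        by (intro bounded_vector_measure_partition_le[OF \<mu>]) (auto simp: partition_on_def disjoint_def Ag_def)
      finally show ?thesis using \<open>R \<ge> 0\<close> \<epsilon> by (simp add: mult_left_mono)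
    qed
    finally show ?thesis by (simp add: c_def algebra_simps)
  qed
  have "c \<ge> 0" using \<open>T \<ge> 0\<close> by (auto simp: c_def intro!: add_nonneg_nonneg sum_nonneg)
  have "vector_integral M \<mu> \<psi> \<le> R * T"
  proof (rule field_le_epsilon)
    fix e :: real assume "e > 0"
    then have "vector_integral M \<mu> \<psi> \<le> R * T + e / (c + 1) * c" using \<open>c \<ge> 0\<close> by (intro main) auto
    also have "e / (c + 1) * c \<le> e" using \<open>c \<ge> 0\<close> \<open>e > 0\<close> by (simp add: field_simps)
    finally show "vector_integral M \<mu> \<psi> \<le> R * T + e" by simp
  qed
  then show ?thesis by (simp add: T_def)
qed

section \<open>Mollified convex functions\<close>

definition conv :: "('a::euclidean_space \<Rightarrow> real) \<Rightarrow> ('a \<Rightarrow> real) \<Rightarrow> 'a \<Rightarrow> real" where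
  "conv \<rho> u x = (LINT z|lebesgue. \<rho> (x - z) * u z)"

lemma continuous_imp_borel_lebesgue:
  "continuous_on UNIV f \<Longrightarrow> f \<in> borel_measurable lebesgue"
  by (intro measurable_completion) (simp add: borel_measurable_continuous_onI)

lemma integrable_continuous_compact_support:
  fixes f :: "'a::euclidean_space \<Rightarrow> real"
  assumes f: "continuous_on UNIV f" and r: "\<And>x. x \<notin> cball a r \<Longrightarrow> f x = 0"
  shows "integrable lebesgue f"
proof -
  have "integrable lborel (\<lambda>x. indicator (cball a r) x *\<^sub>R f x)"
    using f continuous_on_subset by (intro borel_integrable_compact) auto
  also have "(\<lambda>x. indicator (cball a r) x *\<^sub>R f x) = f"
    using r by (intro ext) (metis indicator_simps scaleR_one scaleR_zero_left)
  finally show ?thesis using f by (subst integrable_completion) (auto intro: borel_measurable_continuous_onI)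
qed

lemma integrable_conv:
  assumes "csmooth \<rho>" "continuous_on UNIV u"
  shows "integrable lebesgue (\<lambda>z. \<rho> (x - z) * u z)" "integrable lebesgue (\<lambda>z. \<rho> z * u (x - z))"
proof -
  obtain r where r: "\<And>x. r < norm x \<Longrightarrow> \<rho> x = 0" using assms(1) by (auto simp: csmooth_def)
  have c: "continuous_on UNIV (\<lambda>z. \<rho> (x - z))" "continuous_on UNIV (\<lambda>z. u (x - z))" 
    by (rule continuous_on_compose2[OF csmooth_continuous[OF assms(1), of UNIV]]
         continuous_on_compose2[OF assms(2)]; auto intro!: continuous_intros)+
  show "integrable lebesgue (\<lambda>z. \<rho> (x - z) * u z)"
    by (rule integrable_continuous_compact_support[of _ x r])
       (auto intro!: continuous_intros c assms(2) r simp: dist_norm not_le)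
  show "integrable lebesgue (\<lambda>z. \<rho> z * u (x - z))"
    by (rule integrable_continuous_compact_support[of _ 0 r])
       (auto intro!: continuous_intros c csmooth_continuous[OF assms(1)] r simp: dist_norm not_le)
qed

text \<open>In this form the translation acts on \<open>u\<close>, so Lipschitz bounds and convexity
  of \<open>u\<close> pass to the mollified function.\<close>

lemma conv_flip:
  assumes "csmooth \<rho>" "continuous_on UNIV u"
  shows "conv \<rho> u x = (LINT z|lebesgue. \<rho> z * u (x - z))"
proof -
  have c: "continuous_on UNIV (\<lambda>z. \<rho> (x - z))" "continuous_on UNIV (\<lambda>z. u (x - z))" 
    by (rule continuous_on_compose2[OF csmooth_continuous[OF assms(1), of UNIV]]
         continuous_on_compose2[OF assms(2)]; auto intro!: continuous_intros)+
  have m: "(\<lambda>z. \<rho> (x - z) * u z) \<in> borel_measurable borel" "(\<lambda>z. \<rho> z * u (x - z)) \<in> borel_measurable borel"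
    by (intro borel_measurable_continuous_onI continuous_intros c assms(2) csmooth_continuous[OF assms(1)])+
  have l: "lborel = density (distr lborel borel (\<lambda>z. x + (- 1) *\<^sub>R z)) (\<lambda>_. \<bar>- 1 :: real\<bar> ^ DIM('a))"
    by (rule lborel_affine) simp
  have "conv \<rho> u x = (LINT z|lborel. \<rho> (x - z) * u z)"
    unfolding conv_def using m by (subst integral_completion) auto
  also have "\<dots> = (LINT z|distr lborel borel (\<lambda>z. x - z). \<rho> (x - z) * u z)"
    by (subst l) (simp add: density_1)
  also have "\<dots> = (LINT z|lborel. \<rho> z * u (x - z))"
    using m(1) by (subst integral_distr) auto
  also have "\<dots> = (LINT z|lebesgue. \<rho> z * u (x - z))"
    using m by (subst integral_completion) auto
  finally show ?thesis .
qed

text \<open>The derivative falls on the kernel, so \<open>u\<close> need only be continuous.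
  Differentiation under the integral uses a compact domain that stays fixed while \<open>x\<close>
  moves near \<open>x0\<close>.\<close>

lemma conv_has_derivative:
  assumes \<rho>: "csmooth \<rho>" and u: "continuous_on UNIV u"
  shows "(conv \<rho> u has_derivative (\<lambda>v. conv (\<lambda>y. frechet_derivative \<rho> (at y) v) u x0)) (at x0)"
proof -
  let ?D = "\<lambda>y. frechet_derivative \<rho> (at y)"
  obtain r where r: "\<And>x. r < norm x \<Longrightarrow> \<rho> x = 0" using \<rho> by (auto simp: csmooth_def)
  \<comment> \<open>The radius is that of the support of \<open>\<rho>\<close>, plus 1 for the
    motion of \<open>x\<close> in the unit ball around \<open>x0\<close>, plus a margin.\<close>
  obtain a b where ab: "cball x0 (\<bar>r\<bar> + 2) \<subseteq> cbox a b"
    by (metis bounded_subset_cbox_symmetric[OF bounded_cball])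
  have far: "r < norm (x - z)" if "x \<in> ball x0 1" "z \<notin> cbox a b" for x z
  proof -
    have "\<bar>r\<bar> + 2 < dist x0 z" using that ab by (auto simp: subset_iff not_le)
    moreover have "dist x0 z \<le> dist x0 x + dist x z" by (rule dist_triangle)
    ultimately show ?thesis using that by (auto simp: dist_norm)
  qed
  have D0: "?D y v = 0" if "r < norm y" for y v
  proof -
    have "open {x::'a. r < norm x}" by (intro open_Collect_less continuous_intros)
    have "((\<lambda>x. 0) has_derivative (\<lambda>v. 0)) (at y)" by simp
    then have "(\<rho> has_derivative (\<lambda>v. 0)) (at y)"
      by (rule has_derivative_transform_within_open[OF _ \<open>open {x::'a. r < norm x}\<close>]) (use r that in auto)
    then show ?thesis using frechet_derivative_at by metis
  qed
  have conv_eq: "conv \<sigma> u x = integral (cbox a b) (\<lambda>z. \<sigma> (x - z) * u z)"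
    if "csmooth \<sigma>" "x \<in> ball x0 1" "\<And>z. r < norm z \<Longrightarrow> \<sigma> z = 0" for \<sigma> x
  proof -
    have "conv \<sigma> u x = integral UNIV (\<lambda>z. \<sigma> (x - z) * u z)"
      unfolding conv_def
      by (rule integral_unique[OF has_integral_integral_lebesgue, symmetric]) (rule integrable_conv[OF that(1) u])
    also have "\<dots> = integral (cbox a b) (\<lambda>z. \<sigma> (x - z) * u z)"
    proof -
      have "(\<lambda>z. \<sigma> (x - z) * u z) = (\<lambda>z. if z \<in> cbox a b then \<sigma> (x - z) * u z else 0)"
        using far[OF that(2)] that(3) by (intro ext) auto
      then have "integral UNIV (\<lambda>z. \<sigma> (x - z) * u z) = integral UNIV (\<lambda>z. if z \<in> cbox a b then \<sigma> (x - z) * u z else 0)"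
        by (rule arg_cong)
      then show ?thesis by (simp only: integral_restrict_UNIV)
    qed
    finally show ?thesis .
  qed
  have Dbl: "bounded_linear (?D y)" for y
    using csmooth_has_derivative[OF \<rho>] by (rule has_derivative_bounded_linear)
  define F where "F x z = Blinfun (\<lambda>v. ?D (x - z) v * u z)" for x z
  have F: "blinfun_apply (F x z) = (\<lambda>v. ?D (x - z) v * u z)" for x z
    unfolding F_def by (rule bounded_linear_Blinfun_apply) (intro bounded_linear_mult_const Dbl)
  have cD: "continuous_on S (\<lambda>y. ?D y v)" for S v
    using csmooth_continuous[OF csmooth_frechet_derivative[OF \<rho>]] .
  have cF: "continuous_on (ball x0 1 \<times> cbox a b) (\<lambda>(x, z). F x z)"
  proof (rule continuous_on_blinfun_componentwise)
    fix i :: 'a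
    have "continuous_on (ball x0 1 \<times> cbox a b) (\<lambda>p. ?D (fst p - snd p) i * u (snd p))"
      by (intro continuous_on_mult continuous_on_compose2[OF cD[of UNIV]] continuous_on_compose2[OF u] continuous_intros) auto
    then show "continuous_on (ball x0 1 \<times> cbox a b) (\<lambda>p. blinfun_apply (case p of (x, z) \<Rightarrow> F x z) i)"
      by (simp add: case_prod_beta F)
  qed
  have "((\<lambda>x. integral (cbox a b) (\<lambda>z. \<rho> (x - z) * u z)) has_derivative blinfun_apply (integral (cbox a b) (F x0))) (at x0 within ball x0 1)"
  proof (rule leibniz_rule[OF _ _ cF])
    fix x z assume "x \<in> ball x0 1"
    have "((\<lambda>x. \<rho> (x - z)) has_derivative ?D (x - z)) (at x)"
      using has_derivative_compose[OF has_derivative_diff[OF has_derivative_ident has_derivative_const], OF csmooth_has_derivative[OF \<rho>]]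
      by simp
    then show "((\<lambda>x. \<rho> (x - z) * u z) has_derivative blinfun_apply (F x z)) (at x within ball x0 1)"
      unfolding F by (rule has_derivative_at_withinI[OF has_derivative_mult_left])
  next
    fix x
    show "(\<lambda>z. \<rho> (x - z) * u z) integrable_on cbox a b"
    proof (rule integrable_continuous)
      have "continuous_on (cbox a b) (\<lambda>z. \<rho> (x - z))"
        by (rule continuous_on_compose2[OF csmooth_continuous[OF \<rho>, of UNIV]]) (auto intro: continuous_intros)
      then show "continuous_on (cbox a b) (\<lambda>z. \<rho> (x - z) * u z)"
        by (rule continuous_on_mult) (rule continuous_on_subset[OF u subset_UNIV])
    qed
  qed auto
  then have "((\<lambda>x. integral (cbox a b) (\<lambda>z. \<rho> (x - z) * u z)) has_derivative blinfun_apply (integral (cbox a b) (F x0))) (at x0)"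
    using at_within_open[of x0 "ball x0 1"] by simp
  then have d: "(conv \<rho> u has_derivative blinfun_apply (integral (cbox a b) (F x0))) (at x0)"
    by (rule has_derivative_transform_within_open[of _ _ _ _ "ball x0 1"]) (auto simp: conv_eq[OF \<rho> _ r])
  have "blinfun_apply (integral (cbox a b) (F x0)) v = conv (\<lambda>y. ?D y v) u x0" for v
  proof -
    have "F x0 integrable_on cbox a b"
    proof (rule integrable_continuous)
      show "continuous_on (cbox a b) (F x0)"
        using continuous_on_compose2[OF cF, of "cbox a b" "\<lambda>z. (x0, z)"] by (simp add: continuous_on_Pair image_subset_iff)
    qed
    then have "blinfun_apply (integral (cbox a b) (F x0)) v = integral (cbox a b) (\<lambda>z. blinfun_apply (F x0 z) v)"
      by (rule blinfun_apply_integral)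
    also have "\<dots> = conv (\<lambda>y. ?D y v) u x0"
      unfolding F by (rule conv_eq[symmetric, OF csmooth_frechet_derivative[OF \<rho>]]) (auto simp: D0)
    finally show ?thesis .
  qed
  then have "blinfun_apply (integral (cbox a b) (F x0)) = (\<lambda>v. conv (\<lambda>y. ?D y v) u x0)" by (rule ext)
  then show ?thesis using d by simp
qed

lemma Ck_conv:
  assumes "csmooth \<rho>" "continuous_on UNIV u"
  shows "Ck k (conv \<rho> u)"
  using assms(1)
proof (induction k arbitrary: \<rho>)
  case 0
  show ?case
    by (auto intro!: continuous_at_imp_continuous_on has_derivative_continuous[OF conv_has_derivative[OF 0 assms(2)]])
next
  case (Suc k)
  show ?case
    by (rule Ck_SucI[OF conv_has_derivative[OF Suc.prems assms(2)]]) (intro Suc.IH csmooth_frechet_derivative Suc.prems)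
qed

lemma DERIV_at_right_quotient:
  fixes f :: "real \<Rightarrow> real"
  assumes "(f has_real_derivative D) (at 0)"
  shows "((\<lambda>t. (f t - f 0) / t) \<longlongrightarrow> D) (at_right 0)"
  using assms by (simp add: DERIV_def filterlim_at_split)

text \<open>
  The symmetry of second derivatives is assumed here and verified for the explicit mollifier by
  computation, which spares a proof of Schwarz's theorem.
\<close>

locale convex_mollified =
  fixes \<rho> u :: "real^'d::finite \<Rightarrow> real" and R :: real
  assumes \<rho>: "csmooth \<rho>" and \<rho>_nonneg: "\<And>x. \<rho> x \<ge> 0" and \<rho>_int: "(LINT z|lebesgue. \<rho> z) = 1"
    and \<rho>_sym: "\<And>x v w. frechet_derivative (\<lambda>y. frechet_derivative \<rho> (at y) v) (at x) w =
      frechet_derivative (\<lambda>y. frechet_derivative \<rho> (at y) w) (at x) v"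
    and u_sub: "\<And>x. subdiff R u x \<noteq> {}"
begin

definition W :: "real^'d \<Rightarrow> real" where "W = conv \<rho> u"

text \<open>\<open>G\<close> and \<open>H\<close> are the gradient and the Hessian of
  \<open>W\<close>, with all derivatives placed on the kernel because \<open>u\<close> is merely
  Lipschitz.\<close>

definition G :: "real^'d \<Rightarrow> real^'d" where
  "G x = (\<chi> i. conv (\<lambda>y. frechet_derivative \<rho> (at y) (axis i 1)) u x)"

definition H :: "real^'d \<Rightarrow> real^'d^'d" where
  "H x = (\<chi> i j. conv (\<lambda>y. frechet_derivative (\<lambda>y. frechet_derivative \<rho> (at y) (axis i 1)) (at y) (axis j 1)) u x)"

lemma R_nonneg: "R \<ge> 0"
  using u_sub[of 0] by (auto simp: subdiff_def intro: order_trans[OF norm_ge_zero])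

lemma continuous_u: "continuous_on S u"
proof -
  have "R-lipschitz_on S u"
    using subdiff_nonempty_imp_Lipschitz[OF u_sub] R_nonneg by (intro lipschitz_onI) (auto simp: dist_real_def)
  then show ?thesis by (rule lipschitz_on_continuous_on)
qed

lemma linear_on_axes:
  assumes "linear f"
  shows "f v = (\<Sum>i\<in>UNIV. v $ i *\<^sub>R f (axis i (1::real)))"
proof -
  have "f v = f (\<Sum>i\<in>UNIV. v $ i *\<^sub>R axis i 1)" by (simp add: basis_expansion flip: scalar_mult_eq_scaleR)
  also have "\<dots> = (\<Sum>i\<in>UNIV. v $ i *\<^sub>R f (axis i 1))" by (simp add: linear_sum[OF assms] linear_scale[OF assms])
  finally show ?thesis .
qed

lemma W_has_derivative: "(W has_derivative (\<lambda>v. G x \<bullet> v)) (at x)"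
proof -
  note d = conv_has_derivative[OF \<rho> continuous_u, of x]
  have "conv (\<lambda>y. frechet_derivative \<rho> (at y) v) u x = G x \<bullet> v" for v
    using linear_on_axes[OF has_derivative_linear[OF d], of v] by (simp add: G_def inner_vec_def mult.commute)
  then show ?thesis using d unfolding W_def by simp
qed

lemma G_has_derivative: "(G has_derivative (\<lambda>v. H x *v v)) (at x)"
proof -
  have "((\<lambda>x. G x $ i) has_derivative (\<lambda>v. (H x *v v) $ i)) (at x)" for i
  proof -
    note d = conv_has_derivative[OF csmooth_frechet_derivative[OF \<rho>, of "axis i 1"] continuous_u, of x]
    have "conv (\<lambda>y. frechet_derivative (\<lambda>y. frechet_derivative \<rho> (at y) (axis i 1)) (at y) v) u x = (H x *v v) $ i" for v
      using linear_on_axes[OF has_derivative_linear[OF d], of v]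
      by (simp add: H_def matrix_vector_mult_def mult.commute)
    then show ?thesis using d by (simp add: G_def)
  qed
  then have "((\<lambda>x. G x \<bullet> b) has_derivative (\<lambda>v. (H x *v v) \<bullet> b)) (at x)" if "b \<in> Basis" for b
    using that by (auto simp: Basis_vec_def inner_axis)
  then show ?thesis by (subst has_derivative_componentwise_within) auto
qed

lemma Ck_G: "Ck k G"
  by (rule Ck_vec) (simp add: G_def Ck_conv[OF csmooth_frechet_derivative[OF \<rho>] continuous_u])

lemma continuous_H: "continuous_on S (\<lambda>x. H x $ i $ j)"
  unfolding H_def
  using Ck_continuous[OF Ck_conv[OF csmooth_frechet_derivative[OF csmooth_frechet_derivative[OF \<rho>]] continuous_u, of 0]]
  by simp

lemma transpose_H: "transpose (H x) = H x"
  unfolding H_def transpose_def by (subst \<rho>_sym) simp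

lemma W_eq: "W x = (LINT z|lebesgue. \<rho> z * u (x - z))"
  unfolding W_def by (rule conv_flip[OF \<rho> continuous_u])

lemma integrable_\<rho>: "integrable lebesgue \<rho>"
  using integrable_conv(2)[OF \<rho>, of "\<lambda>_. 1" 0] by simp

lemma W_Lipschitz: "\<bar>W x - W y\<bar> \<le> R * dist x y"
proof -
  note i = integrable_conv(2)[OF \<rho> continuous_u]
  have "\<bar>W x - W y\<bar> = \<bar>LINT z|lebesgue. \<rho> z * u (x - z) - \<rho> z * u (y - z)\<bar>"
    unfolding W_eq using i by simp
  also have "\<dots> \<le> (LINT z|lebesgue. \<bar>\<rho> z * u (x - z) - \<rho> z * u (y - z)\<bar>)" by (rule integral_abs_bound)
  also have "\<dots> \<le> (LINT z|lebesgue. \<rho> z * (R * dist x y))"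
  proof (intro integral_mono integrable_abs Bochner_Integration.integrable_diff i integrable_mult_left integrable_\<rho>)
    fix z
    have "\<bar>\<rho> z * u (x - z) - \<rho> z * u (y - z)\<bar> = \<rho> z * \<bar>u (x - z) - u (y - z)\<bar>"
      using \<rho>_nonneg[of z] by (simp add: abs_mult flip: right_diff_distrib)
    also have "\<dots> \<le> \<rho> z * (R * dist x y)"
      using subdiff_nonempty_imp_Lipschitz[OF u_sub, of "x - z" "y - z"] \<rho>_nonneg
      by (intro mult_left_mono) (auto simp: dist_norm)
    finally show "\<bar>\<rho> z * u (x - z) - \<rho> z * u (y - z)\<bar> \<le> \<rho> z * (R * dist x y)" .
  qed
  also have "\<dots> = R * dist x y" using \<rho>_int by simp
  finally show ?thesis .
qed

text \<open>Differentiate in the direction \<open>G x\<close> itself: the quotients tend to the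
  square of the norm and are bounded by \<open>R\<close> times the norm.\<close>

lemma norm_G_le: "norm (G x) \<le> R"
proof -
  let ?f = "\<lambda>t. W (x + t *\<^sub>R G x)"
  have "((\<lambda>t. x + t *\<^sub>R G x) has_derivative (\<lambda>t. t *\<^sub>R G x)) (at 0)" by (auto intro!: derivative_eq_intros)
  from has_derivative_compose[OF this, of W "\<lambda>v. G x \<bullet> v"] W_has_derivative[of x]
  have "(?f has_derivative (\<lambda>t. t * (G x \<bullet> G x))) (at 0)" by simp
  then have "(?f has_real_derivative (G x \<bullet> G x)) (at 0)"
    by (simp add: has_field_derivative_def mult.commute[of _ "G x \<bullet> G x"])
  then have "((\<lambda>t. (?f t - ?f 0) / t) \<longlongrightarrow> G x \<bullet> G x) (at 0)" by (simp add: DERIV_def)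
  then have "G x \<bullet> G x \<le> R * norm (G x)"
  proof (rule tendsto_upperbound)
    have "(?f t - ?f 0) / t \<le> R * norm (G x)" for t
    proof -
      have "\<bar>?f t - ?f 0\<bar> \<le> R * norm (G x) * \<bar>t\<bar>"
        using W_Lipschitz[of "x + t *\<^sub>R G x" x] by (simp add: dist_norm algebra_simps)
      then have "\<bar>(?f t - ?f 0) / t\<bar> \<le> R * norm (G x)"
        using R_nonneg by (cases "t = 0") (simp_all add: abs_divide pos_divide_le_eq)
      then show ?thesis by linarith
    qed
    then show "\<forall>\<^sub>F t in at 0. (?f t - ?f 0) / t \<le> R * norm (G x)" by simp
  qed simp
  then have "norm (G x) * norm (G x) \<le> R * norm (G x)" by (simp add: dot_square_norm power2_eq_square)
  then show ?thesis using R_nonneg by (cases "G x = 0") auto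
qed

lemma W_convex: "convex_on UNIV W"
proof (rule convex_onI)
  fix t :: real and x y assume t: "0 < t" "t < 1"
  note i = integrable_conv(2)[OF \<rho> continuous_u]
  have "W ((1 - t) *\<^sub>R x + t *\<^sub>R y) \<le> (LINT z|lebesgue. (1 - t) * (\<rho> z * u (x - z)) + t * (\<rho> z * u (y - z)))"
    unfolding W_eq
  proof (intro integral_mono i Bochner_Integration.integrable_add integrable_mult_right)
    fix z
    have "convex_on UNIV u" using u_sub by (rule subdiff_nonempty_imp_convex_on)
    then have "u ((1 - t) *\<^sub>R (x - z) + t *\<^sub>R (y - z)) \<le> (1 - t) * u (x - z) + t * u (y - z)"
      using t by (simp add: convex_onD)
    moreover have "(1 - t) *\<^sub>R (x - z) + t *\<^sub>R (y - z) = (1 - t) *\<^sub>R x + t *\<^sub>R y - z" by (simp add: algebra_simps)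
    ultimately have "\<rho> z * u ((1 - t) *\<^sub>R x + t *\<^sub>R y - z) \<le> \<rho> z * ((1 - t) * u (x - z) + t * u (y - z))"
      using \<rho>_nonneg by (intro mult_left_mono) auto
    then show "\<rho> z * u ((1 - t) *\<^sub>R x + t *\<^sub>R y - z) \<le> (1 - t) * (\<rho> z * u (x - z)) + t * (\<rho> z * u (y - z))"
      by (simp add: algebra_simps)
  qed
  also have "\<dots> = (1 - t) * W x + t * W y"
    unfolding W_eq using i by simp
  finally show "W ((1 - t) *\<^sub>R x + t *\<^sub>R y) \<le> (1 - t) * W x + t * W y" .
qed auto

lemma W_line_DERIV: "((\<lambda>t. W (x + t *\<^sub>R v)) has_real_derivative G (x + t *\<^sub>R v) \<bullet> v) (at t)"
proof -
  have "((\<lambda>t. x + t *\<^sub>R v) has_derivative (\<lambda>t. t *\<^sub>R v)) (at t)" by (auto intro!: derivative_eq_intros)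
  from has_derivative_compose[OF this W_has_derivative]
  have "((\<lambda>t. W (x + t *\<^sub>R v)) has_derivative (\<lambda>s. G (x + t *\<^sub>R v) \<bullet> (s *\<^sub>R v))) (at t)" .
  moreover have "(\<lambda>s. G (x + t *\<^sub>R v) \<bullet> (s *\<^sub>R v)) = (*) (G (x + t *\<^sub>R v) \<bullet> v)" by (rule ext) simp
  ultimately show ?thesis unfolding has_field_derivative_def by simp
qed

lemma G_line_DERIV: "((\<lambda>t. G (x + t *\<^sub>R v) \<bullet> v) has_real_derivative v \<bullet> (H (x + t *\<^sub>R v) *v v)) (at t)"
proof -
  have "((\<lambda>t. x + t *\<^sub>R v) has_derivative (\<lambda>t. t *\<^sub>R v)) (at t)" by (auto intro!: derivative_eq_intros)
  from has_derivative_inner_left[OF has_derivative_compose[OF this G_has_derivative], of v]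
  have "((\<lambda>t. G (x + t *\<^sub>R v) \<bullet> v) has_derivative (\<lambda>s. (H (x + t *\<^sub>R v) *v (s *\<^sub>R v)) \<bullet> v)) (at t)" .
  moreover have "(\<lambda>s. (H (x + t *\<^sub>R v) *v (s *\<^sub>R v)) \<bullet> v) = (*) (v \<bullet> (H (x + t *\<^sub>R v) *v v))"
    by (rule ext) (simp add: matrix_vector_mult_scaleR inner_commute)
  ultimately show ?thesis unfolding has_field_derivative_def by simp
qed

lemma W_tangent: "W x + G x \<bullet> (y - x) \<le> W y"
proof -
  let ?f = "\<lambda>t. W (x + t *\<^sub>R (y - x))"
  have "((\<lambda>t. (?f t - ?f 0) / t) \<longlongrightarrow> G x \<bullet> (y - x)) (at_right 0)"
    using DERIV_at_right_quotient[OF W_line_DERIV[of x "y - x" 0]] by simp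
  then have "G x \<bullet> (y - x) \<le> W y - W x"
  proof (rule tendsto_upperbound)
    show "\<forall>\<^sub>F t in at_right 0. (?f t - ?f 0) / t \<le> W y - W x"
      unfolding eventually_at_right_field
    proof (intro exI[of _ 1] conjI allI impI)
      fix t :: real assume t: "0 < t" "t < 1"
      have "W ((1 - t) *\<^sub>R x + t *\<^sub>R y) \<le> (1 - t) * W x + t * W y"
        using W_convex t by (simp add: convex_onD)
      moreover have "(1 - t) *\<^sub>R x + t *\<^sub>R y = x + t *\<^sub>R (y - x)" by (simp add: algebra_simps)
      ultimately have "?f t - ?f 0 \<le> t * (W y - W x)" by (simp add: algebra_simps)
      then show "(?f t - ?f 0) / t \<le> W y - W x" using t by (simp add: field_simps)
    qed simp
  qed simp
  then show ?thesis by simp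
qed

text \<open>Adding the tangent inequalities at two points shows that the gradient is monotone along
  lines; its derivative is therefore nonnegative.\<close>

lemma sym_psd_H: "sym_psd (H x)"
  unfolding sym_psd_def
proof (intro conjI allI transpose_H)
  fix v
  let ?g = "\<lambda>t. G (x + t *\<^sub>R v) \<bullet> v"
  have mono: "?g 0 \<le> ?g t" if "0 < t" for t
  proof -
    have "G x \<bullet> (t *\<^sub>R v) \<le> G (x + t *\<^sub>R v) \<bullet> (t *\<^sub>R v)"
      using W_tangent[of x "x + t *\<^sub>R v"] W_tangent[of "x + t *\<^sub>R v" x] by (simp add: inner_diff_right)
    then show ?thesis using that by simp
  qed
  have "((\<lambda>t. (?g t - ?g 0) / t) \<longlongrightarrow> v \<bullet> (H x *v v)) (at_right 0)"
    using DERIV_at_right_quotient[OF G_line_DERIV[of x v 0]] by simp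
  then show "0 \<le> v \<bullet> (H x *v v)"
  proof (rule tendsto_lowerbound)
    show "\<forall>\<^sub>F t in at_right 0. 0 \<le> (?g t - ?g 0) / t"
      unfolding eventually_at_right_field using mono by (intro exI[of _ 1]) auto
  qed simp
qed

text \<open>In the direction \<open>p - G x\<close> the subgradient inequality forces the squared
  norm of \<open>p - G x\<close> to be nonpositive. This identifies limits of lattice subgradients
  as values of the gradient.\<close>

lemma subgradient_W_eq:
  assumes "\<And>z. W x + p \<bullet> (z - x) \<le> W z"
  shows "p = G x"
proof -
  let ?v = "p - G x"
  let ?f = "\<lambda>t. W (x + t *\<^sub>R ?v)"
  have "((\<lambda>t. (?f t - ?f 0) / t) \<longlongrightarrow> G x \<bullet> ?v) (at_right 0)"
    using DERIV_at_right_quotient[OF W_line_DERIV[of x ?v 0]] by simp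
  then have "p \<bullet> ?v \<le> G x \<bullet> ?v"
  proof (rule tendsto_lowerbound)
    show "\<forall>\<^sub>F t in at_right 0. p \<bullet> ?v \<le> (?f t - ?f 0) / t"
      unfolding eventually_at_right_field
    proof (intro exI[of _ 1] conjI allI impI)
      fix t :: real assume t: "0 < t" "t < 1"
      have "t * (p \<bullet> ?v) \<le> ?f t - ?f 0" using assms[of "x + t *\<^sub>R ?v"] by simp
      then show "p \<bullet> ?v \<le> (?f t - ?f 0) / t" using t by (simp add: field_simps)
    qed simp
  qed simp
  then have "?v \<bullet> ?v \<le> 0" by (simp add: inner_diff_left)
  then have "?v = 0" using inner_gt_zero_iff[of ?v] by linarith
  then show ?thesis by simp
qed

end

text \<open>
  The change-of-variables theorems of the library require a well-ordered index type, so matrices and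
  vectors over an arbitrary finite index type are relabelled by an ordered copy of it.
\<close>

typedef 'a ocopy = "UNIV :: 'a set" morphisms of_ocopy to_ocopy by simp

lemma of_ocopy_inverse' [simp]: "to_ocopy (of_ocopy x) = x" and to_ocopy_inverse' [simp]: "of_ocopy (to_ocopy y) = y"
  by (simp_all add: of_ocopy_inverse to_ocopy_inverse)

lemma bij_of_ocopy: "bij of_ocopy"
  by (rule bij_betw_byWitness[where f'=to_ocopy]) auto

instance ocopy :: (finite) finite
proof
  have "UNIV \<subseteq> range (to_ocopy :: 'a \<Rightarrow> _)"
  proof
    fix x :: "'a ocopy"
    have "x = to_ocopy (of_ocopy x)" by simp
    then show "x \<in> range to_ocopy" by (rule range_eqI)
  qed
  then show "finite (UNIV :: 'a ocopy set)" by (rule finite_subset) simp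
qed

instantiation ocopy :: (finite) wellorder
begin

definition "x \<le> y \<longleftrightarrow> to_nat (of_ocopy x) \<le> to_nat (of_ocopy y)"
definition "(x :: 'a ocopy) < y \<longleftrightarrow> to_nat (of_ocopy x) < to_nat (of_ocopy y)"

instance
proof
  fix x y z :: "'a ocopy"
  show "x < y \<longleftrightarrow> x \<le> y \<and> \<not> y \<le> x" by (auto simp: less_eq_ocopy_def less_ocopy_def)
  show "x \<le> x" by (simp add: less_eq_ocopy_def)
  show "x \<le> y \<Longrightarrow> y \<le> z \<Longrightarrow> x \<le> z" by (simp add: less_eq_ocopy_def)
  show "x \<le> y \<or> y \<le> x" by (auto simp: less_eq_ocopy_def)
  show "x = y" if "x \<le> y" "y \<le> x"
  proof -
    have "to_nat (of_ocopy x) = to_nat (of_ocopy y)" using that by (simp add: less_eq_ocopy_def)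
    then show ?thesis by (metis injD inj_to_nat of_ocopy_inverse')
  qed
  fix P :: "'a ocopy \<Rightarrow> bool" and a :: "'a ocopy"
  assume step: "\<And>x. (\<And>y. y < x \<Longrightarrow> P y) \<Longrightarrow> P x"
  show "P a"
  proof (induction "to_nat (of_ocopy a)" arbitrary: a rule: less_induct)
    case less
    show ?case by (rule step) (rule less, simp add: less_ocopy_def)
  qed
qed

end

definition relabel :: "real^'a \<Rightarrow> real^'a ocopy" where "relabel x = (\<chi> i. x $ of_ocopy i)"
definition unlabel :: "real^'a ocopy \<Rightarrow> real^'a" where "unlabel y = (\<chi> i. y $ to_ocopy i)"

lemma relabel_unlabel [simp]: "relabel (unlabel y) = y" "unlabel (relabel x) = x"
  by (simp_all add: relabel_def unlabel_def vec_eq_iff)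

lemma linear_relabel: "linear relabel" and linear_unlabel: "linear unlabel"
  by (auto intro!: linearI simp: relabel_def unlabel_def vec_eq_iff)

lemma prod_Basis_cart: "(\<Prod>b\<in>Basis. (x :: real^'a::finite) \<bullet> b) = (\<Prod>i\<in>UNIV. x $ i)"
proof -
  have B: "(Basis :: (real^'a) set) = (\<lambda>i. axis i 1) ` UNIV" by (auto simp: Basis_vec_def)
  have "inj (\<lambda>i. axis i 1 :: real^'a)" by (auto intro!: injI simp: axis_eq_axis)
  then show ?thesis unfolding B by (subst prod.reindex) (auto simp: inner_axis)
qed

text \<open>Boxes correspond to boxes with the same side lengths, and these values determine
  Lebesgue measure.\<close>

lemma distr_unlabel: "distr lborel borel unlabel = (lborel :: (real^'a::finite) measure)"
proof (rule lborel_eqI[symmetric])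
  fix l u :: "real^'a" assume lu: "\<And>b. b \<in> Basis \<Longrightarrow> l \<bullet> b \<le> u \<bullet> b"
  have lu': "l $ i \<le> u $ i" for i
    using lu[of "axis i 1"] by (auto simp: inner_axis)
  have m: "(unlabel :: _ \<Rightarrow> real^'a) \<in> borel_measurable lborel"
    using linear_continuous_on[OF linear_unlabel[unfolded linear_conv_bounded_linear], of "UNIV :: (real^'a ocopy) set"]
    by (simp add: borel_measurable_continuous_onI)
  have pre: "unlabel -` box l u = box (relabel l) (relabel u)"
  proof (rule set_eqI)
    fix y :: "real^'a ocopy"
    have "(\<forall>i. l $ i < y $ to_ocopy i \<and> y $ to_ocopy i < u $ i) \<longleftrightarrow> (\<forall>i. l $ of_ocopy i < y $ i \<and> y $ i < u $ of_ocopy i)"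
      by (metis of_ocopy_inverse' to_ocopy_inverse')
    then show "y \<in> unlabel -` box l u \<longleftrightarrow> y \<in> box (relabel l) (relabel u)"
      by (simp add: mem_box_cart relabel_def unlabel_def)
  qed
  have le: "relabel l \<bullet> b \<le> relabel u \<bullet> b" if "b \<in> Basis" for b
    using that lu' by (auto simp: Basis_vec_def inner_axis relabel_def)
  have "emeasure (distr lborel borel unlabel) (box l u) = emeasure lborel (box (relabel l) (relabel u))"
    using m by (simp add: emeasure_distr pre)
  also have "\<dots> = ennreal (\<Prod>b\<in>Basis. (relabel u - relabel l) \<bullet> b)"
    using le by (rule emeasure_lborel_box)
  also have "(\<Prod>b\<in>Basis. (relabel u - relabel l) \<bullet> b) = (\<Prod>i\<in>UNIV. u $ of_ocopy i - l $ of_ocopy i)"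
    unfolding prod_Basis_cart by (simp add: relabel_def)
  also have "\<dots> = (\<Prod>i\<in>UNIV. u $ i - l $ i)"
    by (rule prod.reindex_bij_betw[OF bij_of_ocopy])
  also have "\<dots> = (\<Prod>b\<in>Basis. (u - l) \<bullet> b)" unfolding prod_Basis_cart by simp
  finally show "emeasure (distr lborel borel unlabel) (box l u) = ennreal (\<Prod>b\<in>Basis. (u - l) \<bullet> b)" .
qed simp

lemma measure_relabel:
  fixes K :: "(real^'a::finite) set"
  assumes "K \<in> sets borel"
  shows "measure lebesgue (relabel ` K) = measure lebesgue K"
proof -
  have m: "(unlabel :: _ \<Rightarrow> real^'a) \<in> borel_measurable lborel"
    using linear_continuous_on[OF linear_unlabel[unfolded linear_conv_bounded_linear], of "UNIV :: (real^'a ocopy) set"]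
    by (simp add: borel_measurable_continuous_onI)
  have eq: "relabel ` K = unlabel -` K"
    by (auto simp: image_iff) (metis relabel_unlabel(1))
  have K': "unlabel -` K \<in> sets borel" using measurable_sets[OF m, of K] assms by simp
  have "measure lborel K = measure (distr lborel borel unlabel) K" by (simp only: distr_unlabel)
  also have "\<dots> = measure lborel (unlabel -` K)" using m assms by (simp add: measure_distr)
  finally show ?thesis using assms K' by (simp add: eq)
qed

lemma relabel_inner: "relabel (x :: real^'a::finite) \<bullet> relabel y = x \<bullet> y"
  unfolding inner_vec_def relabel_def
  using sum.reindex_bij_betw[OF bij_of_ocopy, of "\<lambda>i. x $ i \<bullet> y $ i"] by simp

lemma relabel_matrix_vector:
  fixes A :: "real^'a::finite^'a"
  shows "(\<chi> i j. A $ of_ocopy i $ of_ocopy j) *v y = relabel (A *v unlabel y)"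
  unfolding matrix_vector_mult_def relabel_def vec_eq_iff
  using sum.reindex_bij_betw[OF bij_of_ocopy, of "\<lambda>j. A $ _ $ j * unlabel y $ j"]
  by (simp add: unlabel_def)

text \<open>Relabelling carries an orthonormal eigenbasis to one with the same eigenvalues, so no
  permutation in the Leibniz formula has to be reindexed.\<close>

lemma det_relabel:
  fixes A :: "real^'a::finite^'a"
  assumes "transpose A = A"
  shows "det (\<chi> i j. A $ of_ocopy i $ of_ocopy j) = det A"
proof -
  from symmetric_matrix_eigen[OF assms]
  obtain b :: "'a \<Rightarrow> real^'a" and c where "\<forall>i. norm (b i) = 1 \<and> (\<forall>j. i \<noteq> j \<longrightarrow> b i \<bullet> b j = 0) \<and> A *v b i = c i *\<^sub>R b i"
    by (elim exE) (rule that)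
  then have b: "norm (b i) = 1" "i \<noteq> j \<Longrightarrow> b i \<bullet> b j = 0" "A *v b i = c i *\<^sub>R b i" for i j by auto
  have "det (\<chi> i j. A $ of_ocopy i $ of_ocopy j) = (\<Prod>i\<in>UNIV. c (of_ocopy i))"
  proof (rule det_eq_prod_eigenvalues[where b="\<lambda>i. relabel (b (of_ocopy i))"])
    show "norm (relabel (b (of_ocopy i))) = 1" for i
      using b(1) by (simp add: norm_eq_sqrt_inner relabel_inner)
    show "relabel (b (of_ocopy i)) \<bullet> relabel (b (of_ocopy j)) = 0" if "i \<noteq> j" for i j
    proof -
      have "of_ocopy i \<noteq> of_ocopy j" using that by (metis of_ocopy_inverse')
      then show ?thesis using b(2) by (simp add: relabel_inner)
    qed
    show "(\<chi> i j. A $ of_ocopy i $ of_ocopy j) *v relabel (b (of_ocopy i)) = c (of_ocopy i) *\<^sub>R relabel (b (of_ocopy i))" for i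
      using linear_scale[OF linear_relabel] by (simp add: relabel_matrix_vector b(3))
  qed
  also have "\<dots> = (\<Prod>i\<in>UNIV. c i)" by (rule prod.reindex_bij_betw[OF bij_of_ocopy])
  also have "\<dots> = det A" by (rule det_eq_prod_eigenvalues[symmetric, where b=b]) (simp_all add: b)
  finally show ?thesis .
qed

text \<open>Intended for the gradient map of a convex function, whose derivative is a Hessian; its
  symmetry is what \<open>det_relabel\<close> asks for when the change of variables is transferred
  to the ordered index type.\<close>

lemma measure_image_le_det_bound:
  fixes f :: "real^'a::finite \<Rightarrow> real^'a" and F :: "real^'a \<Rightarrow> real^'a^'a"
  assumes K: "compact K" and f: "\<And>x. (f has_derivative (*v) (F x)) (at x)" and sym: "\<And>x. transpose (F x) = F x"
    and cont: "\<And>i j. continuous_on UNIV (\<lambda>x. F x $ i $ j)" and B: "\<And>x. x \<in> K \<Longrightarrow> \<bar>det (F x)\<bar> \<le> B"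
  shows "measure lebesgue (f ` K) \<le> B * measure lebesgue K"
proof -
  let ?g = "\<lambda>y. relabel (f (unlabel y))"
  let ?F = "\<lambda>y. (\<chi> i j. F (unlabel y) $ of_ocopy i $ of_ocopy j) :: real^'a ocopy^'a ocopy"
  have cl: "continuous_on S (relabel :: real^'a \<Rightarrow> _)" "continuous_on T (unlabel :: _ \<Rightarrow> real^'a)" for S T
    by (intro linear_continuous_on linear_conv_bounded_linear[THEN iffD1] linear_relabel linear_unlabel)+
  have "continuous_on K f" using f has_derivative_continuous by (intro continuous_at_imp_continuous_on) blast
  then have "compact (f ` K)" using K by (rule compact_continuous_image)
  then have fK: "f ` K \<in> sets borel" by (rule borel_compact)
  have rK: "compact (relabel ` K)" using K by (intro compact_continuous_image cl)
  have d: "(?g has_derivative (*v) (?F y)) (at y)" for y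
  proof -
    have "((\<lambda>y. unlabel y) has_derivative unlabel) (at y)" and R: "((\<lambda>x. relabel x) has_derivative relabel) (at (f (unlabel y)))"
      using linear_unlabel linear_relabel by (auto intro!: bounded_linear_imp_has_derivative simp: linear_conv_bounded_linear)
    from has_derivative_compose[OF has_derivative_compose[OF this(1) f] R]
    have "(?g has_derivative (\<lambda>x. relabel (F (unlabel y) *v unlabel x))) (at y)" .
    moreover have "(*v) (?F y) = (\<lambda>x. relabel (F (unlabel y) *v unlabel x))"
      by (rule ext) (rule relabel_matrix_vector)
    ultimately show ?thesis by simp
  qed
  have det: "\<bar>det (matrix ((*v) (?F y)))\<bar> = \<bar>det (F (unlabel y))\<bar>" for y
    by (simp add: matrix_of_matrix_vector_mul det_relabel[OF sym])
  have "continuous_on UNIV (\<lambda>x. \<bar>det (F x)\<bar>)"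
    unfolding det_def by (intro continuous_intros cont)
  then have cdet: "continuous_on (relabel ` K) (\<lambda>y. \<bar>det (F (unlabel y))\<bar>)"
    by (rule continuous_on_compose2[OF _ cl(2)]) auto
  then have int: "(\<lambda>y. \<bar>det (F (unlabel y))\<bar>) integrable_on (relabel ` K)"
  proof -
    have m: "relabel ` K \<in> lmeasurable" using rK by (rule lmeasurable_compact)
    interpret finite_measure "lebesgue_on (relabel ` K)" by (rule finite_measure_lebesgue_on[OF m])
    have "integrable (lebesgue_on (relabel ` K)) (\<lambda>y. \<bar>det (F (unlabel y))\<bar>)"
    proof (rule integrable_const_bound[of _ B])
      show "AE y in lebesgue_on (relabel ` K). norm \<bar>det (F (unlabel y))\<bar> \<le> B"
        using B by (intro AE_I2) (auto simp: space_restrict_space)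
      show "(\<lambda>y. \<bar>det (F (unlabel y))\<bar>) \<in> borel_measurable (lebesgue_on (relabel ` K))"
        by (rule continuous_imp_measurable_on_sets_lebesgue[OF cdet fmeasurableD[OF m]])
    qed
    then show ?thesis using m by (intro integrable_on_lebesgue_on) auto
  qed
  have "measure lebesgue (f ` K) = measure lebesgue (relabel ` f ` K)" using measure_relabel[OF fK] by simp
  also have "relabel ` f ` K = ?g ` (relabel ` K)" by (auto simp: image_image)
  also have "measure lebesgue (?g ` (relabel ` K)) \<le> B * measure lebesgue (relabel ` K)"
  proof (rule measure_bounded_differentiable_image[where f'="\<lambda>y. (*v) (?F y)"])
    show "relabel ` K \<in> lmeasurable" using rK by (rule lmeasurable_compact)
    show "(?g has_derivative (*v) (?F y)) (at y within relabel ` K)" for y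
      using d by (rule has_derivative_at_withinI)
    show "(\<lambda>y. \<bar>det (matrix ((*v) (?F y)))\<bar>) integrable_on relabel ` K"
      unfolding det by (rule int)
    show "\<bar>det (matrix ((*v) (?F y)))\<bar> \<le> B" if "y \<in> relabel ` K" for y
      unfolding det using that B by auto
  qed
  also have "measure lebesgue (relabel ` K) = measure lebesgue K" using K by (intro measure_relabel borel_compact)
  finally show ?thesis .
qed

section \<open>From the lattice to the mollified problem\<close>

definition latt :: "real \<Rightarrow> real^'d::finite \<Rightarrow> real^'d" where
  "latt h z = (\<chi> i. h * of_int \<lfloor>z $ i / h\<rfloor>)"

text \<open>Lattice points are treated throughout as the fixed points of rounding down; this
  description makes them visibly closed under subtraction.\<close>

lemma latt_fixed_iff: "h > 0 \<Longrightarrow> latt h x = x \<longleftrightarrow> (\<forall>i. \<exists>k::int. x $ i = h * of_int k)"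
proof
  assume h: "h > 0" and "\<forall>i. \<exists>k::int. x $ i = h * of_int k"
  then show "latt h x = x" by (metis (no_types, lifting) floor_of_int latt_def nonzero_mult_div_cancel_left order_less_irrefl vec_lambda_eta vec_eq_iff vec_lambda_beta)
qed (auto simp: latt_def vec_eq_iff, metis)

lemma latt_latt [simp]: "h > 0 \<Longrightarrow> latt h (latt h z) = latt h z"
  by (subst latt_fixed_iff) (auto simp: latt_def)

lemma latt_diff: "h > 0 \<Longrightarrow> latt h x = x \<Longrightarrow> latt h y = y \<Longrightarrow> latt h (x - y) = x - y"
  unfolding latt_fixed_iff by (metis of_int_diff right_diff_distrib vector_minus_component)

lemma latt_component_bounds:
  fixes h :: real
  assumes "h > 0" shows "latt h z $ i \<le> z $ i" "z $ i < latt h z $ i + h"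
proof -
  have "h * of_int \<lfloor>z $ i / h\<rfloor> \<le> h * (z $ i / h)" using assms by (intro mult_left_mono) auto
  then show "latt h z $ i \<le> z $ i" using assms by (simp add: latt_def)
  have "h * (z $ i / h) < h * (of_int \<lfloor>z $ i / h\<rfloor> + 1)" using assms by (intro mult_strict_left_mono) linarith+
  then show "z $ i < latt h z $ i + h" using assms by (simp add: latt_def algebra_simps)
qed

lemma norm_diff_latt_le:
  fixes z :: "real^'d::finite" and h :: real
  assumes "h > 0" shows "norm (z - latt h z) \<le> CARD('d) * h"
proof -
  have "norm (z - latt h z) \<le> (\<Sum>i\<in>UNIV. \<bar>(z - latt h z) $ i\<bar>)" by (rule norm_le_l1_cart)
  also have "\<dots> \<le> (\<Sum>i\<in>(UNIV::'d set). h)"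
  proof (rule sum_mono)
    fix i show "\<bar>(z - latt h z) $ i\<bar> \<le> h"
      using latt_component_bounds[OF assms, of z i] by simp
  qed
  finally show ?thesis by simp
qed

lemma finite_latt_image:
  fixes h :: real
  assumes "h > 0" shows "finite (latt h ` cball (0::real^'d::finite) r)"
proof (rule finite_subset)
  let ?N = "\<lceil>r / h\<rceil> + 1"
  let ?g = "\<lambda>k :: 'd \<Rightarrow> int. \<chi> i. h * of_int (k i)"
  show "finite (?g ` {k. \<forall>i. k i \<in> {- ?N..?N}})"
    using finite_PiE[of "UNIV :: 'd set" "\<lambda>_. {- ?N..?N}"] by (intro finite_imageI) (simp add: PiE_def Pi_def)
  show "latt h ` cball 0 r \<subseteq> ?g ` {k. \<forall>i. k i \<in> {- ?N..?N}}"
  proof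
    fix v :: "real^'d" assume "v \<in> latt h ` cball 0 r"
    then obtain x where x: "norm x \<le> r" "v = latt h x" by auto
    have "\<lfloor>x $ i / h\<rfloor> \<in> {- ?N..?N}" for i
    proof -
      have "\<bar>x $ i\<bar> \<le> r" using x(1) component_le_norm_cart[of x i] by linarith
      then have "\<bar>x $ i / h\<bar> \<le> r / h" using assms by (simp add: abs_divide divide_right_mono)
      moreover have "r / h \<le> of_int \<lceil>r / h\<rceil>" by simp
      ultimately have "- of_int \<lceil>r / h\<rceil> \<le> x $ i / h" "x $ i / h \<le> of_int \<lceil>r / h\<rceil>" by linarith+
      then show ?thesis by (simp add: le_floor_iff floor_le_iff)
    qed
    then show "v \<in> ?g ` {k. \<forall>i. k i \<in> {- ?N..?N}}"
      unfolding x(2) latt_def by (intro image_eqI[of _ _ "\<lambda>i. \<lfloor>x $ i / h\<rfloor>"]) auto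
  qed
qed

definition cell :: "real \<Rightarrow> real^'d::finite \<Rightarrow> (real^'d) set" where
  "cell h p = {z. latt h z = p}"

lemma cell_sets: "cell h p \<in> sets borel"
proof -
  have "cell h p = {z \<in> space borel. \<forall>i\<in>UNIV. h * of_int \<lfloor>z $ i / h\<rfloor> = p $ i}"
    by (auto simp: cell_def latt_def vec_eq_iff)
  also have "\<dots> \<in> sets borel"
    by (intro sets.sets_Collect_finite_All borel_measurable_eq) (auto intro!: borel_measurable_continuous_onI continuous_intros)
  finally show ?thesis .
qed

lemma
  fixes p :: "real^'d::finite" and h :: real
  assumes h: "h > 0" and p: "latt h p = p"
  shows cell_lmeasurable: "cell h p \<in> lmeasurable" and measure_cell: "measure lebesgue (cell h p) = h ^ CARD('d)"
proof -
  define e :: "real^'d" where "e = (\<chi> i. h)"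
  have sub1: "box p (p + e) \<subseteq> cell h p"
  proof
    fix z assume z: "z \<in> box p (p + e)"
    have "h * of_int \<lfloor>z $ i / h\<rfloor> = p $ i" for i
    proof -
      obtain k :: int where k: "p $ i = h * of_int k" using p h by (auto simp: latt_fixed_iff)
      have "h * of_int k < z $ i" "z $ i < h * of_int k + h"
        using z k by (auto simp: mem_box_cart e_def dest: spec[of _ i])
      then have "\<lfloor>z $ i / h\<rfloor> = k" using h by (intro floor_unique) (auto simp: field_simps)
      then show ?thesis using k by simp
    qed
    then show "z \<in> cell h p" by (simp add: cell_def latt_def vec_eq_iff)
  qed
  have sub2: "cell h p \<subseteq> cbox p (p + e)"
    using latt_component_bounds(1)[OF h] less_imp_le[OF latt_component_bounds(2)[OF h]]
    by (auto simp: cell_def mem_box_cart e_def)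
  have "bounded (cell h p)" using sub2 bounded_cbox bounded_subset by blast
  then show m: "cell h p \<in> lmeasurable"
    by (rule bounded_set_imp_lmeasurable) (rule sets_completionI_sets, simp add: cell_sets)
  have c: "measure lebesgue (cbox p (p + e)) = h ^ CARD('d)"
    using content_cbox_cart[of p "p + e"] h by (simp add: e_def interval_ne_empty_cart)
  have "measure lebesgue (box p (p + e)) = measure lebesgue (cbox p (p + e))"
    by (simp add: measure_lborel_box_eq measure_lborel_cbox_eq)
  moreover have "measure lebesgue (box p (p + e)) \<le> measure lebesgue (cell h p)"
    using sub1 m by (intro measure_mono_fmeasurable) auto
  moreover have "measure lebesgue (cell h p) \<le> measure lebesgue (cbox p (p + e))"
    using sub2 m by (intro measure_mono_fmeasurable) (auto simp: fmeasurableD)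
  ultimately show "measure lebesgue (cell h p) = h ^ CARD('d)" using c by linarith
qed

lemma integrable_indicator_cell:
  "integrable lebesgue f \<Longrightarrow> integrable lebesgue (\<lambda>z. f z * indicator (cell h p) z :: real)"
  by (intro integrable_real_mult_indicator sets_completionI_sets) (simp_all add: cell_sets)

text \<open>Only finitely many cells meet the support of \<open>f\<close>, so a function of the
  rounded point integrates to a finite sum weighted by cell masses. It is the bridge between
  mollification and averages of lattice translates.\<close>

lemma integral_latt_decompose:
  fixes f \<phi> :: "real^'d::finite \<Rightarrow> real" and h :: real
  assumes h: "h > 0" and f: "integrable lebesgue f" and r: "\<And>z. r < norm z \<Longrightarrow> f z = 0"
  shows "integrable lebesgue (\<lambda>z. f z * \<phi> (latt h z))"
    "(LINT z|lebesgue. f z * \<phi> (latt h z)) =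
      (\<Sum>p\<in>latt h ` cball 0 r. (LINT z|lebesgue. f z * indicator (cell h p) z) * \<phi> p)"
proof -
  let ?F = "latt h ` cball 0 r"
  have eq: "f z * \<phi> (latt h z) = (\<Sum>p\<in>?F. f z * indicator (cell h p) z * \<phi> p)" for z
  proof (cases "norm z \<le> r")
    case True
    have "(\<Sum>p\<in>?F. f z * indicator (cell h p) z * \<phi> p) = (\<Sum>p\<in>?F. if p = latt h z then f z * \<phi> p else 0)"
      by (intro sum.cong) (auto simp: cell_def)
    also have "\<dots> = f z * \<phi> (latt h z)"
      using True finite_latt_image[OF h, of r] by (subst sum.delta) auto
    finally show ?thesis by simp
  next
    case False
    then show ?thesis using r by simp
  qed
  show "integrable lebesgue (\<lambda>z. f z * \<phi> (latt h z))"
    unfolding eq by (intro Bochner_Integration.integrable_sum integrable_mult_left integrable_indicator_cell f)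
  show "(LINT z|lebesgue. f z * \<phi> (latt h z)) = (\<Sum>p\<in>?F. (LINT z|lebesgue. f z * indicator (cell h p) z) * \<phi> p)"
    unfolding eq
    by (subst Bochner_Integration.integral_sum) (auto intro!: integrable_mult_left integrable_indicator_cell f)
qed

text \<open>The graph of the power lies above its tangent at \<open>a\<close>, by Bernoulli's
  inequality applied to \<open>t / a\<close>.\<close>

lemma power_tangent_le:
  fixes t a :: real
  assumes "t \<ge> 0" "a \<ge> 0" "n > 0"
  shows "a ^ n + n * a ^ (n - 1) * (t - a) \<le> t ^ n"
proof (cases "a = 0")
  case True
  then show ?thesis using assms by (cases n; cases "n - 1") (auto simp: power_0_left)
next
  case False
  then have a: "a > 0" using assms by simp
  have "1 + n * (t / a - 1) \<le> (1 + (t / a - 1)) ^ n" using assms a by (intro Bernoulli_inequality) auto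
  then have "a ^ n * (1 + n * (t / a - 1)) \<le> a ^ n * (t / a) ^ n" using a by (intro mult_left_mono) auto
  also have "\<dots> = t ^ n" using a by (simp add: power_divide)
  also have "a ^ n * (1 + n * (t / a - 1)) = a ^ n + n * a ^ (n - 1) * (t - a)"
    using a assms(3) by (cases n) (simp_all add: field_simps)
  finally show ?thesis .
qed

text \<open>Jensen's inequality on one cell: the left side is the mean of \<open>q\<close> times
  \<open>h\<close>, and \<open>h\<close> is the root of the volume of the cell. The tangent
  inequality is taken at the mean \<open>a\<close> and integrated.\<close>

lemma root_integral_power_cell_ge:
  fixes q :: "real^'d::finite \<Rightarrow> real" and h :: real
  assumes h: "h > 0" and p: "latt h p = p" and q: "\<And>x. 0 \<le> q x"
    and i: "integrable lebesgue q" "integrable lebesgue (\<lambda>x. q x ^ CARD('d))"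
  shows "(LINT z|lebesgue. q z * indicator (cell h p) z) * h / h ^ CARD('d)
     \<le> root CARD('d) (LINT z|lebesgue. q z ^ CARD('d) * indicator (cell h p) z)"
proof -
  let ?d = "CARD('d)" and ?V = "h ^ CARD('d)" and ?I = "\<lambda>z. indicator (cell h p) z :: real"
  define M where "M = (LINT z|lebesgue. q z * ?I z)"
  define a where "a = M / ?V"
  have V: "?V > 0" using h by simp
  have "M \<ge> 0" unfolding M_def using q by (intro integral_nonneg_AE) auto
  then have a0: "a \<ge> 0" using V by (simp add: a_def)
  have iI: "integrable lebesgue ?I"
    using cell_lmeasurable[OF h p] fmeasurableD2[OF cell_lmeasurable[OF h p]]
    by (intro integrable_real_indicator) (auto simp: fmeasurableD less_top[symmetric] simp del: emeasure_completion)
  have "(LINT z|lebesgue. (a ^ ?d - ?d * a ^ (?d - 1) * a) * ?I z + ?d * a ^ (?d - 1) * (q z * ?I z))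
      \<le> (LINT z|lebesgue. q z ^ ?d * ?I z)"
  proof (intro integral_mono Bochner_Integration.integrable_add integrable_mult_right iI integrable_indicator_cell i)
    fix z
    have "a ^ ?d + ?d * a ^ (?d - 1) * (q z - a) \<le> q z ^ ?d"
      using power_tangent_le[OF q[of z] a0, of ?d] by simp
    then have "(a ^ ?d + ?d * a ^ (?d - 1) * (q z - a)) * ?I z \<le> q z ^ ?d * ?I z"
      by (intro mult_right_mono) auto
    then show "(a ^ ?d - ?d * a ^ (?d - 1) * a) * ?I z + ?d * a ^ (?d - 1) * (q z * ?I z) \<le> q z ^ ?d * ?I z"
      by (simp add: algebra_simps)
  qed
  also have "(LINT z|lebesgue. (a ^ ?d - ?d * a ^ (?d - 1) * a) * ?I z + ?d * a ^ (?d - 1) * (q z * ?I z)) =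
      (a ^ ?d - ?d * a ^ (?d - 1) * a) * ?V + ?d * a ^ (?d - 1) * M"
    using iI integrable_indicator_cell[OF i(1)]
    by (simp add: M_def measure_cell[OF h p, symmetric])
  also have "\<dots> = a ^ ?d * ?V"
  proof -
    have "M = a * ?V" using h by (simp add: a_def)
    then show ?thesis by (simp only:) (simp add: algebra_simps)
  qed
  also have "\<dots> = (a * h) ^ ?d" by (simp add: power_mult_distrib)
  finally have "root ?d ((a * h) ^ ?d) \<le> root ?d (LINT z|lebesgue. q z ^ ?d * ?I z)" by simp
  moreover have "root ?d ((a * h) ^ ?d) = a * h" using a0 h by (intro real_root_power_cancel) auto
  ultimately have "a * h \<le> root ?d (LINT z|lebesgue. q z ^ ?d * ?I z)" by linarith
  then show ?thesis by (simp only: a_def M_def times_divide_eq_left)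
qed

section \<open>Averages of translates and their subdifferentials\<close>

lemma measure_subdiff_scale:
  fixes S :: "(real^'d::finite) set"
  assumes "compact S" "w \<ge> 0"
  shows "root CARD('d) (measure lebesgue ((*\<^sub>R) w ` S)) = w * root CARD('d) (measure lebesgue S)"
proof -
  have "(\<lambda>x. w *\<^sub>R x + 0) ` S = (*\<^sub>R) w ` S" by simp
  then have "measure lebesgue ((*\<^sub>R) w ` S) = \<bar>w\<bar> ^ CARD('d) * measure lebesgue S"
    using measure_lebesgue_affine[of w 0 S] by simp
  then show ?thesis using assms(2) by (simp add: real_root_mult real_root_power_cancel)
qed

text \<open>A weighted sum of subgradients of \<open>u\<close> at the points \<open>x - p\<close> is
  a subgradient of the average \<open>U\<close> at \<open>x\<close>. The subdifferential of
  \<open>U\<close> thus contains a Minkowski sum, and Brunn-Minkowski bounds its volume from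
  below.\<close>

lemma convex_combination_subdiff:
  fixes u :: "real^'d::finite \<Rightarrow> real"
  assumes F: "finite F" and w: "\<And>p. p \<in> F \<Longrightarrow> 0 \<le> w p" "(\<Sum>p\<in>F. w p) = 1" and sub: "\<And>x. subdiff R u x \<noteq> {}"
  defines "U \<equiv> \<lambda>x. \<Sum>p\<in>F. w p * u (x - p)"
  shows "subdiff R U x \<noteq> {}"
    "(\<Sum>p\<in>F. w p * root CARD('d) (measure lebesgue (subdiff R u (x - p)))) \<le> root CARD('d) (measure lebesgue (subdiff R U x))"
proof -
  let ?S = "\<lambda>p. (*\<^sub>R) (w p) ` subdiff R u (x - p)"
  let ?T = "{\<Sum>p\<in>F. y p | y. \<forall>p\<in>F. y p \<in> ?S p}"
  have "\<And>p. p \<in> F \<Longrightarrow> compact (?S p) \<and> convex (?S p) \<and> ?S p \<noteq> {}"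
    using sub by (auto intro: compact_scaling convex_scaling compact_subdiff convex_subdiff)
  from Brunn_Minkowski_sum[OF F this]
  have T: "compact ?T" "?T \<noteq> {}" and le: "(\<Sum>p\<in>F. root CARD('d) (measure lebesgue (?S p))) \<le> root CARD('d) (measure lebesgue ?T)"
    by auto
  have TU: "?T \<subseteq> subdiff R U x"
  proof
    fix t assume "t \<in> ?T"
    then obtain y where y: "t = (\<Sum>p\<in>F. y p)" "\<forall>p\<in>F. y p \<in> ?S p" by blast
    have "\<forall>p\<in>F. \<exists>g. g \<in> subdiff R u (x - p) \<and> y p = w p *\<^sub>R g" using y(2) by blast
    then obtain g where g: "\<forall>p\<in>F. g p \<in> subdiff R u (x - p) \<and> y p = w p *\<^sub>R g p" by (rule bchoice[THEN exE])
    have t: "t = (\<Sum>p\<in>F. w p *\<^sub>R g p)" using y(1) g by (simp cong: sum.cong)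
    have "norm t \<le> (\<Sum>p\<in>F. w p * R)"
      unfolding t using g w(1) by (intro sum_norm_le) (auto simp: subdiff_def intro!: mult_left_mono)
    also have "\<dots> = R" using w(2) by (simp flip: sum_distrib_right)
    finally have "t \<in> cball 0 R" by simp
    moreover have "U x + t \<bullet> (z - x) \<le> U z" for z
    proof -
      have "U x + t \<bullet> (z - x) = (\<Sum>p\<in>F. w p * (u (x - p) + g p \<bullet> ((z - p) - (x - p))))"
        unfolding U_def t by (simp add: inner_sum_left distrib_left sum.distrib)
      also have "\<dots> \<le> U z"
        unfolding U_def
      proof (intro sum_mono mult_left_mono w(1))
        fix p assume "p \<in> F"
        then have "g p \<in> subdiff R u (x - p)" using g by blast
        then show "u (x - p) + g p \<bullet> ((z - p) - (x - p)) \<le> u (z - p)" unfolding subdiff_def by blast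
      qed
      finally show ?thesis .
    qed
    ultimately show "t \<in> subdiff R U x" by (simp add: subdiff_def)
  qed
  then show "subdiff R U x \<noteq> {}" using T by blast
  have "(\<Sum>p\<in>F. w p * root CARD('d) (measure lebesgue (subdiff R u (x - p)))) = (\<Sum>p\<in>F. root CARD('d) (measure lebesgue (?S p)))"
    using w(1) by (intro sum.cong refl measure_subdiff_scale[symmetric] compact_subdiff) auto
  also note le
  also have "root CARD('d) (measure lebesgue ?T) \<le> root CARD('d) (measure lebesgue (subdiff R U x))"
    using TU T by (simp add: measure_mono_fmeasurable lmeasurable_compact compact_subdiff fmeasurableD)
  finally show "(\<Sum>p\<in>F. w p * root CARD('d) (measure lebesgue (subdiff R u (x - p)))) \<le> root CARD('d) (measure lebesgue (subdiff R U x))" .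
qed

lemma subdiff_add_const: "subdiff R (\<lambda>x. u x + c) x = subdiff R u x"
  by (simp add: subdiff_def)

lemma csmooth_bounded:
  assumes "csmooth \<rho>"
  shows "\<exists>B. \<forall>z. \<bar>\<rho> z\<bar> \<le> B"
proof -
  obtain s where s: "\<And>x. s < norm x \<Longrightarrow> \<rho> x = 0" using assms by (auto simp: csmooth_def)
  have "compact (\<rho> ` cball 0 s)" using csmooth_continuous[OF assms] by (intro compact_continuous_image) auto
  then have "bounded (\<rho> ` cball 0 s)" by (rule compact_imp_bounded)
  then obtain B where "\<forall>z\<in>cball 0 s. \<bar>\<rho> z\<bar> \<le> B"
    unfolding bounded_iff by auto
  then have B: "\<bar>\<rho> z\<bar> \<le> B" if "z \<in> cball 0 s" for z using that by blast
  have "\<bar>\<rho> z\<bar> \<le> max B 0" for z using B[of z] s[of z] by (cases "norm z \<le> s") auto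
  then show ?thesis by blast
qed

lemma csmooth_Lipschitz:
  fixes \<rho> :: "'a::euclidean_space \<Rightarrow> real"
  assumes \<rho>: "csmooth \<rho>"
  shows "\<exists>L. \<forall>x y. \<bar>\<rho> x - \<rho> y\<bar> \<le> L * dist x y"
proof -
  let ?D = "\<lambda>x. frechet_derivative \<rho> (at x)"
  have "\<forall>b. \<exists>B. \<forall>x. \<bar>?D x b\<bar> \<le> B" using csmooth_bounded[OF csmooth_frechet_derivative[OF \<rho>]] by blast
  then obtain B where B: "\<forall>b. \<forall>x. \<bar>?D x b\<bar> \<le> B b" by (rule choice[THEN exE])
  let ?L = "\<Sum>b\<in>Basis. B b"
  have bl: "bounded_linear (?D x)" for x using csmooth_has_derivative[OF \<rho>] by (rule has_derivative_bounded_linear)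
  have "onorm (?D x) \<le> ?L" for x
  proof (rule onorm_le)
    fix v
    have "?D x v = (\<Sum>b\<in>Basis. (v \<bullet> b) * ?D x b)"
      by (subst euclidean_representation[of v, symmetric])
         (simp add: linear_sum[OF bounded_linear.linear[OF bl]] linear_scale[OF bounded_linear.linear[OF bl]])
    then have "norm (?D x v) \<le> (\<Sum>b\<in>Basis. norm ((v \<bullet> b) * ?D x b))" by (simp only: norm_sum)
    also have "\<dots> \<le> (\<Sum>b\<in>Basis. norm v * B b)"
    proof (rule sum_mono)
      fix b :: 'a assume "b \<in> Basis"
      then show "norm ((v \<bullet> b) * ?D x b) \<le> norm v * B b"
        using B Basis_le_norm[of b v] by (simp add: abs_mult mult_mono)
    qed
    also have "\<dots> = ?L * norm v" by (simp add: sum_distrib_left mult.commute)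
    finally show "norm (?D x v) \<le> ?L * norm v" .
  qed
  then have "norm (\<rho> x - \<rho> y) \<le> ?L * norm (x - y)" for x y
    using csmooth_has_derivative[OF \<rho>]
    by (intro differentiable_bound[where f'="?D" and S=UNIV]) (auto intro: has_derivative_at_withinI)
  then show ?thesis by (auto simp: dist_norm)
qed

text \<open>The modulus of continuity comes from the kernel alone, so integrability of
  \<open>q\<close> suffices.\<close>

lemma conv_Lipschitz_pointwise:
  fixes q :: "'a::euclidean_space \<Rightarrow> real"
  assumes \<rho>: "csmooth \<rho>" and L: "\<And>x y. \<bar>\<rho> x - \<rho> y\<bar> \<le> L * dist x y" and q: "integrable lebesgue q" "\<And>x. 0 \<le> q x"
  shows "integrable lebesgue (\<lambda>z. \<rho> (x - z) * q z)"
    "\<bar>conv \<rho> q x - conv \<rho> q y\<bar> \<le> L * dist x y * (LINT z|lebesgue. q z)"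
proof -
  obtain B where B: "\<And>z. \<bar>\<rho> z\<bar> \<le> B" using csmooth_bounded[OF \<rho>] by blast
  have i: "integrable lebesgue (\<lambda>z. \<rho> (x - z) * q z)" for x
  proof (rule Bochner_Integration.integrable_bound)
    show "integrable lebesgue (\<lambda>z. B * q z)" using q(1) by simp
    have "continuous_on UNIV (\<lambda>z. \<rho> (x - z))"
      by (rule continuous_on_compose2[OF csmooth_continuous[OF \<rho>, of UNIV]]) (auto intro: continuous_intros)
    then show "(\<lambda>z. \<rho> (x - z) * q z) \<in> borel_measurable lebesgue"
      by (rule borel_measurable_times[OF continuous_imp_borel_lebesgue borel_measurable_integrable[OF q(1)]])
    show "AE z in lebesgue. norm (\<rho> (x - z) * q z) \<le> norm (B * q z)"
    proof (rule AE_I2)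
      fix z show "norm (\<rho> (x - z) * q z) \<le> norm (B * q z)"
        using mult_right_mono[of "\<bar>\<rho> (x - z)\<bar>" "\<bar>B\<bar>" "\<bar>q z\<bar>"] B[of "x - z"] by (simp add: abs_mult)
    qed
  qed
  show "integrable lebesgue (\<lambda>z. \<rho> (x - z) * q z)" by (rule i)
  have "\<bar>conv \<rho> q x - conv \<rho> q y\<bar> = \<bar>LINT z|lebesgue. \<rho> (x - z) * q z - \<rho> (y - z) * q z\<bar>"
    unfolding conv_def using i by simp
  also have "\<dots> \<le> (LINT z|lebesgue. \<bar>\<rho> (x - z) * q z - \<rho> (y - z) * q z\<bar>)" by (rule integral_abs_bound)
  also have "\<dots> \<le> (LINT z|lebesgue. L * dist x y * q z)"
  proof (intro integral_mono integrable_abs Bochner_Integration.integrable_diff i integrable_mult_right q(1))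
    fix z
    have "\<bar>\<rho> (x - z) * q z - \<rho> (y - z) * q z\<bar> = \<bar>\<rho> (x - z) - \<rho> (y - z)\<bar> * q z"
      using q(2)[of z] by (simp add: abs_mult flip: left_diff_distrib)
    also have "\<dots> \<le> L * dist (x - z) (y - z) * q z" by (intro mult_right_mono L q(2))
    finally show "\<bar>\<rho> (x - z) * q z - \<rho> (y - z) * q z\<bar> \<le> L * dist x y * q z" by (simp add: dist_norm)
  qed
  also have "\<dots> = L * dist x y * (LINT z|lebesgue. q z)" by simp
  finally show "\<bar>conv \<rho> q x - conv \<rho> q y\<bar> \<le> L * dist x y * (LINT z|lebesgue. q z)" .
qed

text \<open>
  \<open>u\<close> solves the discrete problem for the cell masses of \<open>q ^ d\<close>, and \<open>U\<close> is the average of its lattice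
  translates with the cell masses of \<open>\<rho>\<close> as weights.
\<close>

lemma exists_lattice_potential:
  fixes \<rho> q :: "real^'d::finite \<Rightarrow> real" and h R L :: real
  assumes \<rho>: "csmooth \<rho>" "\<And>x. 0 \<le> \<rho> x" "(LINT z|lebesgue. \<rho> z) = 1" and L: "\<And>x y. \<bar>\<rho> x - \<rho> y\<bar> \<le> L * dist x y"
    and q: "\<And>x. 0 \<le> q x" "\<And>x. r < norm x \<Longrightarrow> q x = 0"
      "integrable lebesgue q" "integrable lebesgue (\<lambda>x. q x ^ CARD('d))"
    and R: "R > 0" "(LINT x|lebesgue. q x ^ CARD('d)) = measure lebesgue (cball (0::real^'d) R)" and h: "h > 0"
  shows "\<exists>u U. u 0 = 0 \<and> (\<forall>x. subdiff R u x \<noteq> {}) \<and> (\<forall>x. subdiff R U x \<noteq> {}) \<and>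
     (\<forall>x. \<bar>U x - conv \<rho> u x\<bar> \<le> R * (CARD('d) * h)) \<and>
     (\<forall>x. latt h x = x \<longrightarrow> h * (conv \<rho> q x - L * (2 * CARD('d) * h) * (LINT z|lebesgue. q z))
        \<le> root CARD('d) (measure lebesgue (subdiff R U x)))"
proof -
  let ?d = "CARD('d)" and ?V = "h ^ CARD('d)"
  obtain s where s: "\<And>x. s < norm x \<Longrightarrow> \<rho> x = 0" using \<rho>(1) by (auto simp: csmooth_def)
  have i\<rho>: "integrable lebesgue \<rho>" using integrable_conv(2)[OF \<rho>(1), of "\<lambda>_. 1" 0] by simp
  define m where "m p = (LINT z|lebesgue. q z ^ ?d * indicator (cell h p) z)" for p
  define M where "M p = (LINT z|lebesgue. q z * indicator (cell h p) z)" for p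
  define w where "w p = (LINT z|lebesgue. \<rho> z * indicator (cell h p) z)" for p
  let ?P = "latt h ` cball (0::real^'d) r" and ?F = "latt h ` cball (0::real^'d) s"
  have fin: "finite ?P" "finite ?F" using finite_latt_image[OF h] by blast+
  have q0: "q x ^ ?d = 0" if "r < norm x" for x using q(2)[OF that] by simp
  have w0: "0 \<le> w p" for p unfolding w_def using \<rho>(2) by (intro integral_nonneg_AE) auto
  have m0: "0 \<le> m p" for p unfolding m_def using q(1) by (intro integral_nonneg_AE) auto
  have wF: "w p = 0" if "p \<notin> ?F" for p
  proof -
    have "\<rho> z * indicator (cell h p) z = 0" for z
      using that s[of z] by (auto simp: cell_def indicator_def image_iff not_le)
    then show ?thesis unfolding w_def by (simp only: lebesgue_integral_const) simp
  qed
  have MP: "M p = 0" if "p \<notin> ?P" for p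
  proof -
    have "q z * indicator (cell h p) z = 0" for z
      using that q(2)[of z] by (auto simp: cell_def indicator_def image_iff not_le)
    then show ?thesis unfolding M_def by (simp only: lebesgue_integral_const) simp
  qed
  have "(\<Sum>p\<in>?P. m p) = measure lebesgue (cball (0::real^'d) R)"
    using integral_latt_decompose(2)[OF h q(4) q0, where \<phi>="\<lambda>_. 1"] R(2) by (simp add: m_def)
  from discrete_Alexandrov[OF fin(1) m0 R(1) this]
  obtain v where v: "\<forall>x. subdiff R v x \<noteq> {}" "\<forall>x\<in>?P. m x \<le> measure lebesgue (subdiff R v x)" by blast
  \<comment> \<open>With the Lipschitz bound \<open>R\<close>, the normalisation
    \<open>u 0 = 0\<close> keeps the potentials locally bounded uniformly in \<open>h\<close>, as
    compactness will require. Adding a constant leaves subdifferentials unchanged.\<close>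
  define u where "u x = v x + - v 0" for x
  have u0: "u 0 = 0" by (simp add: u_def)
  have sub: "subdiff R u x = subdiff R v x" for x unfolding u_def by (rule subdiff_add_const)
  have une: "subdiff R u x \<noteq> {}" for x using v sub by simp
  have um: "m x \<le> measure lebesgue (subdiff R u x)" for x
  proof (cases "x \<in> ?P")
    case False
    have "q z ^ ?d * indicator (cell h x) z = 0" for z
      using False q0[of z] by (auto simp: cell_def indicator_def image_iff not_le)
    then have "m x = 0" unfolding m_def by (simp only: lebesgue_integral_const) simp
    then show ?thesis by simp
  next
    case True
    then show ?thesis using bspec[OF v(2)] by (simp only: sub)
  qed
  define U where "U x = (\<Sum>p\<in>?F. w p * u (x - p))" for x
  have w1: "(\<Sum>p\<in>?F. w p) = 1"
    using integral_latt_decompose(2)[OF h i\<rho> s, where \<phi>="\<lambda>_. 1"] \<rho>(3) by (simp add: w_def)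
  note cc = convex_combination_subdiff[OF fin(2) w0 w1 une, folded U_def]
  have uL: "\<bar>u x - u y\<bar> \<le> R * dist x y" for x y by (rule subdiff_nonempty_imp_Lipschitz[OF une])
  have ucont: "continuous_on UNIV u"
    using uL R by (intro lipschitz_on_continuous_on[of R] lipschitz_onI) (auto simp: dist_real_def)
  have close: "\<bar>U x - conv \<rho> u x\<bar> \<le> R * (?d * h)" for x
  proof -
    have Ux: "U x = (LINT z|lebesgue. \<rho> z * u (x - latt h z))"
      unfolding U_def w_def by (rule integral_latt_decompose(2)[OF h i\<rho> s, symmetric])
    note i1 = integral_latt_decompose(1)[OF h i\<rho> s, where \<phi>="\<lambda>p. u (x - p)"] and i2 = integrable_conv(2)[OF \<rho>(1) ucont, of x]
    have "\<bar>U x - conv \<rho> u x\<bar> = \<bar>LINT z|lebesgue. \<rho> z * u (x - latt h z) - \<rho> z * u (x - z)\<bar>"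
      unfolding Ux conv_flip[OF \<rho>(1) ucont] using i1 i2 by simp
    also have "\<dots> \<le> (LINT z|lebesgue. \<bar>\<rho> z * u (x - latt h z) - \<rho> z * u (x - z)\<bar>)" by (rule integral_abs_bound)
    also have "\<dots> \<le> (LINT z|lebesgue. \<rho> z * (R * (?d * h)))"
    proof (intro integral_mono integrable_abs Bochner_Integration.integrable_diff i1 i2 integrable_mult_left i\<rho>)
      fix z
      have "\<bar>u (x - latt h z) - u (x - z)\<bar> \<le> R * dist (x - latt h z) (x - z)" by (rule uL)
      also have "dist (x - latt h z) (x - z) = norm (z - latt h z)" by (simp add: dist_norm)
      also have "R * norm (z - latt h z) \<le> R * (?d * h)" using R norm_diff_latt_le[OF h] by (intro mult_left_mono) auto
      finally have "\<rho> z * \<bar>u (x - latt h z) - u (x - z)\<bar> \<le> \<rho> z * (R * (?d * h))"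
        using \<rho>(2) by (intro mult_left_mono) auto
      moreover have "\<bar>\<rho> z * u (x - latt h z) - \<rho> z * u (x - z)\<bar> = \<rho> z * \<bar>u (x - latt h z) - u (x - z)\<bar>"
        using \<rho>(2)[of z] by (simp add: abs_mult flip: right_diff_distrib)
      ultimately show "\<bar>\<rho> z * u (x - latt h z) - \<rho> z * u (x - z)\<bar> \<le> \<rho> z * (R * (?d * h))" by simp
    qed
    also have "\<dots> = R * (?d * h)" using \<rho>(3) by simp
    finally show ?thesis .
  qed
  have lower: "h * (conv \<rho> q x - L * (2 * ?d * h) * (LINT z|lebesgue. q z)) \<le> root ?d (measure lebesgue (subdiff R U x))"
    if x: "latt h x = x" for x
  proof -
    \<comment> \<open>A point of the cell of \<open>x - latt h z\<close> is within
      \<open>2 * CARD('d) * h\<close> of \<open>x - z\<close>, one rounding error for each point. So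
      on this cell the kernel is at least \<open>\<rho> (x - z)\<close> up to the Lipschitz error,
      and the cell has volume \<open>?V\<close>.\<close>
    have w_ge: "?V * (\<rho> (x - z) - L * (2 * ?d * h)) \<le> w (x - latt h z)" for z
    proof -
      let ?p = "x - latt h z"
      have p: "latt h ?p = ?p" using h x by (intro latt_diff) auto
      let ?c = "\<rho> (x - z) - L * (2 * ?d * h)"
      have iI: "integrable lebesgue (\<lambda>z. indicator (cell h ?p) z :: real)"
        using cell_lmeasurable[OF h p] fmeasurableD2[OF cell_lmeasurable[OF h p]]
        by (intro integrable_real_indicator) (auto simp: fmeasurableD less_top[symmetric] simp del: emeasure_completion)
      have L0: "L \<ge> 0" using order_trans[OF abs_ge_zero L[of "axis undefined 1" 0]] by (simp add: norm_axis_1)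
      have "(LINT y|lebesgue. ?c * indicator (cell h ?p) y) \<le> w ?p"
        unfolding w_def
      proof (intro integral_mono integrable_mult_right iI integrable_indicator_cell i\<rho>)
        fix y
        show "?c * indicator (cell h ?p) y \<le> \<rho> y * indicator (cell h ?p) y"
        proof (cases "y \<in> cell h ?p")
          case True
          have "dist (x - z) y = norm ((y - latt h y) + (z - latt h z))"
            using True by (simp add: cell_def dist_norm norm_minus_commute algebra_simps)
          also have "\<dots> \<le> 2 * ?d * h"
            using norm_triangle_ineq[of "y - latt h y" "z - latt h z"] norm_diff_latt_le[OF h, of y] norm_diff_latt_le[OF h, of z]
            by simp
          finally have "L * dist (x - z) y \<le> L * (2 * ?d * h)" using L0 by (intro mult_left_mono) auto
          then have "?c \<le> \<rho> y" using L[of "x - z" y] by (simp add: abs_le_iff)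
          then show ?thesis using True by simp
        qed simp
      qed
      then show ?thesis by (simp add: measure_cell[OF h p] mult.commute)
    qed
    note Lq = conv_Lipschitz_pointwise(1)[OF \<rho>(1) L q(3) q(1)]
    let ?A = "L * (2 * ?d * h)"
    have "?V * (conv \<rho> q x - ?A * (LINT z|lebesgue. q z)) = (LINT z|lebesgue. ?V * (\<rho> (x - z) * q z - ?A * q z))"
      using Lq q(3) by (simp add: conv_def)
    also have "\<dots> \<le> (LINT z|lebesgue. q z * w (x - latt h z))"
    proof (intro integral_mono integrable_mult_right Bochner_Integration.integrable_diff Lq q(3)
        integral_latt_decompose(1)[OF h q(3) q(2), where \<phi>="\<lambda>p. w (x - p)"])
      fix z
      show "?V * (\<rho> (x - z) * q z - ?A * q z) \<le> q z * w (x - latt h z)"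
        using mult_left_mono[OF w_ge[of z] q(1)[of z]] by (simp add: algebra_simps)
    qed
    also have "\<dots> = (\<Sum>y\<in>?P. M y * w (x - y))"
      unfolding M_def by (rule integral_latt_decompose(2)[OF h q(3) q(2)])
    also have "\<dots> = (\<Sum>p\<in>(\<lambda>y. x - y) ` ?P. w p * M (x - p))"
      by (subst sum.reindex) (auto simp: inj_on_def mult.commute)
    \<comment> \<open>The index set is exchanged by way of the union: \<open>M\<close> vanishes off
      \<open>?P\<close> and \<open>w\<close> vanishes off \<open>?F\<close>.\<close>
    also have "\<dots> = (\<Sum>p\<in>?F \<union> (\<lambda>y. x - y) ` ?P. w p * M (x - p))"
    proof (rule sum.mono_neutral_left)
      show "\<forall>p\<in>?F \<union> (\<lambda>y. x - y) ` ?P - (\<lambda>y. x - y) ` ?P. w p * M (x - p) = 0"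
      proof
        fix p assume "p \<in> ?F \<union> (\<lambda>y. x - y) ` ?P - (\<lambda>y. x - y) ` ?P"
        then have "x - p \<notin> ?P" using image_eqI[of p "\<lambda>y. x - y" "x - p" ?P] by auto
        then show "w p * M (x - p) = 0" using MP by simp
      qed
    qed (use fin in auto)
    also have "\<dots> = (\<Sum>p\<in>?F. w p * M (x - p))"
      using fin wF by (intro sum.mono_neutral_right) auto
    finally have *: "?V * (conv \<rho> q x - ?A * (LINT z|lebesgue. q z)) \<le> (\<Sum>p\<in>?F. w p * M (x - p))" .
    \<comment> \<open>The factor \<open>h / ?V\<close> turns the cell mass \<open>M\<close> into the
      quantity bounded by Jensen's inequality.\<close>
    have "h * (conv \<rho> q x - ?A * (LINT z|lebesgue. q z)) = (h / ?V) * (?V * (conv \<rho> q x - ?A * (LINT z|lebesgue. q z)))"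
      using h by simp
    also have "\<dots> \<le> (h / ?V) * (\<Sum>p\<in>?F. w p * M (x - p))" using * h by (intro mult_left_mono) auto
    also have "\<dots> = (\<Sum>p\<in>?F. w p * (M (x - p) * h / ?V))" by (simp add: sum_distrib_left mult_ac)
    also have "\<dots> \<le> (\<Sum>p\<in>?F. w p * root ?d (measure lebesgue (subdiff R u (x - p))))"
    proof (intro sum_mono mult_left_mono w0)
      fix p assume "p \<in> ?F"
      then have "latt h (x - p) = x - p" using h x by (intro latt_diff) auto
      from root_integral_power_cell_ge[OF h this q(1) q(3,4)]
      have "M (x - p) * h / ?V \<le> root ?d (m (x - p))" by (simp add: M_def m_def)
      also have "\<dots> \<le> root ?d (measure lebesgue (subdiff R u (x - p)))" using um by simp
      finally show "M (x - p) * h / ?V \<le> root ?d (measure lebesgue (subdiff R u (x - p)))" .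
    qed
    also have "\<dots> \<le> root ?d (measure lebesgue (subdiff R U x))" by (rule cc(2))
    finally show ?thesis .
  qed
  show ?thesis using u0 une cc(1) close lower by blast
qed

section \<open>Passage to the limit of vanishing mesh\<close>

lemma Lipschitz_pointwise_subsequence:
  fixes f :: "nat \<Rightarrow> 'a::euclidean_space \<Rightarrow> real"
  assumes L: "\<And>n x y. \<bar>f n x - f n y\<bar> \<le> R * dist x y" and f0: "\<And>n. f n 0 = 0" and "R \<ge> 0"
  shows "\<exists>\<phi> :: nat \<Rightarrow> nat. \<exists>g. strict_mono \<phi> \<and> (\<forall>x. (\<lambda>n. f (\<phi> n) x) \<longlonglongrightarrow> g x)"
proof -
  obtain D :: "'a set" where D: "countable D" "\<And>X. open X \<Longrightarrow> X \<noteq> {} \<Longrightarrow> \<exists>d\<in>D. d \<in> X"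
    by (rule countable_dense_setE) blast
  have "D \<noteq> {}" using D(2)[of UNIV] by auto
  define s where "s = from_nat_into D"
  have sD: "range s = D" unfolding s_def using \<open>D \<noteq> {}\<close> D(1) by (rule range_from_nat_into)
  \<comment> \<open>On a countable dense set the values lie in a product of compact intervals, whose
    sequential compactness replaces a diagonal argument. The common Lipschitz bound carries
    convergence to all points.\<close>
  let ?C = "{a :: nat \<Rightarrow> real. \<forall>i. a i \<in> {- (R * norm (s i))..R * norm (s i)}}"
  have "compact ?C" by (rule compact_function_box) auto
  then have sc: "seq_compact ?C" by (rule compact_imp_seq_compact)
  have mem: "\<forall>n. (\<lambda>i. f n (s i)) \<in> ?C"
    using L[of _ _ 0] f0 by (simp add: abs_le_iff) (smt (verit, best))
  from sc[unfolded seq_compact_def, THEN spec[of _ "\<lambda>n i. f n (s i)"], THEN mp, OF mem]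
  obtain a \<phi> where a: "strict_mono \<phi>" "((\<lambda>n. (\<lambda>i. f n (s i))) \<circ> \<phi>) \<longlonglongrightarrow> a"
    by (elim bexE exE conjE) (rule that)
  have conv: "convergent (\<lambda>n. f (\<phi> n) (s i))" for i
  proof -
    have "isCont (\<lambda>b :: nat \<Rightarrow> real. b i) a"
    proof -
      have "continuous_on UNIV (\<lambda>b :: nat \<Rightarrow> real. b i)" by (rule continuous_on_product_coordinates)
      then show ?thesis by (simp add: continuous_on_eq_continuous_within)
    qed
    then have "(\<lambda>n. (((\<lambda>n. (\<lambda>i. f n (s i))) \<circ> \<phi>) n) i) \<longlonglongrightarrow> a i"
      using a(2) by (rule isCont_tendsto_compose)
    then show ?thesis by (auto simp: convergent_def)
  qed
  have "Cauchy (\<lambda>n. f (\<phi> n) x)" for x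
  proof (rule metric_CauchyI)
    fix e :: real assume e: "e > 0"
    define \<delta> where "\<delta> = e / (3 * (R + 1))"
    have \<delta>: "\<delta> > 0" "R * \<delta> < e / 3"
    proof -
      show "\<delta> > 0" using e assms(3) by (simp add: \<delta>_def)
      have "R * \<delta> = e / 3 * (R / (R + 1))" using assms(3) by (simp add: \<delta>_def field_simps)
      also have "\<dots> < e / 3 * 1" using e assms(3) by (intro mult_strict_left_mono) auto
      finally show "R * \<delta> < e / 3" by simp
    qed
    obtain y where y: "y \<in> D" "y \<in> ball x \<delta>" using D(2)[of "ball x \<delta>"] \<delta> by auto
    obtain i where i: "y = s i" using y(1) sD by auto
    have "Cauchy (\<lambda>n. f (\<phi> n) (s i))" using conv by (simp add: Cauchy_convergent_iff)
    then obtain N where N: "\<And>m n. m \<ge> N \<Longrightarrow> n \<ge> N \<Longrightarrow> dist (f (\<phi> m) y) (f (\<phi> n) y) < e / 3"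
      using e unfolding i by (meson divide_pos_pos metric_CauchyD zero_less_numeral)
    have near: "\<bar>f n x - f n y\<bar> < e / 3" for n
    proof -
      have "\<bar>f n x - f n y\<bar> \<le> R * dist x y" by (rule L)
      also have "\<dots> \<le> R * \<delta>" using y(2) assms(3) by (intro mult_left_mono) auto
      finally show ?thesis using \<delta>(2) by linarith
    qed
    show "\<exists>N. \<forall>m\<ge>N. \<forall>n\<ge>N. dist (f (\<phi> m) x) (f (\<phi> n) x) < e"
    proof (intro exI[of _ N] allI impI)
      fix m n assume "m \<ge> N" "n \<ge> N"
      from N[OF this] near[of "\<phi> m"] near[of "\<phi> n"] show "dist (f (\<phi> m) x) (f (\<phi> n) x) < e"
        unfolding dist_real_def by linarith
    qed
  qed
  then have "\<forall>x. \<exists>l. (\<lambda>n. f (\<phi> n) x) \<longlonglongrightarrow> l" by (simp add: Cauchy_convergent_iff convergent_def)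
  then obtain g where "\<forall>x. (\<lambda>n. f (\<phi> n) x) \<longlonglongrightarrow> g x" by (rule choice[THEN exE])
  then show ?thesis using a(1) by blast
qed

text \<open>The bound \<open>R\<close> on the slopes pays off here: subgradients at \<open>x\<close>
  accumulate in the compact ball, and the defining inequalities pass to the limit.\<close>

lemma subdiff_limit_nonempty:
  fixes f :: "nat \<Rightarrow> 'a::euclidean_space \<Rightarrow> real"
  assumes ne: "\<And>n x. subdiff R (f n) x \<noteq> {}" and lim: "\<And>x. (\<lambda>n. f n x) \<longlonglongrightarrow> g x"
  shows "subdiff R g x \<noteq> {}"
proof -
  have "\<forall>n. \<exists>p. p \<in> subdiff R (f n) x" using ne by blast
  then obtain p where p: "\<forall>n. p n \<in> subdiff R (f n) x" by (rule choice[THEN exE])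
  then have "\<forall>n. p n \<in> cball 0 R" by (simp add: subdiff_def)
  then obtain l \<phi> where l: "l \<in> cball 0 R" "strict_mono \<phi>" "(p \<circ> \<phi>) \<longlonglongrightarrow> l"
    using compact_cball[of "0::'a" R] unfolding compact_def by blast
  have "g x + l \<bullet> (z - x) \<le> g z" for z
  proof (rule LIMSEQ_le)
    show "(\<lambda>n. f (\<phi> n) x + p (\<phi> n) \<bullet> (z - x)) \<longlonglongrightarrow> g x + l \<bullet> (z - x)"
      using LIMSEQ_subseq_LIMSEQ[OF lim l(2)] l(3) by (intro tendsto_intros) (simp_all add: o_def)
    show "(\<lambda>n. f (\<phi> n) z) \<longlonglongrightarrow> g z"
      using LIMSEQ_subseq_LIMSEQ[OF lim l(2)] by (simp add: o_def)
    show "\<exists>N. \<forall>n\<ge>N. f (\<phi> n) x + p (\<phi> n) \<bullet> (z - x) \<le> f (\<phi> n) z"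
      using p by (simp add: subdiff_def)
  qed
  then show ?thesis using l(1) unfolding subdiff_def by blast
qed

lemma conv_pointwise_limit:
  fixes f :: "nat \<Rightarrow> 'a::euclidean_space \<Rightarrow> real"
  assumes \<rho>: "csmooth \<rho>" "\<And>x. 0 \<le> \<rho> x" and ne: "\<And>n x. subdiff R (f n) x \<noteq> {}" "\<And>x. subdiff R g x \<noteq> {}"
    and f0: "\<And>n. f n 0 = 0" and lim: "\<And>x. (\<lambda>n. f n x) \<longlonglongrightarrow> g x"
  shows "(\<lambda>n. conv \<rho> (f n) x) \<longlonglongrightarrow> conv \<rho> g x"
proof -
  have R: "R \<ge> 0" using ne(2)[of 0] by (auto simp: subdiff_def intro: order_trans[OF norm_ge_zero])
  have cont: "continuous_on UNIV k" if "\<And>x. subdiff R k x \<noteq> {}" for k :: "'a \<Rightarrow> real"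
    using subdiff_nonempty_imp_Lipschitz[OF that] R
    by (intro lipschitz_on_continuous_on[of R] lipschitz_onI) (auto simp: dist_real_def)
  have "(\<lambda>n. LINT z|lebesgue. \<rho> z * f n (x - z)) \<longlonglongrightarrow> (LINT z|lebesgue. \<rho> z * g (x - z))"
  \<comment> \<open>The dominating function comes from the Lipschitz bound together with
    \<open>f n 0 = 0\<close>.\<close>
  proof (rule integral_dominated_convergence[where w="\<lambda>z. \<rho> z * (R * norm (x - z))"])
    show "(\<lambda>z. \<rho> z * g (x - z)) \<in> borel_measurable lebesgue"
      using integrable_conv(2)[OF \<rho>(1) cont[OF ne(2)]] by (rule borel_measurable_integrable)
    show "(\<lambda>z. \<rho> z * f n (x - z)) \<in> borel_measurable lebesgue" for n
      using integrable_conv(2)[OF \<rho>(1) cont[OF ne(1)]] by (rule borel_measurable_integrable)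
    show "integrable lebesgue (\<lambda>z. \<rho> z * (R * norm (x - z)))"
      by (rule integrable_conv(2)[OF \<rho>(1), of "\<lambda>y. R * norm y"]) (intro continuous_intros)
    show "AE z in lebesgue. (\<lambda>n. \<rho> z * f n (x - z)) \<longlonglongrightarrow> \<rho> z * g (x - z)"
      by (intro AE_I2 tendsto_mult_left lim)
    show "AE z in lebesgue. norm (\<rho> z * f n (x - z)) \<le> \<rho> z * (R * norm (x - z))" for n
    proof (rule AE_I2)
      fix z
      have "\<bar>f n (x - z)\<bar> \<le> R * norm (x - z)"
        using subdiff_nonempty_imp_Lipschitz[OF ne(1), of n "x - z" 0] f0 by simp
      then show "norm (\<rho> z * f n (x - z)) \<le> \<rho> z * (R * norm (x - z))"
        using \<rho>(2)[of z] by (simp add: abs_mult mult_left_mono)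
    qed
  qed
  then show ?thesis unfolding conv_flip[OF \<rho>(1) cont[OF ne(1)]] conv_flip[OF \<rho>(1) cont[OF ne(2)]] .
qed

text \<open>The base points accumulate in the compact set \<open>E\<close>, and in the limit
  \<open>p\<close> becomes a subgradient of \<open>W\<close> there. A smooth convex function has
  only its gradient as subgradient.\<close>

lemma (in convex_mollified) limit_subgradient:
  assumes V: "\<And>n x. subdiff R (V n) x \<noteq> {}" "\<And>x. (\<lambda>n. V n x) \<longlonglongrightarrow> W x"
    and E: "compact E" and p: "\<forall>m. \<exists>n\<ge>m. \<exists>x\<in>E. p \<in> subdiff R (V n) x"
  shows "p \<in> G ` E"
proof -
  have "\<forall>m. \<exists>a. fst a \<ge> m \<and> snd a \<in> E \<and> p \<in> subdiff R (V (fst a)) (snd a)" using p by force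
  then obtain a where a: "\<forall>m. fst (a m) \<ge> m \<and> snd (a m) \<in> E \<and> p \<in> subdiff R (V (fst (a m))) (snd (a m))"
    by (rule choice[THEN exE])
  define N X where "N m = fst (a m)" and "X m = snd (a m)" for m
  have NX: "N m \<ge> m" "X m \<in> E" "p \<in> subdiff R (V (N m)) (X m)" for m using a by (auto simp: N_def X_def)
  have "\<forall>m. X m \<in> E" using NX by blast
  then obtain x \<sigma> where x: "x \<in> E" "strict_mono \<sigma>" "(X \<circ> \<sigma>) \<longlonglongrightarrow> x"
    using E unfolding compact_def by blast
  have "filterlim (\<lambda>k. N (\<sigma> k)) sequentially sequentially"
  proof (rule filterlim_at_top_mono[OF filterlim_ident])
    show "\<forall>\<^sub>F k in sequentially. k \<le> N (\<sigma> k)"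
      using NX(1) seq_suble[OF x(2)] by (intro always_eventually allI) (meson order_trans)
  qed
  then have VN: "(\<lambda>k. V (N (\<sigma> k)) z) \<longlonglongrightarrow> W z" for z by (rule filterlim_compose[OF V(2)])
  have "W x + p \<bullet> (z - x) \<le> W z" for z
  proof (rule LIMSEQ_le)
    have "(\<lambda>k. R * dist (X (\<sigma> k)) x) \<longlonglongrightarrow> R * dist x x"
      using x(3) by (intro tendsto_intros) (simp add: o_def)
    then have 0: "(\<lambda>k. R * dist (X (\<sigma> k)) x) \<longlonglongrightarrow> 0" by simp
    \<comment> \<open>Convergence of \<open>V\<close> is known pointwise only; the term with
      \<open>R\<close> pays for replacing the moving point \<open>X (\<sigma> k)\<close> by
      \<open>x\<close>.\<close>
    show "(\<lambda>k. V (N (\<sigma> k)) x - R * dist (X (\<sigma> k)) x + p \<bullet> (z - X (\<sigma> k))) \<longlonglongrightarrow> W x + p \<bullet> (z - x)"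
      using tendsto_add[OF tendsto_diff[OF VN[of x] 0] tendsto_inner[OF tendsto_const tendsto_diff[OF tendsto_const x(3)[unfolded o_def]]], of p z]
      by simp
    show "(\<lambda>k. V (N (\<sigma> k)) z) \<longlonglongrightarrow> W z" by (rule VN)
    show "\<exists>K. \<forall>k\<ge>K. V (N (\<sigma> k)) x - R * dist (X (\<sigma> k)) x + p \<bullet> (z - X (\<sigma> k)) \<le> V (N (\<sigma> k)) z"
    proof (intro exI allI impI)
      fix k
      have "V (N (\<sigma> k)) (X (\<sigma> k)) + p \<bullet> (z - X (\<sigma> k)) \<le> V (N (\<sigma> k)) z"
        using NX(3)[of "\<sigma> k"] by (simp add: subdiff_def)
      moreover have "V (N (\<sigma> k)) x - R * dist (X (\<sigma> k)) x \<le> V (N (\<sigma> k)) (X (\<sigma> k))"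
        using subdiff_nonempty_imp_Lipschitz[OF V(1), of "N (\<sigma> k)" x "X (\<sigma> k)"] by (simp add: abs_le_iff dist_commute)
      ultimately show "V (N (\<sigma> k)) x - R * dist (X (\<sigma> k)) x + p \<bullet> (z - X (\<sigma> k)) \<le> V (N (\<sigma> k)) z" by linarith
    qed
  qed
  then have "p = G x" by (rule subgradient_W_eq)
  then show ?thesis using x(1) by blast
qed

text \<open>The two subgradient inequalities add up to an equality, which places \<open>p\<close> on
  a hyperplane.\<close>

lemma negligible_subdiff_Int:
  fixes U :: "'a::euclidean_space \<Rightarrow> real"
  assumes "x \<noteq> y" shows "negligible (subdiff R U x \<inter> subdiff R U y)"
proof (rule negligible_subset)
  show "negligible {p. (y - x) \<bullet> p = U y - U x}" using assms by (intro negligible_hyperplane) auto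
  show "subdiff R U x \<inter> subdiff R U y \<subseteq> {p. (y - x) \<bullet> p = U y - U x}"
  proof
    fix p assume "p \<in> subdiff R U x \<inter> subdiff R U y"
    then have "U x + p \<bullet> (y - x) \<le> U y" "U y + p \<bullet> (x - y) \<le> U x" by (auto simp: subdiff_def)
    then show "p \<in> {p. (y - x) \<bullet> p = U y - U x}" by (simp add: inner_diff_right inner_diff_left inner_commute)
  qed
qed

text \<open>Each lattice point contributes at least \<open>b\<close> times the volume of its cell,
  and the contributions overlap in null sets. The cells cover the ball whose radius is smaller by
  \<open>CARD('d) * h\<close>, the largest rounding error.\<close>

lemma measure_union_subdiff_ge:
  fixes U :: "real^'d::finite \<Rightarrow> real" and h :: real
  assumes h: "h > 0" and b: "b \<ge> 0"
    and ge: "\<And>x. x \<in> cball x0 e \<Longrightarrow> latt h x = x \<Longrightarrow> h ^ CARD('d) * b \<le> measure lebesgue (subdiff R U x)"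
  defines "S \<equiv> \<Union>x\<in>{x \<in> cball x0 e. latt h x = x}. subdiff R U x"
  shows "S \<in> lmeasurable" "b * measure lebesgue (cball x0 (e - CARD('d) * h)) \<le> measure lebesgue S"
proof -
  let ?X = "{x \<in> cball x0 e. latt h x = x}"
  have "?X \<subseteq> latt h ` cball 0 (norm x0 + e)"
  proof
    fix x assume x: "x \<in> ?X"
    then have "norm x \<le> norm x0 + e" using norm_triangle_ineq3[of x x0] by (auto simp: dist_norm norm_minus_commute)
    then show "x \<in> latt h ` cball 0 (norm x0 + e)" using x by (intro image_eqI[of x "latt h" x]) auto
  qed
  then have fin: "finite ?X" using finite_latt_image[OF h] finite_subset by blast
  have m: "subdiff R U x \<in> lmeasurable" for x by (intro lmeasurable_compact compact_subdiff)
  show "S \<in> lmeasurable" unfolding S_def using fin m by (intro fmeasurable.finite_UN) auto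
  have cells: "cell h x \<in> lmeasurable" if "x \<in> ?X" for x using that h by (intro cell_lmeasurable) auto
  have "measure lebesgue (cball x0 (e - CARD('d) * h)) \<le> measure lebesgue (\<Union>x\<in>?X. cell h x)"
  proof (rule measure_mono_fmeasurable)
    show "(\<Union>x\<in>?X. cell h x) \<in> lmeasurable" using fin cells by (intro fmeasurable.finite_UN) auto
    show "cball x0 (e - CARD('d) * h) \<subseteq> (\<Union>x\<in>?X. cell h x)"
    proof
      fix z assume z: "z \<in> cball x0 (e - CARD('d) * h)"
      have "dist x0 (latt h z) \<le> dist x0 z + dist z (latt h z)" by (rule dist_triangle)
      also have "\<dots> \<le> e" using z norm_diff_latt_le[OF h, of z] by (simp add: dist_norm)
      finally have "latt h z \<in> ?X" using h by simp
      then show "z \<in> (\<Union>x\<in>?X. cell h x)" by (intro UN_I[of "latt h z"]) (auto simp: cell_def)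
    qed
  qed auto
  also have "\<dots> \<le> (\<Sum>x\<in>?X. measure lebesgue (cell h x))"
    using fin cells by (intro measure_UNION_le) (auto simp: fmeasurableD)
  also have "\<dots> = (\<Sum>x\<in>?X. h ^ CARD('d))" using h by (intro sum.cong refl measure_cell) auto
  finally have "b * measure lebesgue (cball x0 (e - CARD('d) * h)) \<le> b * (\<Sum>x\<in>?X. h ^ CARD('d))"
    using b by (intro mult_left_mono) auto
  also have "\<dots> = (\<Sum>x\<in>?X. h ^ CARD('d) * b)" by (simp only: sum_distrib_left mult.commute)
  also have "\<dots> \<le> (\<Sum>x\<in>?X. measure lebesgue (subdiff R U x))" using ge by (intro sum_mono) auto
  also have "\<dots> = measure lebesgue S"
    unfolding S_def
    by (rule measure_negligible_finite_Union_image[OF fin, symmetric]) (auto simp: m pairwise_def negligible_subdiff_Int)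
  finally show "b * measure lebesgue (cball x0 (e - CARD('d) * h)) \<le> measure lebesgue S" .
qed

text \<open>
  If the determinant were smaller at some point, it would be smaller on a ball around it, so the gradient image of
  the ball would be too small to contain the limits of the subgradients supplied by the lattice problems.
\<close>

theorem mollified_Alexandrov:
  fixes \<rho> q :: "real^'d::finite \<Rightarrow> real" and R r :: real
  assumes rho: "csmooth \<rho>" "\<And>x. 0 \<le> \<rho> x" "(LINT z|lebesgue. \<rho> z) = 1"
    and \<rho>_sym: "\<And>x v w. frechet_derivative (\<lambda>y. frechet_derivative \<rho> (at y) v) (at x) w =
      frechet_derivative (\<lambda>y. frechet_derivative \<rho> (at y) w) (at x) v"
    and q: "\<And>x. 0 \<le> q x" "\<And>x. r < norm x \<Longrightarrow> q x = 0"
      "integrable lebesgue q" "integrable lebesgue (\<lambda>x. q x ^ CARD('d))"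
    and R: "R > 0" "(LINT x|lebesgue. q x ^ CARD('d)) = measure lebesgue (cball (0::real^'d) R)"
  shows "\<exists>u. convex_mollified \<rho> u R \<and> (\<forall>x. conv \<rho> q x ^ CARD('d) \<le> det (convex_mollified.H \<rho> u x))"
proof -
  let ?d = "CARD('d)" and ?I = "LINT z|lebesgue. q z"
  obtain L where L: "\<And>x y. \<bar>\<rho> x - \<rho> y\<bar> \<le> L * dist x y" using csmooth_Lipschitz[OF rho(1)] by blast
  have L0: "L \<ge> 0" using order_trans[OF abs_ge_zero L[of "axis undefined 1" 0]] by (simp add: norm_axis_1)
  have I0: "?I \<ge> 0" using q(1) by (intro integral_nonneg_AE) auto
  define P where "P h u U \<longleftrightarrow> u 0 = 0 \<and> (\<forall>x. subdiff R u x \<noteq> {}) \<and> (\<forall>x. subdiff R U x \<noteq> {}) \<and>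
     (\<forall>x. \<bar>U x - conv \<rho> u x\<bar> \<le> R * (?d * h)) \<and>
     (\<forall>x. latt h x = x \<longrightarrow> h * (conv \<rho> q x - L * (2 * ?d * h) * ?I) \<le> root ?d (measure lebesgue (subdiff R U x)))"
    for h :: real and u U :: "real^'d \<Rightarrow> real"
  have "\<forall>n. \<exists>a. P (inverse (real (Suc n))) (fst a) (snd a)"
  proof
    fix n
    have "inverse (real (Suc n)) > 0" by simp
    from exists_lattice_potential[OF rho L q R this] show "\<exists>a. P (inverse (real (Suc n))) (fst a) (snd a)"
      unfolding P_def by auto
  qed
  then obtain a where a: "\<forall>n. P (inverse (real (Suc n))) (fst (a n)) (snd (a n))" by (rule choice[THEN exE])
  define u' U' where "u' n = fst (a n)" and "U' n = snd (a n)" for n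
  have P': "P (inverse (real (Suc n))) (u' n) (U' n)" for n using a by (simp add: u'_def U'_def)
  have u'ne: "subdiff R (u' n) x \<noteq> {}" and u'0: "u' n 0 = 0" for n x using P'[of n] by (simp_all add: P_def)
  have "\<exists>\<phi> :: nat \<Rightarrow> nat. \<exists>g. strict_mono \<phi> \<and> (\<forall>x. (\<lambda>n. u' (\<phi> n) x) \<longlonglongrightarrow> g x)"
    using R by (intro Lipschitz_pointwise_subsequence[of _ R] subdiff_nonempty_imp_Lipschitz u'ne u'0) auto
  then obtain \<phi> u where \<phi>: "strict_mono \<phi>" and ulim: "\<And>x. (\<lambda>n. u' (\<phi> n) x) \<longlonglongrightarrow> u x" by blast
  have une: "subdiff R u x \<noteq> {}" for x using u'ne ulim by (rule subdiff_limit_nonempty[of R "\<lambda>n. u' (\<phi> n)"])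
  interpret convex_mollified \<rho> u R
    by unfold_locales (use rho \<rho>_sym une in auto)
  define h where "h n = inverse (real (Suc (\<phi> n)))" for n
  have h0: "h n > 0" for n by (simp add: h_def)
  have hlim: "h \<longlonglongrightarrow> 0"
    using LIMSEQ_subseq_LIMSEQ[OF LIMSEQ_inverse_real_of_nat \<phi>] unfolding h_def o_def .
  define V where "V n = U' (\<phi> n)" for n
  have PV: "P (h n) (u' (\<phi> n)) (V n)" for n unfolding h_def V_def by (rule P')
  have Vne: "subdiff R (V n) x \<noteq> {}"
    and Vclose: "\<bar>V n x - conv \<rho> (u' (\<phi> n)) x\<bar> \<le> R * (?d * h n)"
    and Vlower: "latt (h n) x = x \<Longrightarrow> h n * (conv \<rho> q x - L * (2 * ?d * h n) * ?I) \<le> root ?d (measure lebesgue (subdiff R (V n) x))"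
    for n x using PV[of n] unfolding P_def by blast+
  have Vlim: "(\<lambda>n. V n x) \<longlonglongrightarrow> W x" for x
  proof -
    have c: "(\<lambda>n. conv \<rho> (u' (\<phi> n)) x) \<longlonglongrightarrow> W x"
      unfolding W_def by (rule conv_pointwise_limit[OF rho(1,2), where f="\<lambda>n. u' (\<phi> n)" and R=R]) (rule u'ne une u'0 ulim)+
    have "(\<lambda>n. R * (?d * h n)) \<longlonglongrightarrow> R * (real ?d * 0)" by (intro tendsto_intros hlim)
    then have "(\<lambda>n. V n x - conv \<rho> (u' (\<phi> n)) x) \<longlonglongrightarrow> 0"
    proof -
      assume l: "(\<lambda>n. R * (?d * h n)) \<longlonglongrightarrow> R * (real ?d * 0)"
      show ?thesis
      proof (rule Lim_null_comparison)
        show "\<forall>\<^sub>F n in sequentially. norm (V n x - conv \<rho> (u' (\<phi> n)) x) \<le> R * (?d * h n)"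
          unfolding real_norm_def by (rule always_eventually) (rule allI, rule Vclose)
        show "(\<lambda>n. R * (?d * h n)) \<longlonglongrightarrow> 0" using l by simp
      qed
    qed
    from tendsto_add[OF this c] show ?thesis by simp
  qed
  have "conv \<rho> q x0 ^ ?d \<le> det (H x0)" for x0
  proof (rule ccontr)
    assume "\<not> conv \<rho> q x0 ^ ?d \<le> det (H x0)"
    then have lt: "det (H x0) < conv \<rho> q x0 ^ ?d" by simp
    define \<kappa> where "\<kappa> = conv \<rho> q x0"
    have \<kappa>0: "\<kappa> \<ge> 0" unfolding \<kappa>_def conv_def using rho(2) q(1) by (intro integral_nonneg_AE) auto
    \<comment> \<open>Two thresholds leave a gap: near \<open>x0\<close> the determinant stays below
      \<open>b1\<close>, while the lattice subdifferentials have volume density at least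
      \<open>b2\<close>.\<close>
    obtain b1 where b1: "det (H x0) < b1" "b1 < \<kappa> ^ ?d" using dense[OF lt] by (auto simp: \<kappa>_def)
    obtain b2 where b2: "b1 < b2" "b2 < \<kappa> ^ ?d" using dense[OF b1(2)] by auto
    have det0: "det (H x) \<ge> 0" for x by (rule sym_psd_det_nonneg[OF sym_psd_H])
    have b2pos: "b2 > 0" "b1 > 0" using det0[of x0] b1 b2 by linarith+
    define \<beta> where "\<beta> = root ?d b2"
    have \<beta>: "\<beta> \<ge> 0" "\<beta> ^ ?d = b2" using b2pos by (simp_all add: \<beta>_def)
    have "\<beta> < \<kappa>"
    proof -
      have "root ?d b2 < root ?d (\<kappa> ^ ?d)" using b2(2) by simp
      then show ?thesis using \<kappa>0 by (simp add: \<beta>_def real_root_power_cancel)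
    qed
    have "continuous_on UNIV (\<lambda>x. det (H x))" unfolding det_def by (intro continuous_intros continuous_H)
    then have o1: "open {x. det (H x) < b1}" by (intro open_Collect_less continuous_on_const)
    obtain e1 where e1: "e1 > 0" "ball x0 e1 \<subseteq> {x. det (H x) < b1}"
      using o1 b1(1) unfolding open_contains_ball by blast
    \<comment> \<open>The first bound keeps the determinant below \<open>b1\<close> on the ball. By
      the Lipschitz bound, the second keeps \<open>conv \<rho> q\<close> above the midpoint of
      \<open>\<beta>\<close> and \<open>\<kappa>\<close>, which leaves
      \<open>(\<kappa> - \<beta>) / 2\<close> for the lattice error.\<close>
    define e where "e = min (e1 / 2) ((\<kappa> - \<beta>) / (2 * (L * ?I + 1)))"
    have LI: "L * ?I + 1 > 0" using L0 I0 by (simp add: add_nonneg_pos)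
    have e: "e > 0" using e1 \<open>\<beta> < \<kappa>\<close> LI by (simp add: e_def)
    have detE: "det (H x) \<le> b1" if "x \<in> cball x0 e" for x
    proof -
      have "x \<in> ball x0 e1" using that e1(1) by (auto simp: e_def)
      then show ?thesis using e1(2) by auto
    qed
    have convE: "conv \<rho> q x \<ge> (\<kappa> + \<beta>) / 2" if "x \<in> cball x0 e" for x
    proof -
      have "\<kappa> - conv \<rho> q x \<le> L * dist x0 x * ?I"
        using conv_Lipschitz_pointwise(2)[OF rho(1) L q(3,1), of x0 x] by (simp add: \<kappa>_def abs_le_iff)
      also have "\<dots> = dist x0 x * (L * ?I)" by simp
      also have "\<dots> \<le> e * (L * ?I + 1)" using that L0 I0 e by (intro mult_mono) auto
      also have "\<dots> \<le> (\<kappa> - \<beta>) / (2 * (L * ?I + 1)) * (L * ?I + 1)"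
        using LI by (intro mult_right_mono) (auto simp: e_def)
      also have "\<dots> = (\<kappa> - \<beta>) / 2"
      proof -
        have "a / (2 * K) * K = a / 2" if "K > 0" for a K :: real using that by simp
        then show ?thesis using LI by blast
      qed
      finally show ?thesis by (simp add: field_simps)
    qed
    define S where "S n = (\<Union>x\<in>{x \<in> cball x0 e. latt (h n) x = x}. subdiff R (V n) x)" for n
    have "(\<lambda>n. L * (2 * ?d * h n) * ?I) \<longlonglongrightarrow> L * (real (2 * ?d) * 0) * ?I" by (intro tendsto_intros hlim)
    then have "\<forall>\<^sub>F n in sequentially. L * (2 * ?d * h n) * ?I < (\<kappa> - \<beta>) / 2"
      using \<open>\<beta> < \<kappa>\<close> by (intro order_tendstoD(2)[of _ 0]) auto
    then obtain N where N: "\<And>n. n \<ge> N \<Longrightarrow> L * (2 * ?d * h n) * ?I < (\<kappa> - \<beta>) / 2"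
      by (auto simp: eventually_sequentially)
    have S: "S n \<in> lmeasurable" "b2 * measure lebesgue (cball x0 (e - ?d * h n)) \<le> measure lebesgue (S n)" if n: "n \<ge> N" for n
    proof -
      have ge: "h n ^ ?d * b2 \<le> measure lebesgue (subdiff R (V n) x)" if x: "x \<in> cball x0 e" "latt (h n) x = x" for x
      proof -
        have "h n * \<beta> \<le> h n * (conv \<rho> q x - L * (2 * ?d * h n) * ?I)"
          using N[OF n] convE[OF x(1)] h0[of n] by (intro mult_left_mono) auto
        also have "\<dots> \<le> root ?d (measure lebesgue (subdiff R (V n) x))" using x(2) by (rule Vlower)
        finally have "(h n * \<beta>) ^ ?d \<le> root ?d (measure lebesgue (subdiff R (V n) x)) ^ ?d"
          using h0[of n] \<beta>(1) by (intro power_mono) auto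
        then show ?thesis using \<beta>(2) by (simp add: power_mult_distrib)
      qed
      show "S n \<in> lmeasurable"
        unfolding S_def by (rule measure_union_subdiff_ge(1)[OF h0 less_imp_le[OF b2pos(1)]]) (rule ge)
      show "b2 * measure lebesgue (cball x0 (e - ?d * h n)) \<le> measure lebesgue (S n)"
        unfolding S_def by (rule measure_union_subdiff_ge(2)[OF h0 less_imp_le[OF b2pos(1)]]) (rule ge)
    qed
    \<comment> \<open>The tails decrease to the set of vectors lying in \<open>S n\<close> for
      infinitely many \<open>n\<close>. All of them lie in the ball of radius \<open>R\<close>, so
      continuity from above preserves the lower volume bound.\<close>
    define T where "T m = (\<Union>n\<in>{m + N..}. S n)" for m
    have T_sub: "T m \<subseteq> cball 0 R" for m by (auto simp: T_def S_def subdiff_def)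
    have T_sets: "T m \<in> sets lebesgue" for m
      unfolding T_def using S(1) by (intro sets.countable_UN') (auto simp: fmeasurableD)
    have T_meas: "T m \<in> lmeasurable" for m
      using T_sub T_sets bounded_cball bounded_subset by (intro bounded_set_imp_lmeasurable) blast+
    have T_ge: "b2 * measure lebesgue (cball x0 e) \<le> measure lebesgue (T m)" for m
    proof (rule LIMSEQ_le_const2)
      have cb: "measure lebesgue (cball x0 s) = unit_ball_vol ?d * s ^ ?d" if "s \<ge> 0" for s
        using content_cball[OF that, of x0] by simp
      have "(\<lambda>n. e - ?d * h n) \<longlonglongrightarrow> e - real ?d * 0" by (intro tendsto_intros hlim)
      then have el: "(\<lambda>n. e - ?d * h n) \<longlonglongrightarrow> e" by simp
      have "(\<lambda>n. b2 * (unit_ball_vol ?d * (e - ?d * h n) ^ ?d)) \<longlonglongrightarrow> b2 * (unit_ball_vol ?d * e ^ ?d)"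
        by (intro tendsto_intros el)
      moreover have "\<forall>\<^sub>F n in sequentially. b2 * (unit_ball_vol ?d * (e - ?d * h n) ^ ?d) = b2 * measure lebesgue (cball x0 (e - ?d * h n))"
        using order_tendstoD(1)[OF el e] by eventually_elim (subst cb, simp_all)
      ultimately show "(\<lambda>n. b2 * measure lebesgue (cball x0 (e - ?d * h n))) \<longlonglongrightarrow> b2 * measure lebesgue (cball x0 e)"
        unfolding cb[OF less_imp_le[OF e]] by (rule Lim_transform_eventually)
      show "\<exists>M. \<forall>n\<ge>M. b2 * measure lebesgue (cball x0 (e - ?d * h n)) \<le> measure lebesgue (T m)"
      proof (intro exI[of _ "m + N"] allI impI)
        fix n assume n: "m + N \<le> n"
        have "b2 * measure lebesgue (cball x0 (e - ?d * h n)) \<le> measure lebesgue (S n)" using n by (intro S(2)) simp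
        also have "\<dots> \<le> measure lebesgue (T m)"
          using n S(1)[of n] T_meas by (intro measure_mono_fmeasurable) (auto simp: T_def fmeasurableD)
        finally show "b2 * measure lebesgue (cball x0 (e - ?d * h n)) \<le> measure lebesgue (T m)" .
      qed
    qed
    have "(\<lambda>m. measure lebesgue (T m)) \<longlonglongrightarrow> measure lebesgue (\<Inter>m. T m)"
    proof (rule Lim_measure_decseq)
      show "range T \<subseteq> sets lebesgue" using T_sets by auto
      show "decseq T"
      proof (rule decseq_SucI)
        fix m
        have "{Suc m + N..} \<subseteq> {m + N..}" by auto
        then show "T (Suc m) \<subseteq> T m" unfolding T_def by (rule UN_mono) (rule order_refl)
      qed
      show "emeasure lebesgue (T m) \<noteq> \<infinity>" for m
        using fmeasurableD2[OF T_meas[of m]] by (simp only: infinity_ennreal_def not_False_eq_True)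
    qed
    then have "b2 * measure lebesgue (cball x0 e) \<le> measure lebesgue (\<Inter>m. T m)"
      using T_ge by (intro LIMSEQ_le_const) auto
    also have "\<dots> \<le> measure lebesgue (G ` cball x0 e)"
    proof (rule measure_mono_fmeasurable)
      show "(\<Inter>m. T m) \<subseteq> G ` cball x0 e"
      proof
        fix p assume p: "p \<in> (\<Inter>m. T m)"
        have "\<exists>n\<ge>m. \<exists>x\<in>cball x0 e. p \<in> subdiff R (V n) x" for m
        proof -
          have "p \<in> T m" using p by blast
          then obtain n where n: "n \<in> {m + N..}" "p \<in> S n" unfolding T_def by (rule UN_E)
          from n(2) obtain x where x: "x \<in> {x \<in> cball x0 e. latt (h n) x = x}" "p \<in> subdiff R (V n) x"
            unfolding S_def by (rule UN_E)
          have "x \<in> cball x0 e" using x(1) by simp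
          moreover have "m \<le> n" using n(1) by simp
          ultimately show ?thesis using x(2) by blast
        qed
        then show "p \<in> G ` cball x0 e" using limit_subgradient[OF Vne Vlim compact_cball] by blast
      qed
      show "(\<Inter>m. T m) \<in> sets lebesgue" using T_sets by (intro sets.countable_INT') auto
      show "G ` cball x0 e \<in> lmeasurable"
        using Ck_continuous[OF Ck_G[of 0]] by (intro lmeasurable_compact compact_continuous_image) auto
    qed
    \<comment> \<open>The gradient image has volume at most \<open>b1\<close> times that of the
      ball, against the lower bound with \<open>b2\<close>.\<close>
    also have "\<dots> \<le> b1 * measure lebesgue (cball x0 e)"
      using detE det0 continuous_H transpose_H
      by (intro measure_image_le_det_bound[where F=H] G_has_derivative) auto
    finally have "b2 * measure lebesgue (cball x0 e) \<le> b1 * measure lebesgue (cball x0 e)" .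
    moreover have "measure lebesgue (cball x0 e) > 0" using e by (simp add: content_cball_pos)
    ultimately show False using b2(1) by simp
  qed
  moreover have "convex_mollified \<rho> u R" by unfold_locales
  ultimately show ?thesis by blast
qed

section \<open>Explicit mollifiers\<close>

lemma integral_bump_pos: "s > 0 \<Longrightarrow> (LINT z|lebesgue. bump s (z :: 'a::euclidean_space)) > 0"
proof -
  assume s: "s > 0"
  have c: "continuous_on UNIV (bump s :: 'a \<Rightarrow> real)" using csmooth_bump[OF s] by (rule csmooth_continuous)
  have i: "integrable lebesgue (bump s :: 'a \<Rightarrow> real)"
    using integrable_conv(2)[OF csmooth_bump[OF s], of "\<lambda>_. 1" 0] by simp
  have nn: "0 \<le> (LINT z|lebesgue. bump s (z :: 'a))" by (intro integral_nonneg_AE) (simp add: bump_at_nonneg)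
  have "(LINT z|lebesgue. bump s (z :: 'a)) \<noteq> 0"
  proof
    assume "(LINT z|lebesgue. bump s (z :: 'a)) = 0"
    then have "AE z in lebesgue. bump s (z :: 'a) = 0"
      using integral_nonneg_eq_0_iff_AE[OF i] by (simp add: bump_at_nonneg)
    then have ae: "AE z in lebesgue. z \<notin> {z :: 'a. bump s z \<noteq> 0}" by simp
    have "open {z :: 'a. bump s z \<noteq> 0}" using c by (intro open_Collect_neq) auto
    then have "{z :: 'a. bump s z \<noteq> 0} \<in> sets lebesgue" by (intro sets_completionI_sets) simp
    from AE_iff_null_sets[OF this] ae have "{z :: 'a. bump s z \<noteq> 0} \<in> null_sets lebesgue" by blast
    then have "negligible {z :: 'a. bump s z \<noteq> 0}" by (simp add: negligible_iff_null_sets)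
    moreover have "open {z :: 'a. bump s z \<noteq> 0}" using c by (intro open_Collect_neq) auto
    moreover have "0 \<in> {z :: 'a. bump s z \<noteq> 0}" by (simp add: bump_0)
    ultimately show False using open_not_negligible by blast
  qed
  then show ?thesis using nn by simp
qed

text \<open>The bump normalised to integral 1, supported in the ball of radius
  \<open>1 / sqrt s\<close>; the later choice \<open>s = real (Suc k) ^ 2\<close> makes this radius
  \<open>1 / (k + 1)\<close>.\<close>

definition mollifier :: "real \<Rightarrow> 'a::euclidean_space \<Rightarrow> real" where
  "mollifier s x = inverse (LINT z|lebesgue. bump s (z :: 'a)) * bump s x"

lemma mollifier:
  fixes x :: "'a::euclidean_space"
  assumes s: "s > 0"
  shows "csmooth (mollifier s :: 'a \<Rightarrow> real)" "mollifier s x \<ge> 0" "(LINT z|lebesgue. mollifier s (z :: 'a)) = 1"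
    "norm x \<ge> 1 / sqrt s \<Longrightarrow> mollifier s x = 0"
  using integral_bump_pos[OF s, where 'a='a] csmooth_bump[OF s] bump_at_nonneg[of 0 s] bump_at_eq_0[OF s]
  by (auto simp: mollifier_def[abs_def] intro!: csmooth_mult_const mult_nonneg_nonneg)

text \<open>For a radial kernel, \<open>v\<close> and \<open>w\<close> enter the second derivative
  only through \<open>(x \<bullet> v) * (x \<bullet> w)\<close> and
  \<open>v \<bullet> w\<close>.\<close>

lemma mollifier_symmetric_derivative:
  "frechet_derivative (\<lambda>y. frechet_derivative (mollifier s) (at y) v) (at x) w =
   frechet_derivative (\<lambda>y. frechet_derivative (mollifier s) (at y) w) (at x) v"
proof -
  define k where "k = inverse (LINT z|lebesgue. bump s (z :: 'a))"
  have d1: "frechet_derivative (mollifier s) (at y) = (\<lambda>v. k * (bump_at 2 s y * (- 2 * s * (y \<bullet> v))))" for y :: 'a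
  proof -
    have "mollifier s = (\<lambda>x :: 'a. k * bump s x)" by (simp add: mollifier_def[abs_def] k_def)
    moreover have "((\<lambda>x :: 'a. k * bump s x) has_derivative (\<lambda>v. k * (bump_at 2 s y * (- 2 * s * (y \<bullet> v))))) (at y)"
      using has_derivative_mult_right[OF bump_at_has_derivative[of 0 s y], of k] by (simp add: numeral_2_eq_2)
    ultimately show ?thesis using frechet_derivative_at by metis
  qed
  have d2: "frechet_derivative (\<lambda>y. frechet_derivative (mollifier s) (at y) v) (at x) w =
      k * ((bump_at (2 + 2) s x - 2 * bump_at (2 + 1) s x) * (- 2 * s * (x \<bullet> w)) * (- 2 * s * (x \<bullet> v)) + bump_at 2 s x * (- 2 * s * (w \<bullet> v)))"
    for v w :: 'a
  proof -
    have "((\<lambda>y. - 2 * s * (y \<bullet> v)) has_derivative (\<lambda>w. - 2 * s * (w \<bullet> v))) (at x)"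
      by (auto intro!: derivative_eq_intros)
    from has_derivative_mult_right[OF has_derivative_mult[OF bump_at_has_derivative[of 2 s x] this], of k]
    have "((\<lambda>y. k * (bump_at 2 s y * (- 2 * s * (y \<bullet> v)))) has_derivative
      (\<lambda>w. k * (bump_at 2 s x * (- 2 * s * (w \<bullet> v)) + (bump_at (2 + 2) s x - real 2 * bump_at (2 + 1) s x) * (- 2 * s * (x \<bullet> w)) * (- 2 * s * (x \<bullet> v))))) (at x)" .
    from frechet_derivative_at[OF this, symmetric] show ?thesis unfolding d1 by (simp add: add.commute)
  qed
  show ?thesis unfolding d2 by (simp add: inner_commute mult_ac)
qed

lemma conv_mollifier_tendsto:
  fixes q :: "'a::euclidean_space \<Rightarrow> real"
  assumes q: "continuous_on UNIV q"
  shows "(\<lambda>k. conv (mollifier (real (Suc k) ^ 2)) q x) \<longlonglongrightarrow> q x"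
proof (rule LIMSEQ_I)
  fix e :: real assume e: "e > 0"
  have "isCont q x" using q by (simp add: continuous_on_eq_continuous_within)
  then obtain \<delta> where \<delta>: "\<delta> > 0" "\<And>y. dist y x < \<delta> \<Longrightarrow> dist (q y) (q x) < e / 2"
    using e unfolding continuous_at_eps_delta by (metis half_gt_zero)
  obtain N where N: "inverse (real (Suc N)) < \<delta>" using \<delta>(1) reals_Archimedean by blast
  show "\<exists>N. \<forall>k\<ge>N. norm (conv (mollifier (real (Suc k) ^ 2)) q x - q x) < e"
  proof (intro exI[of _ N] allI impI)
    fix k assume k: "k \<ge> N"
    let ?\<rho> = "mollifier (real (Suc k) ^ 2) :: 'a \<Rightarrow> real"
    have s: "real (Suc k) ^ 2 > 0" by simp
    note \<rho> = mollifier[OF s, where 'a='a]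
    have i\<rho>: "integrable lebesgue ?\<rho>" using integrable_conv(2)[OF \<rho>(1), of "\<lambda>_. 1" 0] by simp
    have i: "integrable lebesgue (\<lambda>z. ?\<rho> z * q (x - z))" by (rule integrable_conv(2)[OF \<rho>(1) q])
    have "conv ?\<rho> q x - q x = (LINT z|lebesgue. ?\<rho> z * q (x - z) - ?\<rho> z * q x)"
      unfolding conv_flip[OF \<rho>(1) q] using i i\<rho> \<rho>(3) by simp
    then have "\<bar>conv ?\<rho> q x - q x\<bar> \<le> (LINT z|lebesgue. \<bar>?\<rho> z * q (x - z) - ?\<rho> z * q x\<bar>)"
      using integral_abs_bound by metis
    also have "\<dots> \<le> (LINT z|lebesgue. ?\<rho> z * (e / 2))"
    proof (intro integral_mono integrable_abs Bochner_Integration.integrable_diff i integrable_mult_left i\<rho>)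
      fix z
      show "\<bar>?\<rho> z * q (x - z) - ?\<rho> z * q x\<bar> \<le> ?\<rho> z * (e / 2)"
      proof (cases "norm z < inverse (real (Suc k))")
        case True
        have "inverse (real (Suc k)) \<le> inverse (real (Suc N))" using k by (intro le_imp_inverse_le) auto
        then have "norm z < \<delta>" using True N by linarith
        then have "dist (x - z) x < \<delta>" by (simp add: dist_norm)
        then have "\<bar>q (x - z) - q x\<bar> \<le> e / 2" using \<delta>(2) by (simp add: dist_real_def less_imp_le)
        then have "?\<rho> z * \<bar>q (x - z) - q x\<bar> \<le> ?\<rho> z * (e / 2)" using \<rho>(2) by (intro mult_left_mono) auto
        then show ?thesis using \<rho>(2)[of z] by (simp add: abs_mult flip: right_diff_distrib)
      next
        case False
        have "sqrt (real (Suc k) ^ 2) = real (Suc k)" by (simp only: real_sqrt_abs abs_of_nat)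
        then have "1 / sqrt (real (Suc k) ^ 2) \<le> norm z" using False by (simp only: inverse_eq_divide not_less)
        then have "?\<rho> z = 0" by (rule \<rho>(4))
        then show ?thesis by simp
      qed
    qed
    also have "\<dots> = e / 2" using \<rho>(3) by simp
    finally show "norm (conv ?\<rho> q x - q x) < e" using e by simp
  qed
qed

lemma conv_mollifier_bounds:
  fixes q :: "'a::euclidean_space \<Rightarrow> real"
  assumes s: "s > 0" and q: "continuous_on UNIV q" "\<And>x. 0 \<le> q x" "\<And>x. q x \<le> K"
  shows "0 \<le> conv (mollifier s) q x" "conv (mollifier s) q x \<le> K"
proof -
  note \<rho> = mollifier[OF s, where 'a='a]
  have i\<rho>: "integrable lebesgue (mollifier s :: 'a \<Rightarrow> real)" using integrable_conv(2)[OF \<rho>(1), of "\<lambda>_. 1" 0] by simp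
  show "0 \<le> conv (mollifier s) q x"
    unfolding conv_def using \<rho>(2) q(2) by (intro integral_nonneg_AE AE_I2 mult_nonneg_nonneg)
  have "conv (mollifier s) q x \<le> (LINT z|lebesgue. mollifier s (z :: 'a) * K)"
    unfolding conv_flip[OF \<rho>(1) q(1)]
  proof (rule integral_mono)
    show "mollifier s z * q (x - z) \<le> mollifier s z * K" for z by (intro mult_left_mono q(3) \<rho>(2))
  qed (intro integrable_conv(2)[OF \<rho>(1) q(1)] integrable_mult_left i\<rho>)+
  then show "conv (mollifier s) q x \<le> K" using \<rho>(3) by simp
qed

section \<open>Testing the normal traces\<close>

lemma norm_matrix_vector_le:
  fixes A :: "real^'m::finite^'k::finite"
  shows "norm (A *v g) \<le> (\<Sum>i\<in>UNIV. \<Sum>j\<in>UNIV. \<bar>A $ i $ j\<bar>) * norm g"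
proof -
  have "norm (A *v g) \<le> (\<Sum>i\<in>UNIV. \<bar>(A *v g) $ i\<bar>)" by (rule norm_le_l1_cart)
  also have "\<dots> \<le> (\<Sum>i\<in>UNIV. \<Sum>j\<in>UNIV. \<bar>A $ i $ j\<bar> * norm g)"
  proof (rule sum_mono)
    fix i
    have "\<bar>(A *v g) $ i\<bar> \<le> (\<Sum>j\<in>UNIV. \<bar>A $ i $ j * g $ j\<bar>)"
      unfolding matrix_vector_mult_def by (simp add: sum_abs)
    also have "\<dots> \<le> (\<Sum>j\<in>UNIV. \<bar>A $ i $ j\<bar> * norm g)"
      by (intro sum_mono) (simp add: abs_mult mult_left_mono component_le_norm_cart)
    finally show "\<bar>(A *v g) $ i\<bar> \<le> (\<Sum>j\<in>UNIV. \<bar>A $ i $ j\<bar> * norm g)" .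
  qed
  also have "\<dots> = (\<Sum>i\<in>UNIV. \<Sum>j\<in>UNIV. \<bar>A $ i $ j\<bar>) * norm g" by (simp add: sum_distrib_right)
  finally show ?thesis .
qed

lemma test_function_vec:
  fixes \<psi> :: "real^'d::finite \<Rightarrow> real^'d"
  assumes "\<And>i. csmooth (\<lambda>x. \<psi> x $ i)"
  shows "test_function UNIV \<psi>"
proof -
  have "\<forall>i. \<exists>r. \<forall>x. r < norm x \<longrightarrow> \<psi> x $ i = 0" using assms by (simp add: csmooth_def)
  then obtain r where r: "\<forall>i. \<forall>x. r i < norm x \<longrightarrow> \<psi> x $ i = 0" by (rule choice[THEN exE])
  have "{x. \<psi> x \<noteq> 0} \<subseteq> cball 0 (Max (range r))"
  proof
    fix x assume "x \<in> {x. \<psi> x \<noteq> 0}"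
    then obtain i where "\<psi> x $ i \<noteq> 0" by (auto simp: vec_eq_iff)
    then have "norm x \<le> r i" using r by (meson not_le)
    also have "\<dots> \<le> Max (range r)" by (intro Max_ge) auto
    finally show "x \<in> cball 0 (Max (range r))" by simp
  qed
  then have "bounded {x. \<psi> x \<noteq> 0}" using bounded_cball bounded_subset by blast
  then have "compact (closure {x. \<psi> x \<noteq> 0})" by (simp add: compact_closure)
  moreover have "Ck k \<psi>" for k using assms by (intro Ck_vec) (simp add: csmooth_def)
  ultimately show ?thesis by (simp add: test_function_def)
qed

lemma measurable_lebesgue_on: "f \<in> borel_measurable lebesgue \<Longrightarrow> f \<in> borel_measurable (lebesgue_on S)"
  by (rule measurable_restrict_space1)

lemma slab_sets: "(slab \<tau> :: (real^('n::finite option)) set) \<in> sets lebesgue"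
proof -
  have "open (slab \<tau> :: (real^('n::finite option)) set)"
    unfolding slab_def by (intro open_Collect_conj open_Collect_less continuous_intros)
  then show "(slab \<tau> :: (real^('n::finite option)) set) \<in> sets lebesgue" by (intro sets_completionI_sets) simp
qed

locale slab_tensor =
  fixes \<tau> :: real
    and A :: "real^('n::finite option) \<Rightarrow> real^('n option)^('n option)"
    and \<mu>\<^sub>0 \<mu>\<^sub>1 :: "(real^('n option)) set \<Rightarrow> real^('n option)"
  assumes dpt: "DPT (slab \<tau>) A" and \<mu>0: "bounded_vector_measure (borel_slice 0) \<mu>\<^sub>0"
    and \<mu>1: "bounded_vector_measure (borel_slice \<tau>) \<mu>\<^sub>1" and traces: "normal_traces_are \<tau> A \<mu>\<^sub>0 \<mu>\<^sub>1"
begin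

abbreviation \<Omega> :: "(real^('n option)) measure" where "\<Omega> \<equiv> lebesgue_on (slab \<tau>)"

definition M :: real where
  "M = enn2real (total_mass (borel_slice 0) \<mu>\<^sub>0) + enn2real (total_mass (borel_slice \<tau>) \<mu>\<^sub>1)"

definition a :: "real^('n option) \<Rightarrow> real" where "a x = det (A x) powr (1 / CARD('n option))"

text \<open>An entrywise norm dominating the operator norm. Its finite integral multiplies the
  gradient of the cutoff in the error term.\<close>

definition nA :: "real^('n option) \<Rightarrow> real" where "nA x = (\<Sum>i\<in>UNIV. \<Sum>j\<in>UNIV. \<bar>A x $ i $ j\<bar>)"

lemma A_psd: "x \<in> slab \<tau> \<Longrightarrow> sym_psd (A x)"
  using dpt by (simp add: DPT_def)

lemma integrable_A: "integrable \<Omega> (\<lambda>x. A x $ i $ j)"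
proof -
  have "bounded_linear (\<lambda>B :: real^('n option)^('n option). B $ i $ j)"
    using bounded_linear_compose[OF bounded_linear_vec_nth bounded_linear_vec_nth] .
  moreover have "integrable \<Omega> A" using dpt by (simp add: DPT_def)
  ultimately show ?thesis by (rule integrable_bounded_linear)
qed

lemma measurable_det_A: "(\<lambda>x. det (A x)) \<in> borel_measurable \<Omega>"
  unfolding det_def using borel_measurable_integrable[OF integrable_A]
  by (intro borel_measurable_sum borel_measurable_times borel_measurable_prod borel_measurable_const)

lemma integrable_nA: "integrable \<Omega> nA"
  unfolding nA_def by (intro Bochner_Integration.integrable_sum integrable_abs integrable_A)

text \<open>\<open>a\<close> is dominated by the trace divided by the dimension, which inherits
  integrability from \<open>A\<close>.\<close>

lemma integrable_a: "integrable \<Omega> a"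
proof (rule Bochner_Integration.integrable_bound)
  show "integrable \<Omega> (\<lambda>x. (\<Sum>i\<in>UNIV. A x $ i $ i) / CARD('n option))"
    by (intro integrable_divide Bochner_Integration.integrable_sum integrable_A)
  show "a \<in> borel_measurable \<Omega>" unfolding a_def using measurable_det_A by measurable
  show "AE x in \<Omega>. norm (a x) \<le> norm ((\<Sum>i\<in>UNIV. A x $ i $ i) / CARD('n option))"
  proof (rule AE_I2)
    fix x assume "x \<in> space \<Omega>"
    then have "CARD('n option) * a x \<le> trace (A x)"
      using sym_psd_trace_ge[OF A_psd] by (simp add: a_def)
    then have "a x \<le> trace (A x) / CARD('n option)" by (simp add: field_simps)
    moreover have "a x \<ge> 0" by (simp add: a_def)
    ultimately show "norm (a x) \<le> norm ((\<Sum>i\<in>UNIV. A x $ i $ i) / CARD('n option))"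
      unfolding trace_def real_norm_def by linarith
  qed
qed

lemma M_nonneg: "M \<ge> 0" by (simp add: M_def)

lemma normal_trace_le:
  assumes \<psi>: "test_function UNIV \<psi>" and R: "\<And>x. norm (\<psi> x) \<le> R"
  shows "normal_trace \<tau> A \<psi> \<le> R * M"
proof -
  have "continuous_on UNIV \<psi>" using \<psi> Ck_continuous[of 0 \<psi>] by (simp add: test_function_def del: Ck.simps)
  then have m: "\<psi> \<in> borel_measurable (borel_slice s)" for s
    unfolding borel_slice_def by (intro measurable_restrict_space1 borel_measurable_continuous_onI)
  have R0: "R \<ge> 0" using order_trans[OF norm_ge_zero R[of 0]] .
  have "vector_integral (borel_slice 0) \<mu>\<^sub>0 \<psi> \<le> R * enn2real (total_mass (borel_slice 0) \<mu>\<^sub>0)"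
    using \<mu>0 m R R0 by (rule vector_integral_le)
  moreover have "vector_integral (borel_slice \<tau>) \<mu>\<^sub>1 \<psi> \<le> R * enn2real (total_mass (borel_slice \<tau>) \<mu>\<^sub>1)"
    using \<mu>1 m R R0 by (rule vector_integral_le)
  ultimately show ?thesis using traces \<psi> by (simp add: normal_traces_are_def M_def distrib_left)
qed

end

section \<open>Spreading cutoffs and the gradient test field\<close>

definition cutoff :: "real \<Rightarrow> 'a::euclidean_space \<Rightarrow> real" where "cutoff s x = exp 1 * bump s x"

lemma cutoff_bounds: "s > 0 \<Longrightarrow> 0 \<le> cutoff s x" "s > 0 \<Longrightarrow> cutoff s x \<le> 1"
proof -
  show "s > 0 \<Longrightarrow> 0 \<le> cutoff s x" by (simp add: cutoff_def bump_at_nonneg)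
  assume "s > 0"
  then have "exp 1 * bump s x \<le> exp 1 * exp (- 1)" by (intro mult_left_mono bump_le) auto
  then show "cutoff s x \<le> 1" by (simp add: cutoff_def flip: exp_add)
qed

lemma cutoff_has_derivative:
  "(cutoff s has_derivative (\<lambda>v. ((- 2 * s * exp 1 * bump_at 2 s x) *\<^sub>R x) \<bullet> v)) (at x)"
  using has_derivative_mult_right[OF bump_at_has_derivative[of 0 s x], of "exp 1"]
  by (simp add: cutoff_def[abs_def] mult_ac numeral_2_eq_2)

text \<open>On the support \<open>s * norm x \<le> sqrt s\<close>. The factor
  \<open>2 * exp 1\<close> comes from differentiating, the other 2 from
  \<open>flat_exp_2_le\<close>. So the gradient tends uniformly to 0 with \<open>s\<close>.\<close>

lemma cutoff_gradient_le:
  assumes s: "s > 0"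
  shows "norm ((- 2 * s * exp 1 * bump_at 2 s x) *\<^sub>R x) \<le> 2 * exp 1 * 2 * sqrt s"
proof (cases "norm x < 1 / sqrt s")
  case True
  have "s * norm x \<le> s * (1 / sqrt s)" using True s by (intro mult_left_mono) auto
  also have "\<dots> = sqrt s" using s by (simp add: real_div_sqrt)
  finally have sx: "s * norm x \<le> sqrt s" .
  have "norm ((- 2 * s * exp 1 * bump_at 2 s x) *\<^sub>R x) = 2 * exp 1 * (bump_at 2 s x * (s * norm x))"
    using s bump_at_nonneg[of 2 s x] by (simp add: abs_mult)
  also have "\<dots> \<le> 2 * exp 1 * (2 * sqrt s)"
    using sx s flat_exp_2_le by (intro mult_left_mono mult_mono) (auto simp: bump_at_def)
  finally show ?thesis by simp
next
  case False
  then have "bump_at 2 s x = 0" using s by (intro bump_at_eq_0) auto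
  then show ?thesis using s by simp
qed

lemma csmooth_cutoff: "s > 0 \<Longrightarrow> csmooth (cutoff s)"
  unfolding cutoff_def[abs_def] by (intro csmooth_mult_const csmooth_bump)

lemma csmooth_times_Ck:
  assumes "csmooth \<rho>" "\<And>k. Ck k f" shows "csmooth (\<lambda>x. \<rho> x * f x)"
proof -
  obtain r where r: "\<forall>x. r < norm x \<longrightarrow> \<rho> x = 0" using assms(1) by (auto simp: csmooth_def)
  then have "\<forall>x. r < norm x \<longrightarrow> \<rho> x * f x = 0" by simp
  moreover have "Ck k (\<lambda>x. \<rho> x * f x)" for k using assms by (intro Ck_mult) (simp_all add: csmooth_def)
  ultimately show ?thesis unfolding csmooth_def by blast
qed

text \<open>The gradient \<open>G\<close> has no compact support, so the test field is
  \<open>cutoff s x *\<^sub>R G x\<close>. Its Jacobian yields the wanted trace plus a term with the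
  cutoff gradient \<open>\<gamma>\<close>, bounded by the norm of \<open>\<gamma>\<close> times
  \<open>R * nA x\<close>.\<close>

lemma (in slab_tensor) cutoff_hessian_integral_le:
  assumes cm: "convex_mollified \<rho> u R" and s: "s > 0"
  shows "integrable \<Omega> (\<lambda>x. cutoff s x * trace (A x ** convex_mollified.H \<rho> u x))"
    "(LINT x|\<Omega>. cutoff s x * trace (A x ** convex_mollified.H \<rho> u x))
      \<le> R * M + 2 * exp 1 * 2 * sqrt s * R * (LINT x|\<Omega>. nA x)"
proof -
  interpret convex_mollified \<rho> u R by (rule cm)
  define \<gamma> :: "real^('n option) \<Rightarrow> real^('n option)" where "\<gamma> x = (- 2 * s * exp 1 * bump_at 2 s x) *\<^sub>R x" for x
  define \<psi> where "\<psi> x = cutoff s x *\<^sub>R G x" for x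
  define c where "c = 2 * exp 1 * 2 * sqrt s"
  have \<gamma>: "norm (\<gamma> x) \<le> c" for x unfolding \<gamma>_def c_def by (rule cutoff_gradient_le[OF s])
  have Gi: "Ck k (\<lambda>x. G x $ i)" for k i
    by (simp add: G_def Ck_conv[OF csmooth_frechet_derivative[OF \<rho>] continuous_u])
  have \<psi>i: "csmooth (\<lambda>x. \<psi> x $ i)" for i
    unfolding \<psi>_def using csmooth_times_Ck[OF csmooth_cutoff[OF s] Gi] by simp
  have \<psi>: "test_function UNIV \<psi>" using \<psi>i by (rule test_function_vec)
  have "norm (\<psi> x) \<le> R" for x
    using mult_mono[OF cutoff_bounds(2)[OF s, of x] norm_G_le[of x]] cutoff_bounds(1)[OF s, of x] by (simp add: \<psi>_def)
  then have nt: "normal_trace \<tau> A \<psi> \<le> R * M" using \<psi> by (intro normal_trace_le)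
  have d: "(\<psi> has_derivative (\<lambda>v. cutoff s x *\<^sub>R (H x *v v) + (\<gamma> x \<bullet> v) *\<^sub>R G x)) (at x)" for x
    unfolding \<psi>_def \<gamma>_def by (rule has_derivative_scaleR[OF cutoff_has_derivative G_has_derivative])
  have J: "jacobian \<psi> (at x) $ k $ i = cutoff s x * H x $ k $ i + \<gamma> x $ i * G x $ k" for x k i
  proof -
    have "frechet_derivative \<psi> (at x) = (\<lambda>v. cutoff s x *\<^sub>R (H x *v v) + (\<gamma> x \<bullet> v) *\<^sub>R G x)"
      using frechet_derivative_at[OF d] by simp
    then show ?thesis
      by (simp add: jacobian_def matrix_def inner_axis matrix_vector_mul_component inner_axis' row_def matrix_vector_mult_basis column_def)
  qed
  have tr: "trace (A x ** jacobian \<psi> (at x)) = cutoff s x * trace (A x ** H x) + \<gamma> x \<bullet> (A x *v G x)" for x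
    unfolding trace_def matrix_matrix_mult_def inner_vec_def matrix_vector_mult_def
    by (simp add: J distrib_left sum.distrib sum_distrib_left mult_ac)
  have Jc: "csmooth (\<lambda>x. jacobian \<psi> (at x) $ k $ i)" for k i
  proof -
    have "frechet_derivative (\<lambda>x. \<psi> x $ k) (at x) (axis i 1) = jacobian \<psi> (at x) $ k $ i" for x
    proof -
      have "((\<lambda>x. \<psi> x $ k) has_derivative (\<lambda>v. (cutoff s x *\<^sub>R (H x *v v) + (\<gamma> x \<bullet> v) *\<^sub>R G x) $ k)) (at x)"
        using bounded_linear.has_derivative[OF bounded_linear_vec_nth d] .
      from frechet_derivative_at[OF this] frechet_derivative_at[OF d]
      show ?thesis by (metis (no_types, lifting) jacobian_def matrix_def vec_lambda_beta)
    qed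
    then show ?thesis using csmooth_frechet_derivative[OF \<psi>i[of k], of "axis i 1"] by simp
  qed
  \<comment> \<open>The entries of \<open>A\<close> are only integrable; every factor paired with
    them is continuous and bounded, being of compact support.\<close>
  have bm: "integrable \<Omega> (\<lambda>x. A x $ i $ j * f x)" if f: "continuous_on UNIV f" "\<exists>B. \<forall>x. \<bar>f x\<bar> \<le> B" for i j f
  proof -
    obtain B where B: "\<And>x. \<bar>f x\<bar> \<le> B" using f(2) by blast
    show ?thesis
    proof (rule Bochner_Integration.integrable_bound)
      show "integrable \<Omega> (\<lambda>x. A x $ i $ j * B)" using integrable_A by simp
      show "(\<lambda>x. A x $ i $ j * f x) \<in> borel_measurable \<Omega>"
        by (intro borel_measurable_times borel_measurable_integrable[OF integrable_A] measurable_lebesgue_on continuous_imp_borel_lebesgue f(1))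
      show "AE x in \<Omega>. norm (A x $ i $ j * f x) \<le> norm (A x $ i $ j * B)"
      proof (rule AE_I2)
        fix x have "\<bar>f x\<bar> \<le> \<bar>B\<bar>" using B[of x] by linarith
        then show "norm (A x $ i $ j * f x) \<le> norm (A x $ i $ j * B)" by (simp add: abs_mult mult_left_mono)
      qed
    qed
  qed
  have i1: "integrable \<Omega> (\<lambda>x. trace (A x ** jacobian \<psi> (at x)))"
    unfolding trace_def matrix_matrix_mult_def vec_lambda_beta
    using csmooth_continuous[OF Jc] csmooth_bounded[OF Jc] by (intro Bochner_Integration.integrable_sum bm) blast+
  have i2: "integrable \<Omega> (\<lambda>x. cutoff s x * trace (A x ** H x))"
  proof -
    have "csmooth (\<lambda>x. cutoff s x * H x $ k $ i)" for k i
      unfolding H_def vec_lambda_beta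
      by (intro csmooth_times_Ck csmooth_cutoff s Ck_conv csmooth_frechet_derivative \<rho> continuous_u)
    note cs = csmooth_continuous[OF this] csmooth_bounded[OF this]
    have "integrable \<Omega> (\<lambda>x. \<Sum>i\<in>UNIV. \<Sum>k\<in>UNIV. A x $ i $ k * (cutoff s x * H x $ k $ i))"
      using cs by (intro Bochner_Integration.integrable_sum bm) blast+
    moreover have "(\<Sum>i\<in>UNIV. \<Sum>k\<in>UNIV. A x $ i $ k * (cutoff s x * H x $ k $ i)) = cutoff s x * trace (A x ** H x)" for x
      unfolding trace_def matrix_matrix_mult_def by (simp add: sum_distrib_left mult_ac)
    ultimately show ?thesis by simp
  qed
  show "integrable \<Omega> (\<lambda>x. cutoff s x * trace (A x ** H x))" by (rule i2)
  have "(LINT x|\<Omega>. cutoff s x * trace (A x ** H x)) \<le> (LINT x|\<Omega>. trace (A x ** jacobian \<psi> (at x)) + c * R * nA x)"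
  proof (intro integral_mono i2 Bochner_Integration.integrable_add i1 integrable_mult_right integrable_nA)
    fix x
    have "\<bar>\<gamma> x \<bullet> (A x *v G x)\<bar> \<le> norm (\<gamma> x) * norm (A x *v G x)" by (rule Cauchy_Schwarz_ineq2)
    also have "\<dots> \<le> c * (nA x * R)"
    proof (rule mult_mono)
      show "norm (A x *v G x) \<le> nA x * R"
        using norm_matrix_vector_le[of "A x" "G x"] mult_left_mono[OF norm_G_le, of "nA x" x]
        by (force simp: nA_def sum_nonneg)
      show "0 \<le> c" using s by (simp add: c_def)
    qed (use \<gamma> in auto)
    finally show "cutoff s x * trace (A x ** H x) \<le> trace (A x ** jacobian \<psi> (at x)) + c * R * nA x"
      unfolding tr by (simp add: abs_le_iff mult_ac)
  qed
  also have "\<dots> = normal_trace \<tau> A \<psi> + c * R * (LINT x|\<Omega>. nA x)"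
    using i1 integrable_nA by (simp add: normal_trace_def)
  finally show "(LINT x|\<Omega>. cutoff s x * trace (A x ** H x)) \<le> R * M + 2 * exp 1 * 2 * sqrt s * R * (LINT x|\<Omega>. nA x)"
    using nt by (simp add: c_def)
qed

lemma le_powr_of_power_le:
  fixes c y :: real
  assumes "0 \<le> c" "c ^ d \<le> y" "d > 0"
  shows "c \<le> y powr (1 / d)"
proof (cases "c = 0")
  case False
  then have "0 < c ^ d" using assms(1) by simp
  then have y: "y > 0" using assms(2) by linarith
  have "c = root d (c ^ d)" using assms by (simp add: real_root_power_cancel)
  also have "\<dots> \<le> root d y" using assms by simp
  also have "\<dots> = y powr (1 / d)" using y assms(3) by (simp add: root_powr_inverse)
  finally show ?thesis .
qed simp

lemma cutoff_tendsto_1: "(\<lambda>k. cutoff (inverse (real (Suc k)) ^ 2) x) \<longlonglongrightarrow> 1"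
proof -
  have "(\<lambda>k. inverse (real (Suc k)) ^ 2) \<longlonglongrightarrow> 0 ^ 2" by (intro tendsto_power LIMSEQ_inverse_real_of_nat)
  then have "(\<lambda>k. 1 - inverse (real (Suc k)) ^ 2 * (x \<bullet> x)) \<longlonglongrightarrow> 1 - 0 * (x \<bullet> x)"
    by (intro tendsto_intros) simp
  then have "(\<lambda>k. flat_exp 0 (1 - inverse (real (Suc k)) ^ 2 * (x \<bullet> x))) \<longlonglongrightarrow> flat_exp 0 (1 - 0 * (x \<bullet> x))"
    by (rule isCont_tendsto_compose[OF DERIV_isCont[OF flat_exp_DERIV]])
  then have "(\<lambda>k. exp 1 * flat_exp 0 (1 - inverse (real (Suc k)) ^ 2 * (x \<bullet> x))) \<longlonglongrightarrow> exp 1 * flat_exp 0 (1 - 0 * (x \<bullet> x))"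
    by (intro tendsto_mult tendsto_const)
  moreover have "exp 1 * flat_exp 0 (1 - 0 * (x \<bullet> x)) = 1" by (simp add: flat_exp_def flip: exp_add)
  ultimately show ?thesis by (simp only: cutoff_def bump_at_def)
qed

section \<open>The bound for test densities \<open>q\<close>\<close>

context slab_tensor
begin

lemma a_nonneg: "0 \<le> a x" by (simp add: a_def)

lemma integrable_a_times:
  assumes "f \<in> borel_measurable \<Omega>" "\<And>x. 0 \<le> f x" "\<And>x. f x \<le> K"
  shows "integrable \<Omega> (\<lambda>x. a x * f x)"
proof (rule Bochner_Integration.integrable_bound)
  show "integrable \<Omega> (\<lambda>x. a x * K)" using integrable_a by simp
  show "(\<lambda>x. a x * f x) \<in> borel_measurable \<Omega>"
    by (intro borel_measurable_times borel_measurable_integrable[OF integrable_a] assms(1))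
  show "AE x in \<Omega>. norm (a x * f x) \<le> norm (a x * K)"
  proof (rule AE_I2)
    fix x show "norm (a x * f x) \<le> norm (a x * K)"
      using assms(2,3)[of x] a_nonneg[of x] by (simp add: abs_mult mult_left_mono)
  qed
qed

text \<open>One index \<open>k\<close> drives both the mollification at scale
  \<open>1 / (k + 1)\<close> and the cutoff at radius \<open>k + 1\<close>. Since \<open>R\<close>
  depends on \<open>q\<close> alone, the error from the cutoff is a constant over
  \<open>k + 1\<close>.\<close>

lemma det_functional_le_continuous_pos:
  assumes q: "continuous_on UNIV q" "\<And>x. 0 \<le> q x" "\<And>x. r < norm x \<Longrightarrow> q x = 0"
    and I: "(LINT x|lebesgue. q x ^ CARD('n option)) > 0"
  shows "CARD('n option) * (LINT x|\<Omega>. a x * q x) \<le> M * root CARD('n option) ((LINT x|lebesgue. q x ^ CARD('n option)) / unit_ball_vol CARD('n option))"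
proof -
  let ?I = "LINT x|lebesgue. q x ^ CARD('n option)"
  define R where "R = root CARD('n option) (?I / unit_ball_vol CARD('n option))"
  have ub: "unit_ball_vol (real CARD('n option)) > 0" by simp
  have R: "R > 0" using I ub by (simp add: R_def)
  have RD: "R ^ CARD('n option) = ?I / unit_ball_vol (real CARD('n option))"
    unfolding R_def using I ub by (intro real_root_pow_pos2) auto
  have "measure lebesgue (cball (0 :: real^('n option)) R) = unit_ball_vol (real CARD('n option)) * R ^ CARD('n option)"
    using content_cball[OF less_imp_le[OF R], of "0 :: real^('n option)"] by simp
  also have "\<dots> = ?I" unfolding RD by (rule nonzero_mult_div_cancel_left[OF less_imp_neq[OF ub, symmetric], simplified times_divide_eq_right[symmetric]])
  finally have Rd: "?I = measure lebesgue (cball (0 :: real^('n option)) R)" by (rule sym)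
  have q0: "q x = 0" if "x \<notin> cball 0 r" for x using that q(3) by simp
  have iq: "integrable lebesgue q" by (rule integrable_continuous_compact_support[OF q(1) q0])
  have iqd: "integrable lebesgue (\<lambda>x. q x ^ CARD('n option))"
    by (rule integrable_continuous_compact_support[of _ 0 r]) (auto intro!: continuous_intros q(1) simp: q0)
  obtain K where K: "\<And>x. q x \<le> K"
  proof -
    have "compact (q ` cball 0 r)" by (intro compact_continuous_image continuous_on_subset[OF q(1)]) auto
    then have "bounded (q ` cball 0 r)" by (rule compact_imp_bounded)
    then obtain B where "\<forall>x\<in>cball 0 r. norm (q x) \<le> B" unfolding bounded_iff by auto
    then have "q x \<le> max B 0" for x using q0[of x] by (cases "x \<in> cball 0 r") (auto simp: max_def dest!: bspec)
    then show ?thesis using that by blast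
  qed
  define \<rho> where "\<rho> k = (mollifier (real (Suc k) ^ 2) :: real^('n option) \<Rightarrow> real)" for k
  define \<eta> where "\<eta> k = (cutoff (inverse (real (Suc k)) ^ 2) :: real^('n option) \<Rightarrow> real)" for k
  have s: "real (Suc k) ^ 2 > 0" "inverse (real (Suc k)) ^ 2 > 0" for k by simp_all
  note cb = conv_mollifier_bounds[OF s(1) q(1,2) K, folded \<rho>_def]
  have \<eta>b: "0 \<le> \<eta> k x" "\<eta> k x \<le> 1" for k x unfolding \<eta>_def by (rule cutoff_bounds[OF s(2)])+
  let ?f = "\<lambda>k x. \<eta> k x * conv (\<rho> k) q x"
  have fb: "0 \<le> ?f k x" "?f k x \<le> K" for k x
  proof -
    show "0 \<le> ?f k x" using cb(1) \<eta>b(1) by (intro mult_nonneg_nonneg)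
    have "?f k x \<le> 1 * K" using cb \<eta>b by (intro mult_mono) auto
    then show "?f k x \<le> K" by simp
  qed
  have fm: "?f k \<in> borel_measurable \<Omega>" for k
    unfolding \<eta>_def \<rho>_def
    by (intro borel_measurable_times measurable_lebesgue_on continuous_imp_borel_lebesgue
        csmooth_continuous[OF csmooth_cutoff[OF s(2)]] Ck_continuous[OF Ck_conv[OF mollifier(1)[OF s(1)] q(1), of 0]])
  have step: "CARD('n option) * (LINT x|\<Omega>. a x * ?f k x) \<le> R * M + 2 * exp 1 * 2 * inverse (real (Suc k)) * R * (LINT x|\<Omega>. nA x)" for k
  proof -
    from mollified_Alexandrov[OF mollifier(1,2,3)[OF s(1)] mollifier_symmetric_derivative q(2) q(3) iq iqd R Rd]
    obtain u where u: "convex_mollified (\<rho> k) u R" "\<And>x. conv (\<rho> k) q x ^ CARD('n option) \<le> det (convex_mollified.H (\<rho> k) u x)"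
      unfolding \<rho>_def by blast
    interpret cm: convex_mollified "\<rho> k" u R by (rule u(1))
    note le = cutoff_hessian_integral_le[OF u(1) s(2), of k, folded \<eta>_def]
    have "CARD('n option) * (LINT x|\<Omega>. a x * ?f k x) = (LINT x|\<Omega>. CARD('n option) * (a x * ?f k x))" by simp
    also have "\<dots> \<le> (LINT x|\<Omega>. \<eta> k x * trace (A x ** cm.H x))"
    proof (intro integral_mono le(1) integrable_mult_right integrable_a_times[OF fm fb])
      fix x assume "x \<in> space \<Omega>"
      then have "sym_psd (A x)" using A_psd by (simp add: space_restrict_space)
      from trace_mult_ge_det[OF this cm.sym_psd_H]
      have "CARD('n option) * (a x * det (cm.H x) powr (1 / CARD('n option))) \<le> trace (A x ** cm.H x)" by (simp add: a_def)
      moreover have "conv (\<rho> k) q x \<le> det (cm.H x) powr (1 / CARD('n option))"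
        using cb(1) u(2) by (rule le_powr_of_power_le) simp
      then have "CARD('n option) * (a x * conv (\<rho> k) q x) \<le> CARD('n option) * (a x * det (cm.H x) powr (1 / CARD('n option)))"
        using a_nonneg by (intro mult_left_mono) auto
      ultimately have "CARD('n option) * (a x * conv (\<rho> k) q x) \<le> trace (A x ** cm.H x)"
        by (rule order_trans[rotated])
      from mult_left_mono[OF this \<eta>b(1), of k x]
      show "CARD('n option) * (a x * ?f k x) \<le> \<eta> k x * trace (A x ** cm.H x)" by (simp add: mult_ac)
    qed
    also have "\<dots> \<le> R * M + 2 * exp 1 * 2 * sqrt (inverse (real (Suc k)) ^ 2) * R * (LINT x|\<Omega>. nA x)" by (rule le(2))
    also have "sqrt (inverse (real (Suc k)) ^ 2) = inverse (real (Suc k))" by (simp only: real_sqrt_abs) simp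
    finally show ?thesis .
  qed
  have "(\<lambda>k. LINT x|\<Omega>. a x * ?f k x) \<longlonglongrightarrow> (LINT x|\<Omega>. a x * q x)"
  proof (rule integral_dominated_convergence[where w="\<lambda>x. a x * K"])
    show "(\<lambda>x. a x * q x) \<in> borel_measurable \<Omega>"
      by (intro borel_measurable_times borel_measurable_integrable[OF integrable_a] measurable_lebesgue_on continuous_imp_borel_lebesgue q(1))
    show "(\<lambda>x. a x * ?f k x) \<in> borel_measurable \<Omega>" for k
      by (rule borel_measurable_integrable[OF integrable_a_times[OF fm fb]])
    show "integrable \<Omega> (\<lambda>x. a x * K)" using integrable_a by simp
    show "AE x in \<Omega>. (\<lambda>k. a x * ?f k x) \<longlonglongrightarrow> a x * q x"
    proof (rule AE_I2)
      fix x
      have "(\<lambda>k. a x * ?f k x) \<longlonglongrightarrow> a x * (1 * q x)"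
        unfolding \<eta>_def \<rho>_def by (intro tendsto_mult tendsto_const cutoff_tendsto_1 conv_mollifier_tendsto q(1))
      then show "(\<lambda>k. a x * ?f k x) \<longlonglongrightarrow> a x * q x" by simp
    qed
    show "AE x in \<Omega>. norm (a x * ?f k x) \<le> a x * K" for k
    proof (rule AE_I2)
      fix x show "norm (a x * ?f k x) \<le> a x * K"
        using fb[of k x] a_nonneg[of x] by (simp add: abs_mult mult_left_mono)
    qed
  qed
  then have L: "(\<lambda>k. CARD('n option) * (LINT x|\<Omega>. a x * ?f k x)) \<longlonglongrightarrow> CARD('n option) * (LINT x|\<Omega>. a x * q x)"
    by (intro tendsto_mult tendsto_const)
  have "(\<lambda>k. R * M + 2 * exp 1 * 2 * inverse (real (Suc k)) * R * (LINT x|\<Omega>. nA x)) \<longlonglongrightarrow> R * M + 2 * exp 1 * 2 * 0 * R * (LINT x|\<Omega>. nA x)"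
    by (intro tendsto_intros LIMSEQ_inverse_real_of_nat)
  then have "(\<lambda>k. R * M + 2 * exp 1 * 2 * inverse (real (Suc k)) * R * (LINT x|\<Omega>. nA x)) \<longlonglongrightarrow> R * M" by simp
  from LIMSEQ_le[OF L this] step have "CARD('n option) * (LINT x|\<Omega>. a x * q x) \<le> R * M" by blast
  then show ?thesis by (simp add: R_def mult.commute)
qed

text \<open>The transport problem needs a ball of positive radius. When the mass of \<open>q\<close>
  raised to the dimension is 0, continuity forces \<open>q = 0\<close>.\<close>

lemma det_functional_le_continuous:
  assumes q: "continuous_on UNIV q" "\<And>x. 0 \<le> q x" "\<And>x. r < norm x \<Longrightarrow> q x = 0"
  shows "CARD('n option) * (LINT x|\<Omega>. a x * q x) \<le> M * root CARD('n option) ((LINT x|lebesgue. q x ^ CARD('n option)) / unit_ball_vol CARD('n option))"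
proof (cases "(LINT x|lebesgue. q x ^ CARD('n option)) > 0")
  case True
  with q show ?thesis by (rule det_functional_le_continuous_pos)
next
  case False
  have iqd: "integrable lebesgue (\<lambda>x. q x ^ CARD('n option))"
    by (rule integrable_continuous_compact_support[of _ 0 r]) (auto intro!: continuous_intros q(1) simp: q(3))
  have "0 \<le> (LINT x|lebesgue. q x ^ CARD('n option))" using q(2) by (intro integral_nonneg_AE AE_I2 zero_le_power)
  then have I0: "(LINT x|lebesgue. q x ^ CARD('n option)) = 0" using False by simp
  then have "AE x in lebesgue. q x ^ CARD('n option) = 0"
    using integral_nonneg_eq_0_iff_AE[OF iqd] q(2) by simp
  then have ae: "AE x in lebesgue. x \<notin> {x. q x \<noteq> 0}" by simp
  have o: "open {x. q x \<noteq> 0}" using q(1) by (intro open_Collect_neq) auto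
  then have "{x. q x \<noteq> 0} \<in> sets lebesgue" by (intro sets_completionI_sets) simp
  from AE_iff_null_sets[OF this] ae have "negligible {x. q x \<noteq> 0}" by (simp add: negligible_iff_null_sets)
  then have "q x = 0" for x using open_not_negligible[OF o] by blast
  then show ?thesis using M_nonneg I0 by simp
qed

text \<open>A measurable \<open>q\<close> is almost everywhere a limit of continuous functions.
  Clamping them to the range of \<open>q\<close> and to a fixed ball gives the dominating functions
  for both integrals.\<close>

lemma det_functional_le_bounded:
  assumes q: "q \<in> borel_measurable lebesgue" "\<And>x. 0 \<le> q x" "\<And>x. q x \<le> K" "\<And>x. r < norm x \<Longrightarrow> q x = 0"
  shows "CARD('n option) * (LINT x|\<Omega>. a x * q x) \<le> M * root CARD('n option) ((LINT x|lebesgue. q x ^ CARD('n option)) / unit_ball_vol CARD('n option))"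
proof -
  have K0: "K \<ge> 0" using order_trans[OF q(2) q(3)] .
  have "q measurable_on UNIV" using q(1) by (simp add: measurable_on_iff_borel_measurable)
  then obtain N g where N: "negligible N" and g: "\<And>n. continuous_on UNIV (g n)"
    and lim: "\<And>x. x \<notin> N \<Longrightarrow> (\<lambda>n. g n x) \<longlonglongrightarrow> q x"
    unfolding measurable_on_def by auto
  \<comment> \<open>A continuous factor equal to 1 on the ball of radius \<open>r\<close> and to 0
    outside that of radius \<open>r + 1\<close>, so that the approximants have compact
    support.\<close>
  define c where "c x = max 0 (min 1 (r + 1 - norm x))" for x :: "real^('n option)"
  define p where "p n x = min K (max 0 (g n x)) * c x" for n x
  have c: "0 \<le> c x" "c x \<le> 1" for x by (auto simp: c_def)
  have pc: "continuous_on UNIV (p n)" for n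
    unfolding p_def c_def by (intro continuous_intros g)
  have p0: "0 \<le> p n x" for n x using c K0 by (simp add: p_def)
  have pK: "p n x \<le> K" for n x
  proof -
    have "p n x \<le> K * 1" unfolding p_def using c K0 by (intro mult_mono) auto
    then show ?thesis by simp
  qed
  have pr: "p n x = 0" if "r + 1 < norm x" for n x using that by (simp add: p_def c_def)
  have plim: "(\<lambda>n. p n x) \<longlonglongrightarrow> q x" if "x \<notin> N" for x
  proof -
    have "(\<lambda>n. p n x) \<longlonglongrightarrow> min K (max 0 (q x)) * c x"
      unfolding p_def by (intro tendsto_intros lim[OF that])
    also have "min K (max 0 (q x)) * c x = q x"
      using q(2,3)[of x] q(4)[of x] by (cases "norm x \<le> r") (auto simp: c_def)
    finally show ?thesis .
  qed
  have "N \<in> null_sets lebesgue" using N by (simp add: negligible_iff_null_sets)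
  then have aeN: "AE x in lebesgue. x \<notin> N" by (rule AE_not_in)
  then have aeN': "AE x in \<Omega>. x \<notin> N"
    using slab_sets by (subst AE_restrict_space_iff) auto
  have L1: "(\<lambda>n. LINT x|\<Omega>. a x * p n x) \<longlonglongrightarrow> (LINT x|\<Omega>. a x * q x)"
  proof (rule integral_dominated_convergence[where w="\<lambda>x. a x * K"])
    show "(\<lambda>x. a x * q x) \<in> borel_measurable \<Omega>"
      by (intro borel_measurable_times borel_measurable_integrable[OF integrable_a] measurable_lebesgue_on q(1))
    show "(\<lambda>x. a x * p n x) \<in> borel_measurable \<Omega>" for n
      by (intro borel_measurable_times borel_measurable_integrable[OF integrable_a] measurable_lebesgue_on continuous_imp_borel_lebesgue pc)
    show "integrable \<Omega> (\<lambda>x. a x * K)" using integrable_a by simp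
    show "AE x in \<Omega>. (\<lambda>n. a x * p n x) \<longlonglongrightarrow> a x * q x"
      using aeN' by eventually_elim (intro tendsto_mult tendsto_const plim)
    show "AE x in \<Omega>. norm (a x * p n x) \<le> a x * K" for n
    proof (rule AE_I2)
      fix x show "norm (a x * p n x) \<le> a x * K"
        using p0[of n x] pK[of n x] a_nonneg[of x] by (simp add: abs_mult mult_left_mono)
    qed
  qed
  have L2: "(\<lambda>n. LINT x|lebesgue. p n x ^ CARD('n option)) \<longlonglongrightarrow> (LINT x|lebesgue. q x ^ CARD('n option))"
  proof (rule integral_dominated_convergence[where w="\<lambda>x. K ^ CARD('n option) * indicator (cball 0 (r + 1)) x"])
    show "(\<lambda>x. q x ^ CARD('n option)) \<in> borel_measurable lebesgue" using q(1) by (rule borel_measurable_power)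
    show "(\<lambda>x. p n x ^ CARD('n option)) \<in> borel_measurable lebesgue" for n
      by (intro borel_measurable_power continuous_imp_borel_lebesgue pc)
    show "integrable lebesgue (\<lambda>x. K ^ CARD('n option) * indicator (cball (0 :: real^('n option)) (r + 1)) x :: real)"
      using lmeasurable_cball fmeasurableD2[OF lmeasurable_cball]
      by (intro integrable_mult_right integrable_real_indicator) (auto simp: less_top[symmetric] simp del: emeasure_completion)
    show "AE x in lebesgue. (\<lambda>n. p n x ^ CARD('n option)) \<longlonglongrightarrow> q x ^ CARD('n option)"
      using aeN by eventually_elim (intro tendsto_power plim)
    show "AE x in lebesgue. norm (p n x ^ CARD('n option)) \<le> K ^ CARD('n option) * indicator (cball 0 (r + 1)) x" for n
    proof (rule AE_I2)
      fix x show "norm (p n x ^ CARD('n option)) \<le> K ^ CARD('n option) * indicator (cball 0 (r + 1)) x"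
      proof (cases "x \<in> cball 0 (r + 1)")
        case True
        have "p n x ^ CARD('n option) \<le> K ^ CARD('n option)" using p0 pK by (intro power_mono)
        then show ?thesis using True p0[of n x] by (simp add: power_abs)
      next
        case False
        then show ?thesis using pr[of x n] by simp
      qed
    qed
  qed
  show ?thesis
  proof (rule LIMSEQ_le)
    show "(\<lambda>n. CARD('n option) * (LINT x|\<Omega>. a x * p n x)) \<longlonglongrightarrow> CARD('n option) * (LINT x|\<Omega>. a x * q x)"
      by (intro tendsto_mult tendsto_const L1)
    show "(\<lambda>n. M * root CARD('n option) ((LINT x|lebesgue. p n x ^ CARD('n option)) / unit_ball_vol CARD('n option))) \<longlonglongrightarrow> M * root CARD('n option) ((LINT x|lebesgue. q x ^ CARD('n option)) / unit_ball_vol CARD('n option))"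
      by (intro tendsto_intros L2) (rule less_imp_neq[OF unit_ball_vol_pos, symmetric], simp)
    show "\<exists>N. \<forall>n\<ge>N. CARD('n option) * (LINT x|\<Omega>. a x * p n x) \<le> M * root CARD('n option) ((LINT x|lebesgue. p n x ^ CARD('n option)) / unit_ball_vol CARD('n option))"
      using det_functional_le_continuous[OF pc p0 pr] by blast
  qed
qed

end

section \<open>Solving for the integral, truncation and conclusion\<close>

lemma isoperimetric_algebra:
  fixes I M \<omega> :: real
  assumes I: "I \<ge> 0" and M: "M \<ge> 0" and \<omega>: "\<omega> > 0" and n: "n > 0"
    and le: "real (Suc n) * I \<le> M * root (Suc n) (I / \<omega>)"
  shows "I \<le> 1 / (real (Suc n) * (real (Suc n) * \<omega>) powr (1 / n)) * M powr (1 + 1 / n)"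
proof (cases "I = 0")
  case True
  then show ?thesis by simp
next
  case False
  then have I: "I > 0" using assms by simp
  let ?d = "Suc n"
  have "0 < real ?d * I" using I by simp
  then have M: "M > 0" using le assms(2) by (cases "M = 0") auto
  have "(real ?d * I) ^ ?d \<le> (M * root ?d (I / \<omega>)) ^ ?d" using le I by (intro power_mono) auto
  also have "\<dots> = M ^ ?d * (I / \<omega>)" using I \<omega> by (simp add: power_mult_distrib real_root_pow_pos2 del: power_Suc)
  finally have "real ?d ^ ?d * I ^ n * I \<le> M ^ ?d / \<omega> * I" by (simp add: power_mult_distrib mult_ac)
  \<comment> \<open>Cancelling one factor \<open>I > 0\<close> leaves the power \<open>n\<close>,
    the origin of the exponent \<open>1 / n\<close>.\<close>
  then have "real ?d ^ ?d * I ^ n \<le> M ^ ?d / \<omega>" using I by (simp only: mult_le_cancel_right)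
  then have "I ^ n \<le> M ^ ?d / (real ?d ^ ?d * \<omega>)" using \<omega> by (simp add: field_simps del: power_Suc)
  from le_powr_of_power_le[OF less_imp_le[OF I] this n]
  have "I \<le> (M ^ ?d / (real ?d ^ ?d * \<omega>)) powr (1 / n)" .
  also have "\<dots> = (M ^ ?d) powr (1 / n) / ((real ?d ^ ?d) powr (1 / n) * \<omega> powr (1 / n))"
    using M \<omega> by (simp add: powr_divide powr_mult del: power_Suc)
  also have pw: "(x ^ ?d) powr (1 / n) = x powr (1 + 1 / n)" if "x > 0" for x :: real
  proof -
    have "(x ^ ?d) powr (1 / n) = (x powr real ?d) powr (1 / n)" using that by (simp only: powr_realpow)
    also have "\<dots> = x powr (real ?d * (1 / n))" by (simp only: powr_powr)
    also have "real ?d * (1 / n) = 1 + 1 / n" using n by (simp add: field_simps)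
    finally show ?thesis .
  qed
  \<comment> \<open>The power \<open>1 + 1 / n\<close> of the dimension is split so that one factor
    joins \<open>\<omega>\<close>: their product is the area of the unit sphere.\<close>
  have "(M ^ ?d) powr (1 / n) / ((real ?d ^ ?d) powr (1 / n) * \<omega> powr (1 / n)) =
      M powr (1 + 1 / n) / (real ?d * (real ?d powr (1 / n) * \<omega> powr (1 / n)))"
    unfolding pw[OF M] using pw[of "real ?d"] by (simp add: powr_add del: power_Suc)
  also have "real ?d powr (1 / n) * \<omega> powr (1 / n) = (real ?d * \<omega>) powr (1 / n)"
    using \<omega> by (simp add: powr_mult)
  finally show ?thesis by simp
qed

text \<open>Truncation in height and in space makes the integral finite, and the bound does not
  depend on \<open>k\<close>. With \<open>d = n + 1\<close> and \<open>q\<close> the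
  \<open>d\<close>-th root of \<open>F k\<close>, one has \<open>F k \<le> a q\<close>: the factor
  \<open>F k powr (n / d)\<close> is at most \<open>a\<close> because \<open>F k\<close> is at most
  \<open>det (A x) powr (1 / n)\<close>.\<close>

lemma (in slab_tensor) det_truncated_integral_le:
  defines "n \<equiv> CARD('n)"
  defines "F \<equiv> \<lambda>k x. min (det (A x) powr (1 / n)) (real k) * indicator (cball 0 (real k)) x"
  shows "integrable \<Omega> (F k)"
    "(LINT x|\<Omega>. F k x) \<le> 1 / (real (Suc n) * (real (Suc n) * unit_ball_vol CARD('n option)) powr (1 / n)) * M powr (1 + 1 / n)"
proof -
  let ?f = "\<lambda>x. det (A x) powr (1 / n)"
  have n: "n > 0" by (simp add: n_def)
  have dn: "CARD('n option) = Suc n" by (simp add: n_def)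
  have F0: "0 \<le> F k x" for x by (simp add: F_def)
  have FK: "F k x \<le> real k" for x by (simp add: F_def indicator_def)
  \<comment> \<open>The test density lives on the whole space, whereas \<open>A\<close> is
    controlled only on the slab; hence the extension by 0.\<close>
  define g where "g x = (if x \<in> slab \<tau> then F k x else 0)" for x
  have g0: "0 \<le> g x" "g x \<le> real k" for x using F0 FK by (auto simp: g_def)
  have gr: "g x = 0" if "real k < norm x" for x using that by (simp add: g_def F_def)
  have Fm: "F k \<in> borel_measurable \<Omega>"
  proof -
    have "indicator (cball 0 (real k)) \<in> borel_measurable (lebesgue :: (real^('n option)) measure)"
      by (intro borel_measurable_indicator) auto
    moreover have "?f \<in> borel_measurable \<Omega>" using measurable_det_A by measurable
    ultimately show ?thesis unfolding F_def
      by (intro borel_measurable_times borel_measurable_min borel_measurable_const measurable_lebesgue_on[of "indicator _"])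
  qed
  have gm: "g \<in> borel_measurable lebesgue"
    unfolding g_def using Fm borel_measurable_if[OF slab_sets] by blast
  have gi: "integrable lebesgue g"
  proof (rule Bochner_Integration.integrable_bound[OF _ gm])
    show "integrable lebesgue (\<lambda>x. real k * indicator (cball (0 :: real^('n option)) (real k)) x)"
      using lmeasurable_cball fmeasurableD2[OF lmeasurable_cball]
      by (intro integrable_mult_right integrable_real_indicator) (auto simp: less_top[symmetric] simp del: emeasure_completion)
    show "AE x in lebesgue. norm (g x) \<le> norm (real k * indicator (cball 0 (real k)) x)"
    proof (rule AE_I2)
      fix x show "norm (g x) \<le> norm (real k * indicator (cball 0 (real k)) x)"
        using g0[of x] gr[of x] by (cases "norm x \<le> real k") auto
    qed
  qed
  define q where "q x = g x powr (1 / CARD('n option))" for x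
  have qd: "q x ^ CARD('n option) = g x" for x
  proof (cases "g x = 0")
    case False
    then have "g x > 0" using g0(1)[of x] by simp
    then have "q x ^ CARD('n option) = g x powr (1 / real CARD('n option) * real CARD('n option))"
      unfolding q_def by (subst powr_realpow[symmetric]) (simp, simp only: powr_powr)
    also have "1 / real CARD('n option) * real CARD('n option) = 1" by simp
    finally show ?thesis using \<open>g x > 0\<close> by simp
  qed (simp add: q_def)
  have main: "CARD('n option) * (LINT x|\<Omega>. a x * q x) \<le> M * root CARD('n option) ((LINT x|lebesgue. q x ^ CARD('n option)) / unit_ball_vol CARD('n option))"
  proof (rule det_functional_le_bounded)
    show "q \<in> borel_measurable lebesgue" unfolding q_def using gm by measurable
    show "0 \<le> q x" for x by (simp add: q_def)
    show "q x \<le> real k powr (1 / CARD('n option))" for x unfolding q_def using g0 by (intro powr_mono2) auto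
    show "q x = 0" if "real k < norm x" for x using gr[OF that] by (simp add: q_def)
  qed
  have gF: "(LINT x|lebesgue. g x) = (LINT x|\<Omega>. F k x)"
  proof -
    have "(LINT x|\<Omega>. F k x) = (LINT x|lebesgue. indicator (slab \<tau>) x *\<^sub>R F k x)"
      using slab_sets by (intro integral_restrict_space) auto
    also have "(\<lambda>x. indicator (slab \<tau>) x *\<^sub>R F k x) = g" by (auto simp: g_def indicator_def)
    finally show ?thesis by simp
  qed
  show iF: "integrable \<Omega> (F k)"
  proof -
    have "(\<lambda>x. indicator (slab \<tau>) x *\<^sub>R F k x) = g" by (auto simp: g_def indicator_def)
    then show ?thesis using gi slab_sets by (subst integrable_restrict_space) auto
  qed
  have "CARD('n option) * (LINT x|\<Omega>. F k x) \<le> CARD('n option) * (LINT x|\<Omega>. a x * q x)"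
  proof (intro mult_left_mono integral_mono iF)
    show "integrable \<Omega> (\<lambda>x. a x * q x)"
    proof (rule integrable_a_times[where K="real k powr (1 / CARD('n option))"])
      show "q \<in> borel_measurable \<Omega>" unfolding q_def using gm by (intro measurable_lebesgue_on) measurable
      show "q x \<le> real k powr (1 / CARD('n option))" for x unfolding q_def using g0 by (intro powr_mono2) auto
    qed (simp add: q_def)
    fix x assume "x \<in> space \<Omega>"
    then have x: "x \<in> slab \<tau>" by (simp add: space_restrict_space)
    then have gx: "g x = F k x" by (simp add: g_def)
    have "g x \<le> ?f x" using F0[of x] by (simp add: gx F_def indicator_def)
    then have "g x powr (n / CARD('n option)) \<le> ?f x powr (n / CARD('n option))" using g0 by (intro powr_mono2) auto
    also have "?f x powr (n / CARD('n option)) = a x" using n by (simp add: powr_powr a_def)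
    finally have "g x powr (n / CARD('n option)) * g x powr (1 / CARD('n option)) \<le> a x * q x"
      unfolding q_def by (intro mult_right_mono) auto
    moreover have "g x powr (n / CARD('n option)) * g x powr (1 / CARD('n option)) = g x"
    proof -
      have "real n / real CARD('n option) + 1 / real CARD('n option) = 1" by (simp add: n_def field_simps)
      then show ?thesis using g0(1)[of x] by (simp only: powr_add[symmetric]) simp
    qed
    ultimately show "F k x \<le> a x * q x" by (simp add: gx)
  qed simp
  also note main
  finally have "CARD('n option) * (LINT x|\<Omega>. F k x) \<le> M * root CARD('n option) ((LINT x|\<Omega>. F k x) / unit_ball_vol CARD('n option))"
    unfolding qd gF .
  then have "real (Suc n) * (LINT x|\<Omega>. F k x) \<le> M * root (Suc n) ((LINT x|\<Omega>. F k x) / unit_ball_vol CARD('n option))"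
    unfolding dn .
  moreover have "0 \<le> (LINT x|\<Omega>. F k x)" using F0 by (intro integral_nonneg_AE AE_I2)
  ultimately show "(LINT x|\<Omega>. F k x) \<le> 1 / (real (Suc n) * (real (Suc n) * unit_ball_vol CARD('n option)) powr (1 / n)) * M powr (1 + 1 / n)"
    by (intro isoperimetric_algebra M_nonneg n) simp_all
qed

theorem theorem2p3:
  fixes \<tau> :: real
    and A :: "real^('n::finite option) \<Rightarrow> real^('n option)^('n option)"
    and \<mu>\<^sub>0 \<mu>\<^sub>1 :: "(real^('n option)) set \<Rightarrow> real^('n option)"
    and n :: nat
  assumes n: "n = CARD('n)"
    and "\<tau> > 0"
    and "DPT (slab \<tau>) A"
    and "integrable (lebesgue_on (slab \<tau>)) A"
    and "bounded_vector_measure (borel_slice 0) \<mu>\<^sub>0"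
    and "bounded_vector_measure (borel_slice \<tau>) \<mu>\<^sub>1"
    and "normal_traces_are \<tau> A \<mu>\<^sub>0 \<mu>\<^sub>1"
  shows "integrable (lebesgue_on (slab \<tau>)) (\<lambda>x. det (A x) powr (1 / n)) \<and>
    (LINT x|lebesgue_on (slab \<tau>). det (A x) powr (1 / n))
      \<le> 1 / ((n + 1) * surface_area (sphere (0 :: real^('n option)) 1) powr (1 / n)) *
        (enn2real (total_mass (borel_slice 0) \<mu>\<^sub>0) + enn2real (total_mass (borel_slice \<tau>) \<mu>\<^sub>1))
          powr (1 + 1 / n)"
proof -
  interpret slab_tensor \<tau> A \<mu>\<^sub>0 \<mu>\<^sub>1
    by unfold_locales (use assms in auto)
  let ?f = "\<lambda>x. det (A x) powr (1 / n)"
  define F where "F k x = min (?f x) (real k) * indicator (cball 0 (real k)) x" for k x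
  define B where "B = 1 / (real (Suc n) * (real (Suc n) * unit_ball_vol CARD('n option)) powr (1 / n)) * M powr (1 + 1 / n)"
  have iF: "integrable \<Omega> (F k)" and FB: "(LINT x|\<Omega>. F k x) \<le> B" for k
    using det_truncated_integral_le[of k] unfolding F_def B_def n by blast+
  have mono: "F k x \<le> F (Suc k) x" for k x
    unfolding F_def by (intro mult_mono) (auto simp: indicator_def)
  have incF: "incseq (\<lambda>k. F k x)" for x using mono by (rule incseq_SucI)
  have lim: "(\<lambda>k. F k x) \<longlonglongrightarrow> ?f x" for x
  proof (rule tendsto_eventually)
    obtain N where N: "max (?f x) (norm x) \<le> real N" using real_arch_simple by blast
    show "\<forall>\<^sub>F k in sequentially. F k x = ?f x"
      unfolding eventually_sequentially
    proof (intro exI[of _ N] allI impI)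
      fix k assume "k \<ge> N"
      then have "real N \<le> real k" by simp
      then show "F k x = ?f x" using N by (simp add: F_def)
    qed
  qed
  have "incseq (\<lambda>k. LINT x|\<Omega>. F k x)"
    using mono iF by (intro incseq_SucI integral_mono) auto
  \<comment> \<open>The truncated integrals increase and are bounded by \<open>B\<close>, so
    monotone convergence gives integrability and the bound at once.\<close>
  then obtain L where L: "(\<lambda>k. LINT x|\<Omega>. F k x) \<longlonglongrightarrow> L"
    using incseq_convergent[of _ B] FB by blast
  have fm: "?f \<in> borel_measurable \<Omega>" using measurable_det_A by measurable
  have i: "integrable \<Omega> ?f"
    by (rule integrable_monotone_convergence[OF iF _ _ L fm]) (auto simp: incF lim)
  have "(LINT x|\<Omega>. ?f x) = L"
    by (rule integral_monotone_convergence[OF iF _ _ L fm]) (auto simp: incF lim)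
  also have "L \<le> B" using L FB by (intro LIMSEQ_le_const2[OF L]) auto
  also have "B = 1 / ((n + 1) * surface_area (sphere (0 :: real^('n option)) 1) powr (1 / n)) * M powr (1 + 1 / n)"
    unfolding B_def surface_area_unit_sphere by (simp add: n add.commute)
  finally show ?thesis using i by (simp only: M_def)
qed

end
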